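(* Let $V=(V_x)_{x \in X}$ and $W=(W_x)_{x \in X}$ be Borel fields of separable Banach spaces. Consider the injective tensor products $V \otimes_\vee W = (V_x \otimes_\vee W_x)_{x \in X}$ and projective tensor products $V \otimes_\wedge W = (V_x \otimes_\wedge W_x)_{x \in X}$. Then $V \otimes_\vee W$ has a unique standard Borel structure such that it is a Borel field of separable Banach spaces and the canonical map $V \times_\pi W \to V \otimes_\vee W : (v,w)\mapsto v\otimes w$ is Borel; likewise, $V \otimes_\wedge W$ has a unique standard Borel structure such that it is a Borel field of separable Banach spaces and the canonical map $V \times_\pi W \to V \otimes_\wedge W : (v,w)\mapsto v \otimes w$ is Borel. The canonical map $V \otimes_\wedge W \to V \otimes_\vee W$, given for each $x\in X$ by the contractive linear map $V_x\otimes_\wedge W_x\to V_x\otimes_\vee W_x$ sending $v\otimes w$ to $v\otimes w$, is Borel.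
   Context: Conventions. A standard Borel space is a measurable space isomorphic to a Borel subset of a Polish space. Product spaces carry the product $\sigma$-algebra and subsets the restricted $\sigma$-algebra. For a family of sets $V = (V_x)_{x\in X}$, the symbol $V$ also denotes the disjoint union of the $V_x$, and $\pi : V \to X$ is the map with $\pi(v) = x$ for $v \in V_x$. For two families over $X$, $V \times_\pi W = \{(v,w) \in V \times W \mid \pi(v)=\pi(w)\}$. A section is a map $\varphi : X \to V$ with $\varphi(x)\in V_x$ for all $x$. A sequence of Borel sections $\varphi_n : X \to V$ is dense if $\{\varphi_n(x) \mid n\in\mathbb{N}\}$ is dense in $V_x$ for every $x\in X$. A Borel field of separable Banach spaces (complex scalars) consists of a standard Borel space $X$, a family $V=(V_x)_{x\in X}$ of separable Banach spaces and a standard Borel structure on $V$ such that $\pi : V\to X$, the norm $V\to[0,+\infty)$, the addition $V\times_\pi V\to V$ and the scalar multiplication $\mathbb{C}\times V\to V$ are Borel, and there is a (norm) dense sequence of Borel sections $X\to V$. For Banach spaces $E,F$, $E\otimes_\vee F$ and $E\otimes_\wedge F$ denote the (completed) injective and projective Banach space tensor products. *)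

theory Defs
  imports "HOL-Analysis.Analysis" "HOL-Algebra.Module"
begin

section \<open>Complex Banach spaces with explicit carriers\<close>

text \<open>
  The members of a field \<open>(V\<^sub>x)\<^sub>x\<close> are unrelated spaces, so they are given as \<open>HOL-Algebra\<close>
  modules over the ring of complex numbers, equipped with a norm. Modules extend the record of rings;
  the ring multiplication and unit of a module play no role and are unconstrained.
\<close>

record 'a normed_module = "(complex, 'a) module" +
  nrm :: "'a \<Rightarrow> real"

definition complex_ring :: "complex normed_module" where
  "complex_ring = \<lparr>carrier = UNIV, mult = (*), one = 1, zero = 0, add = (+), smult = (*), nrm = cmod\<rparr>"

locale complex_normed_space = module complex_ring E
  for E :: "'a normed_module" (structure) +
  assumes nrm_eq_0: "a \<in> carrier E \<Longrightarrow> nrm E a = 0 \<longleftrightarrow> a = \<zero>"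
    and nrm_smult: "a \<in> carrier E \<Longrightarrow> nrm E (c \<odot> a) = cmod c * nrm E a"
    and nrm_triangle: "\<lbrakk>a \<in> carrier E; b \<in> carrier E\<rbrakk> \<Longrightarrow> nrm E (a \<oplus> b) \<le> nrm E a + nrm E b"

text \<open>The value 0 off the carrier is there because the locale \<^locale>\<open>Metric_space\<close> requires
  nonnegativity and symmetry on the whole type.\<close>

definition ndist :: "'a normed_module \<Rightarrow> 'a \<Rightarrow> 'a \<Rightarrow> real" where
  "ndist E a b = (if a \<in> carrier E \<and> b \<in> carrier E then nrm E (a \<ominus>\<^bsub>E\<^esub> b) else 0)"

abbreviation norm_topology :: "'a normed_module \<Rightarrow> 'a topology" where
  "norm_topology E \<equiv> Metric_space.mtopology (carrier E) (ndist E)"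

definition complex_banach_space :: "'a normed_module \<Rightarrow> bool" where
  "complex_banach_space E \<longleftrightarrow>
     complex_normed_space E \<and> Metric_space.mcomplete (carrier E) (ndist E)"

definition linear_maps :: "'a normed_module \<Rightarrow> 'b normed_module \<Rightarrow> ('a \<Rightarrow> 'b) set" where
  "linear_maps E F = {f \<in> carrier E \<rightarrow> carrier F.
     (\<forall>a\<in>carrier E. \<forall>b\<in>carrier E. f (a \<oplus>\<^bsub>E\<^esub> b) = f a \<oplus>\<^bsub>F\<^esub> f b) \<and>
     (\<forall>c. \<forall>a\<in>carrier E. f (c \<odot>\<^bsub>E\<^esub> a) = c \<odot>\<^bsub>F\<^esub> f a)}"

definition contractions :: "'a normed_module \<Rightarrow> 'b normed_module \<Rightarrow> ('a \<Rightarrow> 'b) set" where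
  "contractions E F = {f \<in> linear_maps E F. \<forall>a\<in>carrier E. nrm F (f a) \<le> nrm E a}"


section \<open>Completion of a normed space\<close>

text \<open>Cauchy sequences modulo null sequences.\<close>

definition cauchy_equiv :: "'a normed_module \<Rightarrow> ((nat \<Rightarrow> 'a) \<times> (nat \<Rightarrow> 'a)) set" where
  "cauchy_equiv E = {(s, t).
     Metric_space.MCauchy (carrier E) (ndist E) s \<and> Metric_space.MCauchy (carrier E) (ndist E) t \<and>
     (\<lambda>n. ndist E (s n) (t n)) \<longlonglongrightarrow> 0}"

definition completion :: "'a normed_module \<Rightarrow> (nat \<Rightarrow> 'a) set normed_module" where
  "completion E = \<lparr>
     carrier = {s. Metric_space.MCauchy (carrier E) (ndist E) s} // cauchy_equiv E,
     mult = undefined, one = undefined,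
     zero = cauchy_equiv E `` {\<lambda>n. \<zero>\<^bsub>E\<^esub>},
     add = (\<lambda>A B. \<Union>s\<in>A. \<Union>t\<in>B. cauchy_equiv E `` {\<lambda>n. s n \<oplus>\<^bsub>E\<^esub> t n}),
     smult = (\<lambda>c A. \<Union>s\<in>A. cauchy_equiv E `` {\<lambda>n. c \<odot>\<^bsub>E\<^esub> s n}),
     nrm = (\<lambda>A. THE r. \<forall>s\<in>A. (\<lambda>n. nrm E (s n)) \<longlonglongrightarrow> r)\<rparr>"

definition to_completion :: "'a normed_module \<Rightarrow> 'a \<Rightarrow> (nat \<Rightarrow> 'a) set" where
  "to_completion E a = cauchy_equiv E `` {\<lambda>n. a}"


section \<open>Tensor products\<close>

definition bilinear_forms ::
  "'a normed_module \<Rightarrow> 'b normed_module \<Rightarrow> ('a \<Rightarrow> 'b \<Rightarrow> complex) set" where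
  "bilinear_forms E F = {\<beta>.
     (\<forall>w\<in>carrier F. (\<lambda>v. \<beta> v w) \<in> linear_maps E complex_ring) \<and>
     (\<forall>v\<in>carrier E. \<beta> v \<in> linear_maps F complex_ring)}"

text \<open>
  The algebraic tensor product of \<open>E\<close> and \<open>F\<close> is realised as the span of the evaluations
  \<open>v \<otimes> w : \<beta> \<mapsto> \<beta> v w\<close> in the algebraic dual of the space of all bilinear forms on \<open>E \<times> F\<close>.
  A list of pairs \<open>(v\<^sub>i, w\<^sub>i)\<close> represents the tensor \<open>\<Sum>\<^sub>i v\<^sub>i \<otimes> w\<^sub>i\<close>.
\<close>

type_synonym ('a, 'b) tensor = "('a \<Rightarrow> 'b \<Rightarrow> complex) \<Rightarrow> complex"

definition tensor_sum ::
  "'a normed_module \<Rightarrow> 'b normed_module \<Rightarrow> ('a \<times> 'b) list \<Rightarrow> ('a, 'b) tensor" where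
  "tensor_sum E F ps = (\<lambda>\<beta>\<in>bilinear_forms E F. \<Sum>(v, w)\<leftarrow>ps. \<beta> v w)"

definition alg_tensor ::
  "(('a, 'b) tensor \<Rightarrow> real) \<Rightarrow> 'a normed_module \<Rightarrow> 'b normed_module \<Rightarrow>
     ('a, 'b) tensor normed_module" where
  "alg_tensor \<alpha> E F = \<lparr>
     carrier = {tensor_sum E F ps | ps. set ps \<subseteq> carrier E \<times> carrier F},
     mult = undefined, one = undefined,
     zero = (\<lambda>\<beta>\<in>bilinear_forms E F. 0),
     add = (\<lambda>s t. \<lambda>\<beta>\<in>bilinear_forms E F. s \<beta> + t \<beta>),
     smult = (\<lambda>c t. \<lambda>\<beta>\<in>bilinear_forms E F. c * t \<beta>),
     nrm = \<alpha>\<rparr>"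

text \<open>The supremum is over the unit balls of the duals; evaluating \<open>t = \<Sum>\<^sub>i v\<^sub>i \<otimes> w\<^sub>i\<close> at
  the bilinear form \<open>(v, w) \<mapsto> f v * g w\<close> gives \<open>\<Sum>\<^sub>i f v\<^sub>i * g w\<^sub>i\<close>.\<close>

definition inj_norm :: "'a normed_module \<Rightarrow> 'b normed_module \<Rightarrow> ('a, 'b) tensor \<Rightarrow> real" where
  "inj_norm E F t =
     Sup {cmod (t (\<lambda>v w. f v * g w)) | f g.
            f \<in> contractions E complex_ring \<and> g \<in> contractions F complex_ring}"

definition proj_norm :: "'a normed_module \<Rightarrow> 'b normed_module \<Rightarrow> ('a, 'b) tensor \<Rightarrow> real" where
  "proj_norm E F t =
     Inf {\<Sum>(v, w)\<leftarrow>ps. nrm E v * nrm F w | ps.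
            set ps \<subseteq> carrier E \<times> carrier F \<and> t = tensor_sum E F ps}"

type_synonym ('a, 'b) ctensor = "(nat \<Rightarrow> ('a, 'b) tensor) set"

definition inj_tensor ::
  "'a normed_module \<Rightarrow> 'b normed_module \<Rightarrow> ('a, 'b) ctensor normed_module"  (infixl \<open>\<otimes>\<^sub>\<or>\<close> 70)
  where "E \<otimes>\<^sub>\<or> F = completion (alg_tensor (inj_norm E F) E F)"

definition proj_tensor ::
  "'a normed_module \<Rightarrow> 'b normed_module \<Rightarrow> ('a, 'b) ctensor normed_module"  (infixl \<open>\<otimes>\<^sub>\<and>\<close> 70)
  where "E \<otimes>\<^sub>\<and> F = completion (alg_tensor (proj_norm E F) E F)"

definition inj_elem ::
  "'a normed_module \<Rightarrow> 'b normed_module \<Rightarrow> 'a \<Rightarrow> 'b \<Rightarrow> ('a, 'b) ctensor" where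
  "inj_elem E F v w = to_completion (alg_tensor (inj_norm E F) E F) (tensor_sum E F [(v, w)])"

definition proj_elem ::
  "'a normed_module \<Rightarrow> 'b normed_module \<Rightarrow> 'a \<Rightarrow> 'b \<Rightarrow> ('a, 'b) ctensor" where
  "proj_elem E F v w = to_completion (alg_tensor (proj_norm E F) E F) (tensor_sum E F [(v, w)])"

definition canonical_map ::
  "'a normed_module \<Rightarrow> 'b normed_module \<Rightarrow> (('a, 'b) ctensor \<Rightarrow> ('a, 'b) ctensor) \<Rightarrow> bool" where
  "canonical_map E F j \<longleftrightarrow>
     j \<in> contractions (E \<otimes>\<^sub>\<and> F) (E \<otimes>\<^sub>\<or> F) \<and>
     (\<forall>v\<in>carrier E. \<forall>w\<in>carrier F. j (proj_elem E F v w) = inj_elem E F v w)"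


section \<open>Borel fields\<close>

text \<open>
  Measurable spaces are represented by the type \<open>measure\<close>; only \<open>space\<close> and \<open>sets\<close> are used.
  Polish spaces are taken as topologies on subsets of \<open>real\<close>, which is no restriction up to
  homeomorphism since a Polish space has at most continuum many points.
\<close>

definition polish_topology :: "'a topology \<Rightarrow> bool" where
  "polish_topology T \<longleftrightarrow> completely_metrizable_space T \<and> separable_space T"

definition borel_of :: "'a topology \<Rightarrow> 'a measure" where
  "borel_of T = sigma (topspace T) {U. openin T U}"

definition measurable_iso :: "'a measure \<Rightarrow> 'b measure \<Rightarrow> ('a \<Rightarrow> 'b) \<Rightarrow> bool" where
  "measurable_iso M N f \<longleftrightarrow>
     f \<in> M \<rightarrow>\<^sub>M N \<and> bij_betw f (space M) (space N) \<and> the_inv_into (space M) f \<in> N \<rightarrow>\<^sub>M M"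

definition standard_borel :: "'a measure \<Rightarrow> bool" where
  "standard_borel M \<longleftrightarrow>
     (\<exists>(T :: real topology) B f. polish_topology T \<and> B \<in> sets (borel_of T) \<and>
        measurable_iso M (restrict_space (borel_of T) B) f)"

text \<open>The disjoint union of the carriers of a family is \<open>SIGMA x:space X. carrier (V x)\<close>, and the
  projection \<open>\<pi>\<close> is \<^const>\<open>fst\<close>.\<close>

definition fibre_product :: "('x \<times> 'a) measure \<Rightarrow> ('x \<times> 'b) measure \<Rightarrow> (('x \<times> 'a) \<times> ('x \<times> 'b)) measure" where
  "fibre_product M N = restrict_space (M \<Otimes>\<^sub>M N) {(p, q). fst p = fst q}"

definition borel_section :: "'x measure \<Rightarrow> ('x \<times> 'a) measure \<Rightarrow> ('x \<Rightarrow> 'a) \<Rightarrow> bool" where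
  "borel_section X M \<phi> \<longleftrightarrow> (\<lambda>x. (x, \<phi> x)) \<in> X \<rightarrow>\<^sub>M M"

definition borel_banach_field ::
  "'x measure \<Rightarrow> ('x \<Rightarrow> 'a normed_module) \<Rightarrow> ('x \<times> 'a) measure \<Rightarrow> bool" where
  "borel_banach_field X V M \<longleftrightarrow>
     standard_borel X \<and>
     (\<forall>x\<in>space X. complex_banach_space (V x) \<and> separable_space (norm_topology (V x))) \<and>
     standard_borel M \<and>
     space M = (SIGMA x:space X. carrier (V x)) \<and>
     fst \<in> M \<rightarrow>\<^sub>M X \<and>
     (\<lambda>(x, v). nrm (V x) v) \<in> M \<rightarrow>\<^sub>M borel \<and>
     (\<lambda>((x, v), (y, w)). (x, v \<oplus>\<^bsub>V x\<^esub> w)) \<in> fibre_product M M \<rightarrow>\<^sub>M M \<and>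
     (\<lambda>(c, (x, v)). (x, c \<odot>\<^bsub>V x\<^esub> v)) \<in> borel \<Otimes>\<^sub>M M \<rightarrow>\<^sub>M M \<and>
     (\<exists>\<phi> :: nat \<Rightarrow> 'x \<Rightarrow> 'a. (\<forall>n. borel_section X M (\<phi> n)) \<and>
        (\<forall>x\<in>space X. norm_topology (V x) closure_of range (\<lambda>n. \<phi> n x) = carrier (V x)))"

definition inj_tensor_field ::
  "'x measure \<Rightarrow> ('x \<Rightarrow> 'a normed_module) \<Rightarrow> ('x \<times> 'a) measure \<Rightarrow>
     ('x \<Rightarrow> 'b normed_module) \<Rightarrow> ('x \<times> 'b) measure \<Rightarrow> ('x \<times> ('a, 'b) ctensor) measure \<Rightarrow> bool" where
  "inj_tensor_field X V MV W MW M \<longleftrightarrow>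
     borel_banach_field X (\<lambda>x. V x \<otimes>\<^sub>\<or> W x) M \<and>
     (\<lambda>((x, v), (y, w)). (x, inj_elem (V x) (W x) v w)) \<in> fibre_product MV MW \<rightarrow>\<^sub>M M"

definition proj_tensor_field ::
  "'x measure \<Rightarrow> ('x \<Rightarrow> 'a normed_module) \<Rightarrow> ('x \<times> 'a) measure \<Rightarrow>
     ('x \<Rightarrow> 'b normed_module) \<Rightarrow> ('x \<times> 'b) measure \<Rightarrow> ('x \<times> ('a, 'b) ctensor) measure \<Rightarrow> bool" where
  "proj_tensor_field X V MV W MW M \<longleftrightarrow>
     borel_banach_field X (\<lambda>x. V x \<otimes>\<^sub>\<and> W x) M \<and>
     (\<lambda>((x, v), (y, w)). (x, proj_elem (V x) (W x) v w)) \<in> fibre_product MV MW \<rightarrow>\<^sub>M M"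

end

theory Submission
  imports Defs
begin

text \<open>
  Let \<open>\<xi>\<^sub>n\<close> be a dense sequence of sections of a family of separable Banach spaces for which the norms
  \<open>\<parallel>c \<xi>\<^sub>i + \<xi>\<^sub>j - \<xi>\<^sub>k\<parallel>\<close> are Borel. Then \<open>v \<mapsto> (\<pi> v, (\<parallel>v - \<xi>\<^sub>n\<parallel>)\<^sub>n)\<close> embeds the total space into a
  standard Borel space. Its range is Borel, because distance sequences are characterised by
  countably many inequalities, so the pulled back structure is standard. The structure maps are
  Borel for it, being infima of countably many Borel functions by the triangle inequality.
  Conversely, in any Borel field with Borel sections \<open>\<xi>\<^sub>n\<close> this embedding is an injective Borel map on
  a standard Borel space, so by Lusin's separation theorem it generates the whole
  \<open>\<sigma>\<close>-algebra; this is uniqueness.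

  For tensor products \<open>\<xi>\<close> runs through the finite sums of \<open>\<phi>\<^sub>i \<otimes> \<psi>\<^sub>j\<close>. Both tensor norms are suprema,
  over pairs of functionals and over bilinear forms (by Hahn--Banach) respectively, that is, over
  values on the dense sequences subject to countably many closed constraints whose bounds are Borel
  in \<open>x\<close>. By compactness, feasibility of such a system is a Borel condition on \<open>x\<close>.
\<close>

section \<open>Analytic sets and standard Borel spaces\<close>

text \<open>The projective norm is an infimum over exact representations of a tensor, and an exact
  representation cannot be moved into the dense sequences; hence the passage to a supremum over
  bilinear forms, which have countable codes. A dense sequence is not closed under the linear
  operations, so linearity of a code z is expressed by bounding \<open>c * z i + z j - z k\<close>
  by the norm of the same combination of vectors: whenever the k-th vector approximates a
  combination of two others, the values have to follow. One family of inequalities thus yields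
  linearity and continuity together, and rational scalars suffice by continuity. The condition r <
  sup is not closed; it becomes so after adding a margin 1/(n+1) and taking the union over n. The
  same three-term norms are all that is needed to generate a Borel field, so the tensor products can
  be treated as soon as these are Borel. Since \<open>standard_borel\<close> speaks of Polish
  topologies on sets of reals, the space of real sequences has to be transported along an injection
  into the reals.\<close>

lemma closed_image_separation:
  fixes f g :: "'c::{complete_space,second_countable_topology} \<Rightarrow> 'b::t2_space"
  assumes P: "closed P" and Q: "closed Q"
    and f: "continuous_on UNIV f" and g: "continuous_on UNIV g"
    and disj: "f ` P \<inter> g ` Q = {}"
  shows "\<exists>D\<in>sets borel. f ` P \<subseteq> D \<and> g ` Q \<inter> D = {}"
proof (rule ccontr)
  define sep where "sep A B \<longleftrightarrow> (\<exists>D\<in>sets borel. f ` A \<subseteq> D \<and> g ` B \<inter> D = {})" for A B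
  assume "\<not> ?thesis"
  then have nsep: "\<not> sep P Q" by (simp add: sep_def)
  \<comment> \<open>Read contrapositively: when both sets are cut into countably many pieces, some
    pair of pieces remains inseparable.\<close>
  have sep_UN: "sep (\<Union>i. A i) (\<Union>j. B j)" if "\<And>i j. sep (A i) (B j)" for A B :: "nat \<Rightarrow> 'c set"
  proof -
    have "\<forall>i j. \<exists>D. D \<in> sets borel \<and> f ` A i \<subseteq> D \<and> g ` B j \<inter> D = {}"
      using that unfolding sep_def by (meson bexE)
    then obtain D where "\<forall>i j. D i j \<in> sets borel \<and> f ` A i \<subseteq> D i j \<and> g ` B j \<inter> D i j = {}"
      unfolding choice_iff by blast
    then have D: "\<And>i j. D i j \<in> sets borel" "\<And>i j. f ` A i \<subseteq> D i j" "\<And>i j. g ` B j \<inter> D i j = {}"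
      by blast+
    have "(\<Union>i. \<Inter>j. D i j) \<in> sets borel"
      using D(1) by measurable
    moreover have "f ` (\<Union>i. A i) \<subseteq> (\<Union>i. \<Inter>j. D i j)"
      using D(2) by blast
    moreover have "g ` (\<Union>j. B j) \<inter> (\<Union>i. \<Inter>j. D i j) = {}"
      using D(3) by blast
    ultimately show ?thesis unfolding sep_def by blast
  qed
  obtain C :: "'c set" where "countable C" and C: "\<And>U. open U \<Longrightarrow> U \<noteq> {} \<Longrightarrow> \<exists>d\<in>C. d \<in> U"
    using countable_dense_exists by metis
  have "C \<noteq> {}" using C[OF open_UNIV] by auto
  define c where "c = from_nat_into C"
  have cover: "\<exists>i. x \<in> cball (c i) e" if "e > 0" for x e
  proof -
    obtain d where "d \<in> C" "d \<in> ball x e" using C[of "ball x e"] \<open>e > 0\<close> by auto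
    moreover obtain i where "d = c i"
      using \<open>d \<in> C\<close> \<open>countable C\<close> \<open>C \<noteq> {}\<close> unfolding c_def by (metis from_nat_into_surj)
    ultimately show ?thesis by (auto simp: dist_commute intro: less_imp_le)
  qed
  define I where "I S \<longleftrightarrow> closed (fst S) \<and> closed (snd S) \<and> \<not> sep (fst S) (snd S)" for S
  \<comment> \<open>The halving radii make the inseparable pieces shrink to a single point on each
    side, which completeness provides.\<close>
  define R where "R n S S' \<longleftrightarrow> fst S' \<subseteq> fst S \<and> snd S' \<subseteq> snd S \<and>
     (\<exists>a b. fst S' \<subseteq> cball a ((1/2)^n) \<and> snd S' \<subseteq> cball b ((1/2)^n))" for n :: nat and S S' :: "'c set \<times> 'c set"
  have step: "\<exists>S'. I S' \<and> R n S S'" if S: "I S" for S n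
  proof -
    define A where "A i = fst S \<inter> cball (c i) ((1/2)^n)" for i
    define B where "B i = snd S \<inter> cball (c i) ((1/2)^n)" for i
    have "(\<Union>i. A i) = fst S" "(\<Union>i. B i) = snd S"
      using cover[of "(1/2)^n"] unfolding A_def B_def by auto
    then obtain i j where "\<not> sep (A i) (B j)"
      using S sep_UN[of A B] unfolding I_def by auto
    then show ?thesis
      using S by (intro exI[of _ "(A i, B j)"]) (auto simp: I_def R_def A_def B_def)
  qed
  have "\<exists>T. T 0 = (P, Q) \<and> (\<forall>n. I (T n) \<and> R n (T n) (T (Suc n)))"
  proof -
    have "\<exists>T. \<forall>n. (I (T n) \<and> (n = 0 \<longrightarrow> T n = (P, Q))) \<and> R n (T n) (T (Suc n))"
      by (rule dependent_nat_choice) (use P Q nsep step in \<open>auto simp: I_def\<close>)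
    then show ?thesis by blast
  qed
  then obtain T where T0: "T 0 = (P, Q)" and TI: "\<And>n. I (T n)" and TR: "\<And>n. R n (T n) (T (Suc n))"
    by blast
  have mono: "fst (T n) \<subseteq> fst (T m) \<and> snd (T n) \<subseteq> snd (T m)" if "m \<le> n" for m n
    using that
  proof (induction rule: dec_induct)
    case (step n)
    then show ?case using TR[of n] unfolding R_def by blast
  qed simp
  have small: "\<exists>n. (\<forall>x\<in>fst (T n). \<forall>y\<in>fst (T n). dist x y < e) \<and> (\<forall>x\<in>snd (T n). \<forall>y\<in>snd (T n). dist x y < e)"
    if "e > 0" for e
  proof -
    obtain n where n: "(1/2::real)^n < e/2"
      using real_arch_pow_inv[of "e/2" "1/2"] \<open>e > 0\<close> by auto
    obtain a b where ab: "fst (T (Suc n)) \<subseteq> cball a ((1/2)^n)" "snd (T (Suc n)) \<subseteq> cball b ((1/2)^n)"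
      using TR[of n] unfolding R_def by auto
    have *: "dist x y < e" if "x \<in> cball z ((1/2)^n)" "y \<in> cball z ((1/2)^n)" for x y z :: 'c
      using that n dist_triangle3[of x y z] by simp
    show ?thesis
      using ab * by (meson subsetD)
  qed
  \<comment> \<open>An empty piece would be separated by the empty set or by the whole
    space.\<close>
  have ne: "fst (T n) \<noteq> {}" "snd (T n) \<noteq> {}" for n
    using TI[of n] unfolding I_def sep_def by (auto dest: bspec[of _ _ "{}"] bspec[of _ _ UNIV])
  obtain p where p: "\<And>n. p \<in> fst (T n)"
  proof -
    have "\<exists>a. \<forall>n. a \<in> fst (T n)"
    proof (rule decreasing_closed_nest)
      show "\<exists>n. \<forall>x\<in>fst (T n). \<forall>y\<in>fst (T n). dist x y < e" if "e > 0" for e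
        using small[OF that] by blast
    qed (use TI ne mono in \<open>auto simp: I_def\<close>)
    then show ?thesis using that by blast
  qed
  obtain q where q: "\<And>n. q \<in> snd (T n)"
  proof -
    have "\<exists>a. \<forall>n. a \<in> snd (T n)"
    proof (rule decreasing_closed_nest)
      show "\<exists>n. \<forall>x\<in>snd (T n). \<forall>y\<in>snd (T n). dist x y < e" if "e > 0" for e
        using small[OF that] by blast
    qed (use TI ne mono in \<open>auto simp: I_def\<close>)
    then show ?thesis using that by blast
  qed
  \<comment> \<open>The limit points lie in P and Q, so their images differ. Disjoint neighbourhoods
    of the images then separate the n-th pieces for large n, contrary to their choice.\<close>
  have "f p \<noteq> g q"
    using p[of 0] q[of 0] disj T0 by auto
  then obtain U W where UW: "open U" "open W" "f p \<in> U" "g q \<in> W" "U \<inter> W = {}"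
    by (meson hausdorff)
  have "open (f -` U)" "open (g -` W)"
    using f g UW by (auto intro: open_vimage)
  then obtain e1 e2 where e: "e1 > 0" "ball p e1 \<subseteq> f -` U" "e2 > 0" "ball q e2 \<subseteq> g -` W"
    using UW by (metis open_contains_ball vimageI)
  obtain n where n: "\<forall>x\<in>fst (T n). \<forall>y\<in>fst (T n). dist x y < min e1 e2"
     "\<forall>x\<in>snd (T n). \<forall>y\<in>snd (T n). dist x y < min e1 e2"
    using small[of "min e1 e2"] e by auto
  have "fst (T n) \<subseteq> ball p e1" "snd (T n) \<subseteq> ball q e2"
    using n(1)[rule_format, OF p] n(2)[rule_format, OF q] by auto
  then have "sep (fst (T n)) (snd (T n))"
    unfolding sep_def using e UW by (intro bexI[of _ U]) auto
  then show False using TI[of n] unfolding I_def by simp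
qed

text \<open>The space \<open>nat \<Rightarrow> real\<close> plays the role of the Baire space: an index is stored as the value of a
  coordinate, which is harmless because \<open>\<nat>\<close> is closed and discrete in \<open>\<real>\<close>.\<close>

lemma closed_projection_Union:
  fixes F :: "nat \<Rightarrow> ('a::topological_space \<times> (nat \<Rightarrow> real)) set"
  assumes "\<And>k. closed (F k)"
  shows "\<exists>G :: ('a \<times> (nat \<Rightarrow> real)) set. closed G \<and> fst ` G = (\<Union>k. fst ` F k)"
proof -
  define t :: "'a \<times> (nat \<Rightarrow> real) \<Rightarrow> 'a \<times> (nat \<Rightarrow> real)" where "t p = (fst p, \<lambda>i. snd p (Suc i))" for p
  have c0: "continuous_on UNIV (\<lambda>p::'a \<times> (nat \<Rightarrow> real). snd p i)" for i
    by (rule continuous_on_product_then_coordinatewise) (intro continuous_intros)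
  have ct: "continuous_on UNIV t"
    unfolding t_def by (intro continuous_intros c0)
  \<comment> \<open>For an integer value of coordinate 0, the inequality with 1/2 says that the
    stored index is not k, and says it by a closed condition.\<close>
  define G where "G = {p. snd p 0 \<in> \<nat>} \<inter> (\<Inter>k. {p. \<bar>snd p 0 - real k\<bar> \<ge> 1/2} \<union> t -` F k)"
  have "closed {p::'a \<times> (nat \<Rightarrow> real). snd p 0 \<in> \<nat>}"
    using closed_vimage[OF closed_Nats c0[of 0]] by (simp add: vimage_def)
  moreover have "closed {p::'a \<times> (nat \<Rightarrow> real). \<bar>snd p 0 - real k\<bar> \<ge> 1/2}" for k
    by (intro closed_Collect_le continuous_intros c0)
  moreover have "closed (t -` F k)" for k
    by (rule closed_vimage[OF assms ct])
  ultimately have "closed G"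
    unfolding G_def by (intro closed_Int closed_INT closed_Un ballI)
  moreover have "fst ` G = (\<Union>k. fst ` F k)"
  proof (intro equalityI subsetI)
    fix x assume "x \<in> fst ` G"
    then obtain y where y: "(x, y) \<in> G" by force
    then obtain k where "y 0 = real k" unfolding G_def by (auto elim: Nats_cases)
    moreover have "\<bar>y 0 - real k\<bar> \<ge> 1/2 \<or> t (x, y) \<in> F k" using y unfolding G_def by auto
    ultimately have "t (x, y) \<in> F k" by simp
    then show "x \<in> (\<Union>k. fst ` F k)" unfolding t_def by force
  next
    fix x assume "x \<in> (\<Union>k. fst ` F k)"
    then obtain k y where y: "(x, y) \<in> F k" by force
    define z where "z i = (case i of 0 \<Rightarrow> real k | Suc j \<Rightarrow> y j)" for i
    have "t (x, z) = (x, y)" by (simp add: t_def z_def)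
    moreover have "\<bar>real k - real j\<bar> \<ge> 1/2" if "j \<noteq> k" for j
      using that by (cases "j < k") auto
    ultimately have "\<bar>real k - real j\<bar> \<ge> 1/2 \<or> t (x, z) \<in> F j" for j
      using y by (cases "j = k") auto
    then have "(x, z) \<in> G"
      unfolding G_def by (auto simp: z_def)
    then show "x \<in> fst ` G" by force
  qed
  ultimately show ?thesis by blast
qed

text \<open>A point of the intersection has one witness for each k; \<open>prod_encode\<close>
  interleaves them into a single sequence from which each k reads its own part.\<close>

lemma closed_projection_Inter:
  fixes F :: "nat \<Rightarrow> ('a::topological_space \<times> (nat \<Rightarrow> real)) set"
  assumes "\<And>k. closed (F k)"
  shows "\<exists>G :: ('a \<times> (nat \<Rightarrow> real)) set. closed G \<and> fst ` G = (\<Inter>k. fst ` F k)"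
proof -
  define t :: "nat \<Rightarrow> 'a \<times> (nat \<Rightarrow> real) \<Rightarrow> 'a \<times> (nat \<Rightarrow> real)"
    where "t k p = (fst p, \<lambda>i. snd p (prod_encode (k, i)))" for k p
  have c0: "continuous_on UNIV (\<lambda>p::'a \<times> (nat \<Rightarrow> real). snd p i)" for i
    by (rule continuous_on_product_then_coordinatewise) (intro continuous_intros)
  have ct: "continuous_on UNIV (t k)" for k
    unfolding t_def by (intro continuous_intros c0)
  define G where "G = (\<Inter>k. t k -` F k)"
  have "closed G"
    unfolding G_def by (intro closed_INT ballI closed_vimage assms ct)
  moreover have "fst ` G = (\<Inter>k. fst ` F k)"
  proof (intro equalityI subsetI)
    fix x assume "x \<in> fst ` G"
    then obtain y where "(x, y) \<in> G" by force
    then show "x \<in> (\<Inter>k. fst ` F k)" unfolding G_def t_def by force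
  next
    fix x assume "x \<in> (\<Inter>k. fst ` F k)"
    then have "\<exists>y. (x, y) \<in> F k" for k by force
    then obtain y where y: "\<And>k. (x, y k) \<in> F k" by metis
    define z where "z i = (case prod_decode i of (k, j) \<Rightarrow> y k j)" for i
    have "t k (x, z) = (x, y k)" for k by (simp add: t_def z_def)
    then have "(x, z) \<in> G" using y unfolding G_def by auto
    then show "x \<in> fst ` G" by force
  qed
  ultimately show ?thesis by blast
qed

text \<open>The class of such projections is stable under countable unions and intersections. It
  contains the open sets because in a metric space these are countable unions of closed sets, namely
  of the points at distance at least 1/(n+1) from the complement.\<close>

lemma borel_eq_closed_projection:
  fixes C :: "'a::metric_space set"
  assumes "C \<in> sets borel"
  shows "\<exists>F :: ('a \<times> (nat \<Rightarrow> real)) set. closed F \<and> C = fst ` F"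
proof -
  define An where "An C \<longleftrightarrow> (\<exists>F :: ('a \<times> (nat \<Rightarrow> real)) set. closed F \<and> C = fst ` F)" for C
  have cl: "An C" if "closed C" for C
    unfolding An_def using that by (intro exI[of _ "C \<times> UNIV"]) (auto intro: closed_Times)
  have Un: "An (\<Union>k. C k)" if "\<And>k. An (C k)" for C :: "nat \<Rightarrow> _"
  proof -
    have "\<forall>k. \<exists>F :: ('a \<times> (nat \<Rightarrow> real)) set. closed F \<and> C k = fst ` F"
      using that by (simp add: An_def)
    then obtain F :: "nat \<Rightarrow> ('a \<times> (nat \<Rightarrow> real)) set" where "\<forall>k. closed (F k) \<and> C k = fst ` F k"
      unfolding choice_iff by blast
    then have F: "\<And>k. closed (F k)" "\<And>k. C k = fst ` F k" by simp_all
    obtain G :: "('a \<times> (nat \<Rightarrow> real)) set" where G: "closed G" "fst ` G = (\<Union>k. fst ` F k)"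
      using closed_projection_Union[of F, OF F(1)] by (elim exE conjE)
    show ?thesis
      unfolding An_def using G by (intro exI[of _ G]) (simp add: F(2))
  qed
  have Int: "An (\<Inter>k. C k)" if "\<And>k. An (C k)" for C :: "nat \<Rightarrow> _"
  proof -
    have "\<forall>k. \<exists>F :: ('a \<times> (nat \<Rightarrow> real)) set. closed F \<and> C k = fst ` F"
      using that by (simp add: An_def)
    then obtain F :: "nat \<Rightarrow> ('a \<times> (nat \<Rightarrow> real)) set" where "\<forall>k. closed (F k) \<and> C k = fst ` F k"
      unfolding choice_iff by blast
    then have F: "\<And>k. closed (F k)" "\<And>k. C k = fst ` F k" by simp_all
    obtain G :: "('a \<times> (nat \<Rightarrow> real)) set" where G: "closed G" "fst ` G = (\<Inter>k. fst ` F k)"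
      using closed_projection_Inter[of F, OF F(1)] by (elim exE conjE)
    show ?thesis
      unfolding An_def using G by (intro exI[of _ G]) (simp add: F(2))
  qed
  have op: "An (- C)" if C: "closed C" for C
  proof (cases "C = {}")
    case False
    define D where "D n = {x. infdist x C \<ge> 1 / real (Suc n)}" for n
    have "closed (D n)" for n
      unfolding D_def by (intro closed_Collect_le continuous_intros)
    moreover have "- C = (\<Union>n. D n)"
    proof (intro equalityI subsetI)
      fix x assume "x \<in> - C"
      then have "infdist x C > 0"
        using in_closed_iff_infdist_zero[OF C False] infdist_nonneg[of x C] by (metis ComplD less_eq_real_def)
      then obtain n where "inverse (real (Suc n)) < infdist x C"
        using reals_Archimedean by blast
      then show "x \<in> (\<Union>n. D n)" by (auto simp: D_def inverse_eq_divide intro!: exI[of _ n])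
    next
      fix x assume "x \<in> (\<Union>n. D n)"
      then obtain n where n: "infdist x C \<ge> 1 / real (Suc n)" by (auto simp: D_def)
      have "1 / real (Suc n) > 0" by simp
      with n have "infdist x C \<noteq> 0" by linarith
      then show "x \<in> - C" by (metis ComplI infdist_zero)
    qed
    ultimately show ?thesis using Un[of D] cl by simp
  qed (use cl in simp)
  have "C \<in> sigma_sets UNIV (Collect closed)"
    using assms by (simp add: borel_eq_closed)
  \<comment> \<open>The complement is carried through the induction because \<open>An\<close> is not
    known to pass to complements; a union then turns into an intersection.\<close>
  then have "An C \<and> An (- C)"
  proof (induction rule: sigma_sets.induct)
    case (Basic a)
    then show ?case using cl op by simp
  next
    case Empty
    show ?case using cl by simp
  next
    case (Compl a)
    then show ?case by (simp add: Compl_eq_Diff_UNIV[symmetric])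
  next
    case (Union a)
    moreover have "- (\<Union>i. a i) = (\<Inter>i. - a i)" by auto
    ultimately show ?case using Un[of a] Int[of "\<lambda>i. - a i"] by simp
  qed
  then show ?thesis by (simp add: An_def)
qed

section \<open>Complete separable metric spaces as Borel sets of distance sequences\<close>

lemma (in Metric_space) distance_sequence_iff:
  assumes compl: mcomplete and cM: "range c \<subseteq> M" and dense: "mtopology closure_of range c = M"
  shows "(\<exists>x\<in>M. \<forall>n. a n = d x (c n)) \<longleftrightarrow>
    (\<forall>n m. \<bar>a n - a m\<bar> \<le> d (c n) (c m) \<and> d (c n) (c m) \<le> a n + a m) \<and>
    (\<forall>k. \<exists>n. a n < 1 / real (Suc k))" (is "?L \<longleftrightarrow> ?R")
proof
  assume ?L
  then obtain x where x: "x \<in> M" and a: "\<And>n. a n = d x (c n)" by blast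
  have c: "c n \<in> M" for n using cM by auto
  have "\<bar>a n - a m\<bar> \<le> d (c n) (c m) \<and> d (c n) (c m) \<le> a n + a m" for n m
    using triangle[of x "c n" "c m"] triangle[of x "c m" "c n"] triangle[of "c n" x "c m"] x c
    by (auto simp: a commute)
  moreover have "\<exists>n. a n < 1 / real (Suc k)" for k
  proof -
    have "x \<in> mtopology closure_of range c" using x dense by simp
    then have "\<exists>y\<in>range c. y \<in> mball x (1 / real (Suc k))"
      unfolding metric_closure_of by auto
    then show ?thesis by (auto simp: a)
  qed
  ultimately show ?R by blast
next
  assume R: ?R
  have c: "c n \<in> M" for n using cM by auto
  \<comment> \<open>The points \<open>c (N k)\<close> form a Cauchy sequence because d (c n) (c m)
    is at most a n + a m. The limit has the prescribed distances because a is 1-Lipschitz along c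
    and tends to 0 along N.\<close>
  obtain N where N: "\<And>k. a (N k) < 1 / real (Suc k)" using R by metis
  have "MCauchy (\<lambda>k. c (N k))"
    unfolding MCauchy_def
  proof (intro conjI allI impI)
    fix e :: real assume "e > 0"
    then obtain K where K: "inverse (real (Suc K)) < e/2" using reals_Archimedean[of "e/2"] by auto
    have "d (c (N n)) (c (N m)) < e" if "K \<le> n" "K \<le> m" for n m
    proof -
      have "1 / real (Suc n) \<le> inverse (real (Suc K))" "1 / real (Suc m) \<le> inverse (real (Suc K))"
        using that by (auto simp: field_simps)
      then show ?thesis using R N[of n] N[of m] K by (smt (verit) field_sum_of_halves)
    qed
    then show "\<exists>K. \<forall>n n'. K \<le> n \<longrightarrow> K \<le> n' \<longrightarrow> d (c (N n)) (c (N n')) < e" by blast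
  qed (use c in auto)
  then obtain x where x: "limitin mtopology (\<lambda>k. c (N k)) x sequentially"
    using compl unfolding mcomplete_def by blast
  then have xM: "x \<in> M" and lim: "\<And>e. e > 0 \<Longrightarrow> \<exists>K. \<forall>k\<ge>K. d (c (N k)) x < e"
    unfolding limit_metric_sequentially by blast+
  have "a n = d x (c n)" for n
  proof -
    have "\<bar>a n - d x (c n)\<bar> \<le> e" if e: "e > 0" for e
    proof -
      obtain K where K: "\<forall>k\<ge>K. d (c (N k)) x < e/2" using lim[OF half_gt_zero[OF e]] by blast
      obtain K' where K': "inverse (real (Suc K')) < e/2" using reals_Archimedean[OF half_gt_zero[OF e]] by blast
      define k where "k = max K K'"
      have "1 / real (Suc k) \<le> inverse (real (Suc K'))"
        by (auto simp: field_simps k_def)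
      moreover have "d (c (N k)) x < e/2" using K by (simp add: k_def)
      moreover have "d x (c n) \<le> d (c (N k)) x + d (c (N k)) (c n)" "d (c (N k)) (c n) \<le> d (c (N k)) x + d x (c n)"
        using triangle[of x "c (N k)" "c n"] triangle[of "c (N k)" x "c n"] xM c by (auto simp: commute)
      moreover have "\<bar>a n - a (N k)\<bar> \<le> d (c n) (c (N k))" "d (c n) (c (N k)) \<le> a n + a (N k)"
        using R by blast+
      ultimately show ?thesis
        using K' N[of k] commute[of "c n" "c (N k)"] by (smt (verit) field_sum_of_halves)
    qed
    then have "\<bar>a n - d x (c n)\<bar> \<le> 0" by (rule field_le_epsilon[of _ 0, simplified])
    then show ?thesis by simp
  qed
  then show ?L using xM by blast
qed

lemma measurable_to_fun_borel:
  fixes f :: "'a \<Rightarrow> 'i::countable \<Rightarrow> 'b::second_countable_topology"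
  assumes "\<And>i. (\<lambda>x. f x i) \<in> borel_measurable M"
  shows "f \<in> borel_measurable M"
  using assms by (rule measurable_coordinatewise_then_product)

text \<open>A Polish space is embedded by its distances to a dense sequence. The range is Borel by
  \<open>distance_sequence_iff\<close>, and a ball centred in the sequence goes to the trace on the
  range of a half space in one coordinate, so images of open sets, and then of Borel sets, are
  Borel.\<close>

lemma standard_borel_embedding:
  assumes "standard_borel M"
  shows "\<exists>e :: 'a \<Rightarrow> nat \<Rightarrow> real. e \<in> borel_measurable M \<and> inj_on e (space M) \<and> (\<forall>A\<in>sets M. e ` A \<in> sets borel)"
proof -
  obtain T :: "real topology" and B f where T: "polish_topology T" and B: "B \<in> sets (borel_of T)"
    and f: "measurable_iso M (restrict_space (borel_of T) B) f"
    using assms unfolding standard_borel_def by blast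
  have spT: "space (borel_of T) = topspace T" and
    setsT: "sets (borel_of T) = sigma_sets (topspace T) {U. openin T U}"
    unfolding borel_of_def by (intro space_measure_of sets_measure_of; auto dest: openin_subset)+
  obtain S d where "Metric_space S d" and compl: "Metric_space.mcomplete S d" and Td: "T = Metric_space.mtopology S d"
    using T unfolding polish_topology_def completely_metrizable_space_def by blast
  then interpret Metric_space S d by blast
  have topT: "topspace T = S" using Td by simp
  have "\<exists>\<kappa> :: real \<Rightarrow> nat \<Rightarrow> real. \<kappa> \<in> borel_measurable (borel_of T) \<and> inj_on \<kappa> S \<and> (\<forall>A\<in>sets (borel_of T). \<kappa> ` A \<in> sets borel)"
  \<comment> \<open>The empty space has no dense sequence and is treated apart.\<close>
  proof (cases "S = {}")
    case True
    have *: "A = {}" if "A \<in> sets (borel_of T)" for A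
      using sets.sets_into_space[OF that] True spT topT by auto
    show ?thesis
    proof (intro exI[of _ "\<lambda>_ _. 0"] conjI ballI)
      show "(\<lambda>_ _. 0) ` A \<in> sets borel" if "A \<in> sets (borel_of T)" for A
        using *[OF that] by simp
    qed (use True in simp_all)
  next
    case False
    obtain C where C: "countable C" "C \<subseteq> S" "mtopology closure_of C = S"
      using T topT Td unfolding polish_topology_def separable_space_def by auto
    have "C \<noteq> {}" using C False by auto
    define c where "c = from_nat_into C"
    have rc: "range c = C" unfolding c_def using C \<open>C \<noteq> {}\<close> by (simp add: range_from_nat_into)
    have c: "c n \<in> S" for n using rc C by auto
    define \<kappa> where "\<kappa> x = (\<lambda>n. d x (c n))" for x
    have "(\<lambda>x. d x (c n)) \<in> borel_measurable (borel_of T)" for n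
    proof (rule borel_measurableI)
      fix W :: "real set" assume "open W"
      have "continuous_map T euclidean (\<lambda>x. d x (c n))"
        using continuous_map_mdist[of T "metric (S, d)" "\<lambda>x. x" "\<lambda>x. c n"] c unfolding Td
        by (simp add: mtopology_of_def mspace_metric mdist_metric)
      then have "openin T {x \<in> topspace T. d x (c n) \<in> W}"
        using \<open>open W\<close> by (simp add: openin_continuous_map_preimage)
      moreover have "(\<lambda>x. d x (c n)) -` W \<inter> space (borel_of T) = {x \<in> topspace T. d x (c n) \<in> W}"
        using spT by auto
      ultimately show "(\<lambda>x. d x (c n)) -` W \<inter> space (borel_of T) \<in> sets (borel_of T)"
        unfolding setsT by (auto intro: sigma_sets.Basic)
    qed
    then have meas: "\<kappa> \<in> borel_measurable (borel_of T)"
      unfolding \<kappa>_def by (intro measurable_to_fun_borel)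
    define K where "K = {a. (\<forall>n m. \<bar>a n - a m\<bar> \<le> d (c n) (c m) \<and> d (c n) (c m) \<le> a n + a m) \<and>
      (\<forall>k. \<exists>n. a n < 1 / real (Suc k))}"
    have im: "\<kappa> ` S = K"
    proof -
      have *: "a \<in> \<kappa> ` S \<longleftrightarrow> (\<exists>x\<in>S. \<forall>n. a n = d x (c n))" for a
        by (auto simp: \<kappa>_def fun_eq_iff image_iff)
      have "range c \<subseteq> S" "mtopology closure_of range c = S" using C rc by auto
      from distance_sequence_iff[OF compl this] show ?thesis
        unfolding set_eq_iff K_def mem_Collect_eq * by simp
    qed
    have K: "K \<in> sets borel"
      unfolding K_def by measurable
    have near: "\<exists>n. d x (c n) < r" if "x \<in> S" "r > 0" for x r
    proof -
      have "x \<in> mtopology closure_of range c" using C rc that by simp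
      then have "\<exists>y\<in>range c. y \<in> mball x r"
        unfolding metric_closure_of using that by auto
      then show ?thesis by auto
    qed
    have inj: "inj_on \<kappa> S"
    proof (rule inj_onI)
      fix x y assume xy: "x \<in> S" "y \<in> S" "\<kappa> x = \<kappa> y"
      have "d x y \<le> e" if "e > 0" for e
      proof -
        obtain n where "d x (c n) < e/2" using near[of x "e/2"] xy \<open>e > 0\<close> by auto
        moreover have "d y (c n) = d x (c n)" using xy by (auto simp: \<kappa>_def fun_eq_iff)
        ultimately show ?thesis using triangle[of x "c n" y] xy c commute[of y "c n"] by auto
      qed
      then have "d x y \<le> 0" by (rule field_le_epsilon[of _ 0, simplified])
      then show "x = y" using xy by (metis antisym nonneg zero)
    qed
    have op: "\<kappa> ` U \<in> sets borel" if U: "openin T U" for U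
    proof -
      have sub: "U \<subseteq> S" using U topT openin_subset by blast
      \<comment> \<open>Balls with centres in the dense sequence and radii 1/(k+1) form a countable
        base, so only countably many half spaces are involved.\<close>
      define I where "I = {(n, k). mball (c n) (1 / real (Suc k)) \<subseteq> U}"
      have "U = (\<Union>(n, k)\<in>I. mball (c n) (1 / real (Suc k)))"
      proof (intro equalityI subsetI)
        fix x assume x: "x \<in> U"
        then obtain r where r: "r > 0" "mball x r \<subseteq> U"
          using U unfolding Td openin_mtopology by blast
        obtain k where k: "inverse (real (Suc k)) < r/2" using reals_Archimedean[of "r/2"] r by auto
        obtain n where n: "d x (c n) < 1 / real (Suc k)" using near[of x "1 / real (Suc k)"] x sub by auto
        have "mball (c n) (1 / real (Suc k)) \<subseteq> mball x r"
        proof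
          fix y assume "y \<in> mball (c n) (1 / real (Suc k))"
          then show "y \<in> mball x r"
            using triangle[of x "c n" y] n k x sub c by (auto simp: inverse_eq_divide)
        qed
        then have "(n, k) \<in> I" using r by (auto simp: I_def)
        moreover have "x \<in> mball (c n) (1 / real (Suc k))" using n x sub c by (auto simp: commute)
        ultimately show "x \<in> (\<Union>(n, k)\<in>I. mball (c n) (1 / real (Suc k)))" by blast
      qed (auto simp: I_def)
      then have "\<kappa> ` U = (\<Union>p\<in>I. \<kappa> ` mball (c (fst p)) (1 / real (Suc (snd p))))"
        by (simp add: split_beta image_UN)
      also have "\<dots> = (\<Union>p\<in>I. K \<inter> {a. a (fst p) < 1 / real (Suc (snd p))})"
      proof -
        have "\<kappa> ` mball (c n) r = K \<inter> {a. a n < r}" for n r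
          unfolding im[symmetric] using c by (auto simp: \<kappa>_def commute[of "c n"])
        then show ?thesis by simp
      qed
      also have "\<dots> \<in> sets borel"
      proof (rule sets.countable_UN')
        show "(\<lambda>p. K \<inter> {a. a (fst p) < 1 / real (Suc (snd p))}) ` I \<subseteq> sets borel"
        proof safe
          fix n m
          have "{a::nat \<Rightarrow> real. a n < r} \<in> sets borel" for r by measurable
          then show "K \<inter> {a. a (fst (n, m)) < 1 / real (Suc (snd (n, m)))} \<in> sets borel"
            using K by auto
        qed
      qed (rule countable_subset[OF subset_UNIV], simp)
      finally show ?thesis .
    qed
    have "\<kappa> ` A \<in> sets borel" if "A \<in> sets (borel_of T)" for A
      using that[unfolded setsT]
    proof (induction rule: sigma_sets.induct)
      case (Compl a)
      have "a \<subseteq> S"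
        using sigma_sets_into_sp[OF _ Compl(1)] topT openin_subset by blast
      then have "\<kappa> ` (topspace T - a) = K - \<kappa> ` a"
        using inj im topT by (metis inj_on_image_set_diff Diff_subset order_refl)
      then show ?case using K Compl by simp
    next
      case (Union a)
      then show ?case by (simp add: image_UN)
    qed (use op in auto)
    then show ?thesis using meas inj by blast
  qed
  then obtain \<kappa> :: "real \<Rightarrow> nat \<Rightarrow> real" where \<kappa>: "\<kappa> \<in> borel_measurable (borel_of T)" "inj_on \<kappa> S"
    "\<And>A. A \<in> sets (borel_of T) \<Longrightarrow> \<kappa> ` A \<in> sets borel" by blast
  let ?R = "restrict_space (borel_of T) B"
  have spR: "space ?R = B" using B by (simp add: space_restrict_space2)
  have fm: "f \<in> M \<rightarrow>\<^sub>M ?R" and bij: "bij_betw f (space M) B" and inv: "the_inv_into (space M) f \<in> ?R \<rightarrow>\<^sub>M M"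
    using f spR unfolding measurable_iso_def by auto
  have BS: "B \<subseteq> S" using B spT topT sets.sets_into_space by blast
  have "f \<in> M \<rightarrow>\<^sub>M borel_of T"
    using fm by (simp add: measurable_restrict_space2_iff)
  then have "\<kappa> \<circ> f \<in> borel_measurable M"
    by (rule measurable_comp) (rule \<kappa>(1))
  moreover have "inj_on (\<kappa> \<circ> f) (space M)"
    using bij \<kappa>(2) BS by (intro comp_inj_on) (auto simp: bij_betw_def intro: inj_on_subset)
  moreover have "(\<kappa> \<circ> f) ` A \<in> sets borel" if A: "A \<in> sets M" for A
  proof -
    have AM: "A \<subseteq> space M" using A sets.sets_into_space by blast
    have "f ` A = the_inv_into (space M) f -` A \<inter> B"
    proof (intro equalityI subsetI)
      fix y assume "y \<in> f ` A"
      then show "y \<in> the_inv_into (space M) f -` A \<inter> B"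
        using AM bij by (auto simp: bij_betw_def the_inv_into_f_f subset_iff)
    next
      fix y assume y: "y \<in> the_inv_into (space M) f -` A \<inter> B"
      then have "f (the_inv_into (space M) f y) = y"
        using bij by (auto simp: bij_betw_def intro: f_the_inv_into_f)
      then show "y \<in> f ` A" using y by force
    qed
    also have "\<dots> \<in> sets ?R" using measurable_sets[OF inv A] spR by simp
    finally have "f ` A \<in> sets (borel_of T)" using B by (simp add: sets_restrict_space_iff)
    then show ?thesis using \<kappa>(3)[of "f ` A"] by (simp add: image_image)
  qed
  ultimately show ?thesis by blast
qed

section \<open>Injecting real sequences into the real line\<close>

lemma inj_nat_set_real: "\<exists>i :: nat set \<Rightarrow> real. inj i"
proof -
  \<comment> \<open>Base 3 with digits 0 and 1 avoids double expansions: the whole tail behind the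
    first differing digit is worth at most half of that digit.\<close>
  define i :: "nat set \<Rightarrow> real" where "i S = (\<Sum>n. indicat_real S n * (1/3)^n)" for S
  have geo: "summable (\<lambda>n. (1/3::real)^n)" by (simp add: summable_geometric)
  have sm: "summable (\<lambda>n. indicat_real S n * (1/3)^n)" for S
    by (rule summable_comparison_test'[OF geo, of 0]) (simp add: indicator_def)
  have lt: "i S < i T" if n: "n \<in> T" "n \<notin> S" and eq: "\<And>k. k < n \<Longrightarrow> k \<in> S \<longleftrightarrow> k \<in> T" for S T n
  proof -
    define p where "p = (\<Sum>k<n. indicat_real S k * (1/3)^k)"
    have "p = (\<Sum>k<n. indicat_real T k * (1/3)^k)"
      unfolding p_def using eq by (intro sum.cong) (auto simp: indicator_def)
    then have T: "i T = p + (\<Sum>k. indicat_real T (k + n) * (1/3)^(k + n))"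
      unfolding i_def using suminf_split_initial_segment[OF sm[of T], of n] by simp
    have S: "i S = p + (\<Sum>k. indicat_real S (k + n) * (1/3)^(k + n))"
      unfolding i_def p_def using suminf_split_initial_segment[OF sm[of S], of n] by simp
    have smn: "summable (\<lambda>k. indicat_real S (k + n) * (1/3)^(k + n))" for S
      using sm[of S] by (subst summable_iff_shift[of "\<lambda>k. indicat_real S k * (1/3)^k"])
    have "(1/3)^n \<le> (\<Sum>k. indicat_real T (k + n) * (1/3)^(k + n))"
      using sum_le_suminf[OF smn[of T], of "{0}"] n by (simp add: indicator_def)
    moreover have "(\<Sum>k. indicat_real S (k + n) * (1/3)^(k + n)) < (1/3)^n"
    proof -
      have smn': "summable (\<lambda>k. indicat_real S (Suc k + n) * (1/3)^(Suc k + n))"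
        using smn[of S] by (subst summable_Suc_iff[of "\<lambda>k. indicat_real S (k + n) * (1/3)^(k + n)"])
      have geo': "(\<lambda>k. (1/3)^Suc n * (1/3::real)^k) sums ((1/3)^Suc n * (1 / (1 - 1/3)))"
        by (intro sums_mult geometric_sums) simp
      have "(\<Sum>k. indicat_real S (k + n) * (1/3)^(k + n)) = (\<Sum>k. indicat_real S (Suc k + n) * (1/3)^(Suc k + n))"
        using suminf_split_head[OF smn[of S]] n by simp
      also have "\<dots> \<le> (\<Sum>k. (1/3)^Suc n * (1/3)^k)"
        by (rule suminf_le[OF _ smn' sums_summable[OF geo']]) (auto simp: indicator_def power_add)
      also have "\<dots> = (1/3)^Suc n * (3/2)" using sums_unique[OF geo'] by simp
      also have "\<dots> < (1/3)^n" by simp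
      finally show ?thesis .
    qed
    ultimately show ?thesis using S T by linarith
  qed
  have "inj i"
  proof (rule injI, rule ccontr)
    fix S T assume e: "i S = i T" and "S \<noteq> T"
    then have ex: "\<exists>n. (n \<in> S) \<noteq> (n \<in> T)" by auto
    define n where "n = (LEAST n. (n \<in> S) \<noteq> (n \<in> T))"
    have "(n \<in> S) \<noteq> (n \<in> T)" unfolding n_def using ex by (rule LeastI_ex)
    moreover have "k \<in> S \<longleftrightarrow> k \<in> T" if "k < n" for k
      using not_less_Least[of k "\<lambda>n. (n \<in> S) \<noteq> (n \<in> T)"] that unfolding n_def by auto
    ultimately show False using lt[of n S T] lt[of n T S] e by auto
  qed
  then show ?thesis by blast
qed

text \<open>A real sequence is determined by the pairs of an index n and a rational below its n-th
  term, and such pairs are coded by natural numbers.\<close>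

lemma inj_real_seq_real: "\<exists>i :: (nat \<Rightarrow> real) \<Rightarrow> real. inj i"
proof -
  obtain i :: "nat set \<Rightarrow> real" where "inj i" using inj_nat_set_real by blast
  define h :: "(nat \<Rightarrow> real) \<Rightarrow> nat set"
    where "h a = {m. of_rat (from_nat (snd (prod_decode m))) < a (fst (prod_decode m))}" for a
  have "inj h"
  proof (rule injI)
    fix a b :: "nat \<Rightarrow> real" assume ab: "h a = h b"
    have "of_rat q < a n \<longleftrightarrow> of_rat q < b n" for q n
    proof -
      have "prod_encode (n, to_nat q) \<in> h a \<longleftrightarrow> prod_encode (n, to_nat q) \<in> h b" using ab by simp
      then show ?thesis by (simp add: h_def)
    qed
    then have "\<not> a n < b n" "\<not> b n < a n" for n
      using of_rat_dense[of "a n" "b n"] of_rat_dense[of "b n" "a n"] by (metis less_asym)+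
    then show "a = b" by (intro ext) (metis linorder_cases)
  qed
  with \<open>inj i\<close> show ?thesis using inj_compose by blast
qed

lemma separable_space_euclidean: "separable_space (euclidean :: 'a::second_countable_topology topology)"
proof -
  obtain D :: "'a set" where D: "countable D" "\<And>U. open U \<Longrightarrow> U \<noteq> {} \<Longrightarrow> \<exists>d\<in>D. d \<in> U"
    using countable_dense_exists by metis
  have "D \<inter> - closure D = {}" using closure_subset[of D] by blast
  then have "closure D = UNIV"
    using D(2)[of "- closure D"] by auto
  then show ?thesis
    unfolding separable_space_def using D(1) by auto
qed

text \<open>A Polish topology on a set of reals is obtained by carrying the topology of
  \<open>nat \<Rightarrow> real\<close> to the range of an injection i. Only injectivity of i
  matters: the topology on the range is the transported one, not the one inherited from the
  reals.\<close>

lemma standard_borel_vimage: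
  fixes \<kappa> :: "'a \<Rightarrow> nat \<Rightarrow> real"
  assumes inj: "inj_on \<kappa> \<Omega>" and im: "\<kappa> ` \<Omega> \<in> sets borel"
  shows "standard_borel (vimage_algebra \<Omega> \<kappa> borel)"
proof -
  obtain i :: "(nat \<Rightarrow> real) \<Rightarrow> real" where i: "inj i" using inj_real_seq_real by blast
  define j where "j = the_inv i"
  define T where "T = pullback_topology (range i) j euclidean"
  have ii: "j (i a) = a" for a using i by (simp add: j_def the_inv_f_f)
  have topT: "topspace T = range i" by (simp add: T_def topspace_pullback_topology)
  have opT: "openin T S \<longleftrightarrow> (\<exists>U. open U \<and> S = j -` U \<inter> range i)" for S
    by (simp add: T_def openin_pullback_topology)
  have "T homeomorphic_space (euclidean :: (nat \<Rightarrow> real) topology)"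
    unfolding homeomorphic_space_def homeomorphic_maps_def
  proof (intro exI conjI)
    show "continuous_map T euclidean j"
      unfolding T_def using continuous_map_pullback[OF continuous_map_id] by (simp add: o_def)
    show "continuous_map euclidean T i"
      unfolding T_def by (rule continuous_map_pullback') (auto simp: o_def ii)
  qed (auto simp: topT ii)
  then have pol: "polish_topology T"
    unfolding polish_topology_def
    by (simp add: homeomorphic_completely_metrizable_space homeomorphic_separable_space
        completely_metrizable_space_euclidean separable_space_euclidean)
  have spT: "space (borel_of T) = range i" and
    setsT: "sets (borel_of T) = sigma_sets (range i) {U. openin T U}"
    unfolding borel_of_def topT[symmetric] by (intro space_measure_of sets_measure_of; auto dest: openin_subset)+
  have invm: "j \<in> borel_measurable (borel_of T)"
    by (rule borel_measurableI) (auto simp: spT setsT opT intro!: sigma_sets.Basic)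
  have im': "i ` A \<in> sets (borel_of T)" if "A \<in> sets borel" for A
  proof -
    have "i ` A = j -` A \<inter> space (borel_of T)" using spT ii by auto
    then show ?thesis using measurable_sets[OF invm that] by simp
  qed
  define M where "M = vimage_algebra \<Omega> \<kappa> (borel :: (nat \<Rightarrow> real) measure)"
  have spM: "space M = \<Omega>" by (simp add: M_def)
  have \<kappa>m: "\<kappa> \<in> borel_measurable M" unfolding M_def by (rule measurable_vimage_algebra1) simp
  define B where "B = i ` \<kappa> ` \<Omega>"
  have B: "B \<in> sets (borel_of T)" unfolding B_def by (rule im'[OF im])
  let ?R = "restrict_space (borel_of T) B"
  have spR: "space ?R = B" using B by (simp add: space_restrict_space2)
  have "i \<in> borel \<rightarrow>\<^sub>M borel_of T"
    unfolding borel_of_def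
    by (rule measurable_measure_of) (auto simp: topT opT ii vimage_def dest: openin_subset)
  then have "(\<lambda>x. i (\<kappa> x)) \<in> M \<rightarrow>\<^sub>M borel_of T"
    using \<kappa>m by simp
  then have "(\<lambda>x. i (\<kappa> x)) \<in> M \<rightarrow>\<^sub>M ?R"
    by (rule measurable_restrict_space2[rotated]) (auto simp: B_def spM)
  moreover have inj': "inj_on (\<lambda>x. i (\<kappa> x)) \<Omega>" using inj i by (auto simp: inj_on_def)
  moreover have "bij_betw (\<lambda>x. i (\<kappa> x)) (space M) (space ?R)"
    using inj' unfolding spR by (auto simp: bij_betw_def spM B_def)
  moreover have "the_inv_into \<Omega> (\<lambda>x. i (\<kappa> x)) \<in> ?R \<rightarrow>\<^sub>M M"
    unfolding M_def
  proof (rule measurable_vimage_algebra2)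
    show "the_inv_into \<Omega> (\<lambda>x. i (\<kappa> x)) \<in> space ?R \<rightarrow> \<Omega>"
      unfolding spR unfolding B_def using the_inv_into_f_f[OF inj'] by auto
    have "(\<lambda>y. \<kappa> (the_inv_into \<Omega> (\<lambda>x. i (\<kappa> x)) y)) \<in> ?R \<rightarrow>\<^sub>M borel \<longleftrightarrow> j \<in> ?R \<rightarrow>\<^sub>M borel"
      by (rule measurable_cong) (unfold spR, auto simp: B_def the_inv_into_f_f[OF inj'] ii)
    then show "(\<lambda>y. \<kappa> (the_inv_into \<Omega> (\<lambda>x. i (\<kappa> x)) y)) \<in> ?R \<rightarrow>\<^sub>M borel"
      using measurable_restrict_space1[OF invm] by blast
  qed
  ultimately have "measurable_iso M ?R (\<lambda>x. i (\<kappa> x))"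
    unfolding measurable_iso_def spM by blast
  then show ?thesis
    unfolding standard_borel_def M_def[symmetric] using pol B by blast
qed

text \<open>Turns a measurable function of a into a Borel function of the code e a. The preimage of
  a Borel set under h after the inverse of e is an image under e of a measurable set, hence Borel by
  hypothesis.\<close>

lemma measurable_factor_embedding:
  fixes e :: "'a \<Rightarrow> 'b::topological_space" and h :: "'a \<Rightarrow> 'c::topological_space"
  assumes e: "inj_on e (space M)" and eim: "\<And>A. A \<in> sets M \<Longrightarrow> e ` A \<in> sets borel"
    and h: "h \<in> borel_measurable M"
  shows "\<exists>k\<in>borel_measurable borel. \<forall>a\<in>space M. k (e a) = h a"
proof -
  \<comment> \<open>A constant value off the range of e makes the preimage there either everything
    or nothing.\<close>
  define c :: 'c where "c = undefined"
  define k where "k r = (if r \<in> e ` space M then h (the_inv_into (space M) e r) else c)" for r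
  have ke: "k (e a) = h a" if "a \<in> space M" for a
    using that e by (simp add: k_def the_inv_into_f_f)
  have k: "k \<in> borel_measurable borel"
  proof (rule measurableI)
    fix W :: "'c set" assume W: "W \<in> sets borel"
    have "k -` W = e ` (h -` W \<inter> space M) \<union> (if c \<in> W then - (e ` space M) else {})"
    proof (rule Set.set_eqI)
      fix r show "r \<in> k -` W \<longleftrightarrow> r \<in> e ` (h -` W \<inter> space M) \<union> (if c \<in> W then - (e ` space M) else {})"
      proof (cases "r \<in> e ` space M")
        case True
        then obtain a where a: "a \<in> space M" "r = e a" by blast
        then have "r \<in> e ` (h -` W \<inter> space M) \<longleftrightarrow> h a \<in> W"
          using e by (auto dest: inj_onD)
        then show ?thesis using a ke by auto
      qed (auto simp: k_def)
    qed
    moreover have "- (e ` space M) \<in> sets borel" using eim[OF sets.top] by (simp add: borel_comp)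
    ultimately show "k -` W \<inter> space borel \<in> sets borel"
      using eim[OF measurable_sets[OF h W]] by auto
  qed simp
  show ?thesis using ke by (intro bexI[OF _ k]) simp
qed

text \<open>For measurable A, the images under h of A and of its complement are disjoint by
  injectivity, and both are projections of closed sets. A Borel set separating them has A as its
  preimage.\<close>

lemma standard_borel_eq_vimage_algebra:
  fixes h :: "'a \<Rightarrow> nat \<Rightarrow> real"
  assumes M: "standard_borel M" and h: "h \<in> borel_measurable M" and inj: "inj_on h (space M)"
  shows "sets M = sets (vimage_algebra (space M) h borel)"
proof
  show "sets (vimage_algebra (space M) h borel) \<subseteq> sets M"
    using measurable_sets[OF h] by (auto simp: sets_vimage_algebra2)
next
  obtain e :: "'a \<Rightarrow> nat \<Rightarrow> real" where e: "e \<in> borel_measurable M" "inj_on e (space M)"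
    and eim: "\<And>A. A \<in> sets M \<Longrightarrow> e ` A \<in> sets borel"
    using standard_borel_embedding[OF M] by blast
  have "\<exists>k\<in>borel_measurable borel. \<forall>a\<in>space M. k (e a) = h a"
    by (rule measurable_factor_embedding[OF e(2) _ h]) (rule eim)
  then obtain k :: "(nat \<Rightarrow> real) \<Rightarrow> nat \<Rightarrow> real" where k: "k \<in> borel_measurable borel"
    and ke': "\<forall>a\<in>space M. k (e a) = h a" by (elim bexE)
  have ke: "k (e a) = h a" if "a \<in> space M" for a using ke' that by simp
  have G: "(\<lambda>a. (e a, h a)) ` A \<in> sets borel" if A: "A \<in> sets M" for A
  proof -
    have "(\<lambda>a. (e a, h a)) ` A = {p. fst p \<in> e ` A \<and> (\<forall>n. snd p n = k (fst p) n)}"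
    proof (intro equalityI subsetI)
      fix p assume "p \<in> {p. fst p \<in> e ` A \<and> (\<forall>n. snd p n = k (fst p) n)}"
      then obtain a where "a \<in> A" "fst p = e a" "snd p = k (e a)" by (auto simp: fun_eq_iff)
      moreover from this have "k (e a) = h a" using ke sets.sets_into_space[OF A] by blast
      ultimately show "p \<in> (\<lambda>a. (e a, h a)) ` A" by (cases p) auto
    qed (use ke sets.sets_into_space[OF A] in auto)
    also have "\<dots> \<in> sets (borel \<Otimes>\<^sub>M borel)"
    proof -
      have [measurable]: "k \<in> borel_measurable borel" "e ` A \<in> sets borel" using k eim[OF A] by auto
      have [measurable]: "(\<lambda>p::(nat \<Rightarrow> real) \<times> (nat \<Rightarrow> real). k (fst p) n) \<in> borel_measurable (borel \<Otimes>\<^sub>M borel)" for n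
        by (rule measurable_compose[OF _ measurable_product_coordinates]) measurable
      have [measurable]: "(\<lambda>p::(nat \<Rightarrow> real) \<times> (nat \<Rightarrow> real). snd p n) \<in> borel_measurable (borel \<Otimes>\<^sub>M borel)" for n
        by (rule measurable_compose[OF _ measurable_product_coordinates]) measurable
      have "{p \<in> space (borel \<Otimes>\<^sub>M borel). fst p \<in> e ` A \<and> (\<forall>n. snd p n = k (fst p) n)} \<in> sets (borel \<Otimes>\<^sub>M borel)"
        by measurable
      then show ?thesis by (simp add: space_pair_measure)
    qed
    finally show ?thesis unfolding borel_prod .
  qed
  show "sets M \<subseteq> sets (vimage_algebra (space M) h borel)"
  proof
    fix A assume A: "A \<in> sets M"
    let ?g = "\<lambda>a. (e a, h a)"
    from borel_eq_closed_projection[OF G[OF A]]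
    obtain P :: "(((nat \<Rightarrow> real) \<times> (nat \<Rightarrow> real)) \<times> (nat \<Rightarrow> real)) set"
      where P: "closed P" "?g ` A = fst ` P" by (elim exE conjE)
    from borel_eq_closed_projection[OF G[OF sets.compl_sets[OF A]]]
    obtain Q :: "(((nat \<Rightarrow> real) \<times> (nat \<Rightarrow> real)) \<times> (nat \<Rightarrow> real)) set"
      where Q: "closed Q" "?g ` (space M - A) = fst ` Q" by (elim exE conjE)
    have hA: "snd ` fst ` P = h ` A" "snd ` fst ` Q = h ` (space M - A)"
      unfolding P(2)[symmetric] Q(2)[symmetric] by (auto simp: image_image)
    have AM: "A \<subseteq> space M" using A sets.sets_into_space by blast
    have c: "continuous_on UNIV (\<lambda>p::((nat \<Rightarrow> real) \<times> (nat \<Rightarrow> real)) \<times> (nat \<Rightarrow> real). snd (fst p))"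
      by (intro continuous_intros)
    have "(\<lambda>p. snd (fst p)) ` P \<inter> (\<lambda>p. snd (fst p)) ` Q = {}"
      using hA inj AM unfolding image_image[symmetric] by (auto simp: inj_on_def image_image)
    from closed_image_separation[OF P(1) Q(1) c c this] obtain D where "D \<in> sets borel"
      "h ` A \<subseteq> D" "h ` (space M - A) \<inter> D = {}"
      using hA by (auto simp: image_image)
    then have "A = h -` D \<inter> space M" using AM by auto
    with \<open>D \<in> sets borel\<close> show "A \<in> sets (vimage_algebra (space M) h borel)"
      by (auto simp: sets_vimage_algebra2)
  qed
qed

section \<open>Feasibility of countably many closed constraints\<close>

lemma compact_PiE_UNIV:
  fixes K :: "'i \<Rightarrow> 'a::topological_space set"
  assumes "\<And>i. compact (K i)"
  shows "compact {z. \<forall>i. z i \<in> K i}"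
proof -
  have "compactin (product_topology (\<lambda>_. euclidean) UNIV) (PiE UNIV K)"
    using assms by (simp add: compactin_PiE)
  moreover have "PiE UNIV K = {z. \<forall>i. z i \<in> K i}" by auto
  ultimately show ?thesis by (simp add: euclidean_product_topology)
qed

text \<open>The exact system is replaced by finite stages: the first n constraints, slack 1/(n+1),
  and a point of a countable dense set. Each stage is a countable Borel condition on x, and by
  compactness a sequence of approximate solutions has a limit that solves all constraints
  exactly.\<close>

lemma measurable_feasible:
  fixes g :: "'k::countable \<Rightarrow> ('i::countable \<Rightarrow> complex) \<Rightarrow> real" and b :: "'k \<Rightarrow> 'x \<Rightarrow> real"
  assumes g: "\<And>k. continuous_on UNIV (g k)" and b: "\<And>k. b k \<in> borel_measurable X"
    and bounded: "\<And>i. \<exists>k. \<forall>z. cmod (z i) \<le> g k z"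
  shows "{x \<in> space X. \<exists>z. \<forall>k. g k z \<le> b k x} \<in> sets X"
proof -
  obtain D :: "('i \<Rightarrow> complex) set" where "countable D" and D: "\<And>U. open U \<Longrightarrow> U \<noteq> {} \<Longrightarrow> \<exists>d\<in>D. d \<in> U"
    using countable_dense_exists by metis
  define A where "A n z = {x \<in> space X. \<forall>k. to_nat k \<le> n \<longrightarrow> g k z < b k x + 1 / real (Suc n)}" for n z
  have "{x \<in> space X. \<exists>z. \<forall>k. g k z \<le> b k x} = (\<Inter>n. \<Union>z\<in>D. A n z)"
  proof (intro equalityI subsetI)
    fix x assume "x \<in> {x \<in> space X. \<exists>z. \<forall>k. g k z \<le> b k x}"
    then obtain z where x: "x \<in> space X" and z: "\<And>k. g k z \<le> b k x" by auto
    show "x \<in> (\<Inter>n. \<Union>z\<in>D. A n z)"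
    proof
      fix n
      \<comment> \<open>Finitely many strict inequalities between continuous functions define an
        open set, which therefore meets D.\<close>
      define U where "U = (\<Inter>k\<in>{k. to_nat k \<le> n}. {z. g k z < b k x + 1 / real (Suc n)})"
      have "finite (to_nat -` {..n} :: 'k set)" by (rule finite_vimageI) auto
      then have "finite {k :: 'k. to_nat k \<le> n}" by (simp add: vimage_def)
      then have "open U"
        unfolding U_def by (intro open_INT ballI open_Collect_less g continuous_intros)
      moreover have "g k z < b k x + 1 / real (Suc n)" for k
        using z[of k] divide_pos_pos[of 1 "real (Suc n)"] by linarith
      then have "z \<in> U" unfolding U_def by blast
      ultimately obtain d where "d \<in> D" "d \<in> U" using D[of U] by blast
      then show "x \<in> (\<Union>z\<in>D. A n z)" using x unfolding U_def A_def by blast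
    qed
  next
    fix x assume x: "x \<in> (\<Inter>n. \<Union>z\<in>D. A n z)"
    then have xX: "x \<in> space X" unfolding A_def by blast
    have "\<forall>n. \<exists>z. \<forall>k. to_nat k \<le> n \<longrightarrow> g k z < b k x + 1 / real (Suc n)"
      using x unfolding A_def by blast
    then obtain Z where Z: "\<And>n k. to_nat k \<le> n \<Longrightarrow> g k (Z n) < b k x + 1 / real (Suc n)"
      by metis
    \<comment> \<open>The constraint that bounds coordinate i is imposed only from stage
      \<open>to_nat k\<close> on, so the bound holds eventually.\<close>
    have "Bseq (\<lambda>n. Z n i)" for i
    proof -
      obtain k where k: "\<And>z. cmod (z i) \<le> g k z" using bounded by blast
      have "cmod (Z n i) \<le> b k x + 1" if "to_nat k \<le> n" for n
      proof -
        have "1 / real (Suc n) \<le> 1" by simp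
        then show ?thesis using k[of "Z n"] Z[OF that] by linarith
      qed
      then show ?thesis by (intro BfunI eventually_sequentiallyI)
    qed
    then have "\<forall>i. \<exists>R. \<forall>n. cmod (Z n i) \<le> R" unfolding Bseq_def by blast
    then obtain R where R: "\<And>i n. cmod (Z n i) \<le> R i" by metis
    have "seq_compact {z :: 'i \<Rightarrow> complex. \<forall>i. z i \<in> cball 0 (R i)}"
      by (rule compact_imp_seq_compact) (rule compact_PiE_UNIV, simp)
    moreover have "\<forall>n. Z n \<in> {z. \<forall>i. z i \<in> cball 0 (R i)}"
      using R by simp
    ultimately obtain z r where r: "strict_mono r" and lim: "(Z \<circ> r) \<longlonglongrightarrow> z"
      by (rule seq_compactE)
    have "g k z \<le> b k x" for k
    proof (rule LIMSEQ_le)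
      show "(\<lambda>n. g k (Z (r n))) \<longlonglongrightarrow> g k z"
        using continuous_on_tendsto_compose[OF g lim[unfolded o_def]] by simp
      have "(\<lambda>n. b k x + 1 / real (Suc n)) \<longlonglongrightarrow> b k x + 0"
        by (intro tendsto_intros LIMSEQ_Suc[OF lim_1_over_n])
      from LIMSEQ_subseq_LIMSEQ[OF this r] show "(\<lambda>n. b k x + 1 / real (Suc (r n))) \<longlonglongrightarrow> b k x"
        by (simp add: o_def)
      have "g k (Z (r n)) \<le> b k x + 1 / real (Suc (r n))" if "n \<ge> to_nat k" for n
        using Z[of k "r n"] seq_suble[OF r, of n] that by simp
      then show "\<exists>N. \<forall>n\<ge>N. g k (Z (r n)) \<le> b k x + 1 / real (Suc (r n))" by blast
    qed
    then show "x \<in> {x \<in> space X. \<exists>z. \<forall>k. g k z \<le> b k x}" using xX by blast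
  qed
  moreover have "A n z \<in> sets X" for n z
    unfolding A_def using b by measurable
  ultimately show ?thesis
    using \<open>countable D\<close> by (auto intro!: sets.countable_UN')
qed

section \<open>Normed spaces with explicit carriers\<close>

abbreviation ndiff :: "'a normed_module \<Rightarrow> 'a \<Rightarrow> 'a \<Rightarrow> real" where
  "ndiff E a b \<equiv> nrm E (a \<ominus>\<^bsub>E\<^esub> b)"

lemma complex_ring_simps [simp]:
  "carrier complex_ring = UNIV" "add complex_ring a b = a + b" "mult complex_ring a b = a * b"
  "zero complex_ring = 0" "one complex_ring = 1" "smult complex_ring a b = a * b" "nrm complex_ring a = cmod a"
  by (simp_all add: complex_ring_def)

lemma cring_complex_ring: "cring complex_ring"
proof (rule cringI)
  show "abelian_group complex_ring"
    by (rule abelian_groupI) (auto simp: add.assoc intro: exI[of _ "- _"] ab_left_minus)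
  show "Group.comm_monoid complex_ring"
    by (rule Group.comm_monoidI) (auto simp: mult.commute)
qed (auto simp: algebra_simps)

lemma complex_normed_spaceI:
  assumes "abelian_group E"
    and "\<And>c a. a \<in> carrier E \<Longrightarrow> c \<odot>\<^bsub>E\<^esub> a \<in> carrier E"
    and "\<And>c d a. a \<in> carrier E \<Longrightarrow> (c + d) \<odot>\<^bsub>E\<^esub> a = c \<odot>\<^bsub>E\<^esub> a \<oplus>\<^bsub>E\<^esub> d \<odot>\<^bsub>E\<^esub> a"
    and "\<And>c a b. a \<in> carrier E \<Longrightarrow> b \<in> carrier E \<Longrightarrow> c \<odot>\<^bsub>E\<^esub> (a \<oplus>\<^bsub>E\<^esub> b) = c \<odot>\<^bsub>E\<^esub> a \<oplus>\<^bsub>E\<^esub> c \<odot>\<^bsub>E\<^esub> b"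
    and "\<And>c d a. a \<in> carrier E \<Longrightarrow> (c * d) \<odot>\<^bsub>E\<^esub> a = c \<odot>\<^bsub>E\<^esub> (d \<odot>\<^bsub>E\<^esub> a)"
    and "\<And>a. a \<in> carrier E \<Longrightarrow> 1 \<odot>\<^bsub>E\<^esub> a = a"
    and "\<And>a. a \<in> carrier E \<Longrightarrow> nrm E a = 0 \<Longrightarrow> a = \<zero>\<^bsub>E\<^esub>"
    and "\<And>c a. a \<in> carrier E \<Longrightarrow> nrm E (c \<odot>\<^bsub>E\<^esub> a) = cmod c * nrm E a"
    and "\<And>a b. a \<in> carrier E \<Longrightarrow> b \<in> carrier E \<Longrightarrow> nrm E (a \<oplus>\<^bsub>E\<^esub> b) \<le> nrm E a + nrm E b"
  shows "complex_normed_space E"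
proof -
  interpret module complex_ring E
    by (rule moduleI) (use assms cring_complex_ring in auto)
  have "nrm E \<zero>\<^bsub>E\<^esub> = 0"
    using assms(8)[of "\<zero>\<^bsub>E\<^esub>" 0] smult_l_null[of "\<zero>\<^bsub>E\<^esub>"] by simp
  then show ?thesis
    by unfold_locales (use assms in auto)
qed

lemma complex_rational_approx:
  assumes "e > 0"
  shows "\<exists>q r. cmod (c - Complex (of_rat q) (of_rat r)) < e"
proof -
  obtain q where q: "Re c - e/2 < of_rat q" "of_rat q < Re c + e/2"
    using of_rat_dense[of "Re c - e/2" "Re c + e/2"] assms by auto
  obtain r where r: "Im c - e/2 < of_rat r" "of_rat r < Im c + e/2"
    using of_rat_dense[of "Im c - e/2" "Im c + e/2"] assms by auto
  have "cmod (c - Complex (of_rat q) (of_rat r)) \<le> \<bar>Re c - of_rat q\<bar> + \<bar>Im c - of_rat r\<bar>"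
    using cmod_le[of "c - Complex (of_rat q) (of_rat r)"] by simp
  also have "\<dots> < e" using q r by linarith
  finally show ?thesis by blast
qed

context complex_normed_space
begin

lemma smult_simps:
  "a \<in> carrier E \<Longrightarrow> c \<odot> a \<in> carrier E"
  "a \<in> carrier E \<Longrightarrow> (c + d) \<odot> a = c \<odot> a \<oplus> d \<odot> a"
  "a \<in> carrier E \<Longrightarrow> b \<in> carrier E \<Longrightarrow> c \<odot> (a \<oplus> b) = c \<odot> a \<oplus> c \<odot> b"
  "a \<in> carrier E \<Longrightarrow> (c * d) \<odot> a = c \<odot> (d \<odot> a)"
  "a \<in> carrier E \<Longrightarrow> 1 \<odot> a = a"
  "a \<in> carrier E \<Longrightarrow> 0 \<odot> a = \<zero>"
  "c \<odot> \<zero> = \<zero>"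
  using smult_closed[of c a] smult_l_distr[of c d a] smult_r_distr[of c a b] smult_assoc1[of c d a] smult_one[of a]
    smult_l_null[of a] smult_r_null[of c]
  by simp_all

lemma uminus_eq_smult: "a \<in> carrier E \<Longrightarrow> \<ominus> a = (-1) \<odot> a"
proof -
  assume a: "a \<in> carrier E"
  have "(-1) \<odot> a \<oplus> a = (-1 + 1) \<odot> a"
    using a by (simp only: smult_simps)
  also have "\<dots> = \<zero>" using a by (simp add: smult_simps)
  finally show ?thesis using a by (intro M.minus_equality) (auto simp: smult_simps)
qed

lemma minus_eq_smult: "a \<in> carrier E \<Longrightarrow> b \<in> carrier E \<Longrightarrow> a \<ominus> b = a \<oplus> (-1) \<odot> b"
  by (simp add: a_minus_def uminus_eq_smult)

lemma nrm_zero [simp]: "nrm E \<zero> = 0"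
  by (simp add: nrm_eq_0)

lemma nrm_uminus [simp]: "a \<in> carrier E \<Longrightarrow> nrm E (\<ominus> a) = nrm E a"
  by (simp add: uminus_eq_smult nrm_smult)

lemma nrm_nonneg [simp]: "a \<in> carrier E \<Longrightarrow> 0 \<le> nrm E a"
  using nrm_triangle[of a "\<ominus> a"] by (simp add: M.r_neg)

lemma minus_closed' [simp]: "a \<in> carrier E \<Longrightarrow> b \<in> carrier E \<Longrightarrow> a \<ominus> b \<in> carrier E"
  by (simp add: a_minus_def)

lemma add_minus_add:
  "a \<in> carrier E \<Longrightarrow> b \<in> carrier E \<Longrightarrow> c \<in> carrier E \<Longrightarrow> d \<in> carrier E \<Longrightarrow>
    (a \<oplus> b) \<ominus> (c \<oplus> d) = (a \<ominus> c) \<oplus> (b \<ominus> d)"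
  by (simp add: a_minus_def M.minus_add M.a_ac)

lemma smult_minus: "a \<in> carrier E \<Longrightarrow> b \<in> carrier E \<Longrightarrow> c \<odot> (a \<ominus> b) = c \<odot> a \<ominus> c \<odot> b"
  by (simp add: minus_eq_smult smult_simps(1,3)) (simp add: smult_simps(1) smult_simps(4)[symmetric] mult.commute)

lemma minus_add_minus:
  "a \<in> carrier E \<Longrightarrow> b \<in> carrier E \<Longrightarrow> c \<in> carrier E \<Longrightarrow> (a \<ominus> b) \<oplus> (b \<ominus> c) = a \<ominus> c"
  by (simp add: a_minus_def M.a_ac M.r_neg1 M.r_neg2)

lemma minus_swap: "a \<in> carrier E \<Longrightarrow> b \<in> carrier E \<Longrightarrow> \<ominus> (a \<ominus> b) = b \<ominus> a"
  by (simp add: a_minus_def M.minus_add M.a_comm)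

lemma minus_add_cancel: "a \<in> carrier E \<Longrightarrow> b \<in> carrier E \<Longrightarrow> (a \<ominus> b) \<oplus> b = a"
  by (simp add: a_minus_def M.a_assoc M.l_neg)

lemma minus_self: "a \<in> carrier E \<Longrightarrow> a \<ominus> a = \<zero>"
  by (simp add: a_minus_def M.r_neg)

lemma minus_zero: "a \<in> carrier E \<Longrightarrow> a \<ominus> \<zero> = a"
  by (simp add: a_minus_def)

lemma add_minus_cancel: "a \<in> carrier E \<Longrightarrow> b \<in> carrier E \<Longrightarrow> (a \<oplus> b) \<ominus> b = a"
  by (simp add: a_minus_def M.a_assoc M.r_neg)

lemma minus_eq_zero_iff: "a \<in> carrier E \<Longrightarrow> b \<in> carrier E \<Longrightarrow> a \<ominus> b = \<zero> \<longleftrightarrow> a = b"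
  by (metis minus_add_cancel minus_self M.l_zero)

lemma nrm_minus_commute: "a \<in> carrier E \<Longrightarrow> b \<in> carrier E \<Longrightarrow> nrm E (a \<ominus> b) = nrm E (b \<ominus> a)"
  by (metis minus_swap nrm_uminus minus_closed')

lemma nrm_minus_triangle:
  "a \<in> carrier E \<Longrightarrow> b \<in> carrier E \<Longrightarrow> c \<in> carrier E \<Longrightarrow> nrm E (a \<ominus> c) \<le> nrm E (a \<ominus> b) + nrm E (b \<ominus> c)"
  by (metis minus_add_minus nrm_triangle minus_closed')

lemma nrm_add_minus_add:
  "a \<in> carrier E \<Longrightarrow> b \<in> carrier E \<Longrightarrow> c \<in> carrier E \<Longrightarrow> d \<in> carrier E \<Longrightarrow>
    nrm E ((a \<oplus> b) \<ominus> (c \<oplus> d)) \<le> nrm E (a \<ominus> c) + nrm E (b \<ominus> d)"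
  by (simp add: add_minus_add nrm_triangle)

lemma nrm_smult_minus:
  "a \<in> carrier E \<Longrightarrow> b \<in> carrier E \<Longrightarrow> nrm E (c \<odot> a \<ominus> c \<odot> b) = cmod c * nrm E (a \<ominus> b)"
  by (simp add: smult_minus[symmetric] nrm_smult)

lemma nrm_le_add_minus: "a \<in> carrier E \<Longrightarrow> b \<in> carrier E \<Longrightarrow> nrm E a \<le> nrm E b + nrm E (a \<ominus> b)"
  by (metis nrm_triangle minus_add_cancel minus_closed' add.commute)

lemma nrm_smult_minus_smult:
  "a \<in> carrier E \<Longrightarrow> nrm E (c \<odot> a \<ominus> d \<odot> a) = cmod (c - d) * nrm E a"
proof -
  assume a: "a \<in> carrier E"
  have "c \<odot> a \<ominus> d \<odot> a = c \<odot> a \<oplus> ((-1) * d) \<odot> a"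
    using a by (simp only: minus_eq_smult smult_simps)
  also have "\<dots> = (c - d) \<odot> a" using a by (simp add: smult_simps(2)[symmetric])
  finally show ?thesis using a by (simp add: nrm_smult)
qed

sublocale Met: Metric_space "carrier E" "ndist E"
proof
  fix x y z
  show "0 \<le> ndist E x y" by (simp add: ndist_def)
  show "ndist E x y = ndist E y x" by (simp add: ndist_def nrm_minus_commute)
  show "x \<in> carrier E \<Longrightarrow> y \<in> carrier E \<Longrightarrow> ndist E x y = 0 \<longleftrightarrow> x = y"
    by (simp add: ndist_def nrm_eq_0 minus_eq_zero_iff)
  show "x \<in> carrier E \<Longrightarrow> y \<in> carrier E \<Longrightarrow> z \<in> carrier E \<Longrightarrow> ndist E x z \<le> ndist E x y + ndist E y z"
    by (simp add: ndist_def nrm_minus_triangle)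
qed

lemma ndist_eq: "a \<in> carrier E \<Longrightarrow> b \<in> carrier E \<Longrightarrow> ndist E a b = nrm E (a \<ominus> b)"
  by (simp add: ndist_def)

lemma abs_nrm_diff_le: "a \<in> carrier E \<Longrightarrow> b \<in> carrier E \<Longrightarrow> \<bar>nrm E a - nrm E b\<bar> \<le> ndist E a b"
  using nrm_le_add_minus[of a b] nrm_le_add_minus[of b a] nrm_minus_commute[of a b] by (simp add: ndist_eq)

lemma dense_iff:
  assumes "A \<subseteq> carrier E"
  shows "norm_topology E closure_of A = carrier E \<longleftrightarrow> (\<forall>v\<in>carrier E. \<forall>e>0. \<exists>a\<in>A. nrm E (a \<ominus> v) < e)"
  unfolding Met.metric_closure_of
  using assms by (auto simp: ndist_eq nrm_minus_commute subset_iff set_eq_iff Bex_def cong: conj_cong)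

end

section \<open>Functionals: Hahn--Banach and extension from a dense sequence\<close>

context complex_normed_space
begin

definition sublinear :: "('a \<Rightarrow> real) \<Rightarrow> bool" where
  "sublinear q \<longleftrightarrow> (\<forall>a\<in>carrier E. \<forall>b\<in>carrier E. q (a \<oplus> b) \<le> q a + q b) \<and>
    (\<forall>t\<ge>0. \<forall>a\<in>carrier E. q (complex_of_real t \<odot> a) \<le> t * q a)"

lemma sublinear_add: "sublinear q \<Longrightarrow> a \<in> carrier E \<Longrightarrow> b \<in> carrier E \<Longrightarrow> q (a \<oplus> b) \<le> q a + q b"
  unfolding sublinear_def by blast

lemma sublinear_scale: "sublinear q \<Longrightarrow> t \<ge> 0 \<Longrightarrow> a \<in> carrier E \<Longrightarrow> q (complex_of_real t \<odot> a) \<le> t * q a"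
  unfolding sublinear_def by blast

lemma sublinear_zero: "sublinear q \<Longrightarrow> q \<zero> = 0"
  using sublinear_scale[of q 0 \<zero>] sublinear_add[of q \<zero> \<zero>] by (simp add: smult_simps)

lemma sublinear_scale_eq:
  assumes q: "sublinear q" and t: "t \<ge> 0" and a: "a \<in> carrier E"
  shows "q (complex_of_real t \<odot> a) = t * q a"
proof (cases "t = 0")
  case True
  then show ?thesis using sublinear_zero[OF q] a by (simp add: smult_simps)
next
  case False
  have "complex_of_real (inverse t) \<odot> (complex_of_real t \<odot> a) = (complex_of_real (inverse t) * complex_of_real t) \<odot> a"
    using a by (simp only: smult_simps)
  also have "\<dots> = a" using False a by (simp add: smult_simps flip: of_real_mult)
  finally have "q a \<le> inverse t * q (complex_of_real t \<odot> a)"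
    using sublinear_scale[OF q, of "inverse t" "complex_of_real t \<odot> a"] t a by (simp add: smult_simps)
  then have "t * q a \<le> q (complex_of_real t \<odot> a)" using False t by (simp add: field_simps)
  then show ?thesis using sublinear_scale[OF q t a] by simp
qed

lemma sublinear_lower: "sublinear q \<Longrightarrow> a \<in> carrier E \<Longrightarrow> - q (\<ominus> a) \<le> q a"
  using sublinear_add[of q a "\<ominus> a"] sublinear_zero[of q] by (simp add: M.r_neg)

text \<open>By subadditivity the expression decreases as t grows, and its limit is again sublinear,
  lies below q and is linear along y. The value 0 off the carrier keeps the functional in the set to
  which Zorn's lemma is applied later.\<close>

definition steepest :: "('a \<Rightarrow> real) \<Rightarrow> 'a \<Rightarrow> 'a \<Rightarrow> real" where
  "steepest q y x = (if x \<in> carrier E then INF t\<in>{0..}. q (x \<oplus> complex_of_real t \<odot> y) - t * q y else 0)"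

context
  fixes q y assumes q: "sublinear q" and y: "y \<in> carrier E"
begin

lemma steepest_lower:
  assumes "x \<in> carrier E" "t \<ge> 0"
  shows "- q (\<ominus> x) \<le> q (x \<oplus> complex_of_real t \<odot> y) - t * q y"
proof -
  have "complex_of_real t \<odot> y = (x \<oplus> complex_of_real t \<odot> y) \<oplus> \<ominus> x"
    using assms y by (simp add: smult_simps M.a_ac M.r_neg1 M.r_neg2)
  then have "t * q y \<le> q (x \<oplus> complex_of_real t \<odot> y) + q (\<ominus> x)"
    using sublinear_add[OF q, of "x \<oplus> complex_of_real t \<odot> y" "\<ominus> x"] sublinear_scale_eq[OF q, of t y] assms y
    by (simp add: smult_simps)
  then show ?thesis by simp
qed

lemma steepest_bdd: "x \<in> carrier E \<Longrightarrow> bdd_below ((\<lambda>t. q (x \<oplus> complex_of_real t \<odot> y) - t * q y) ` {0..})"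
  using steepest_lower by (intro bdd_belowI[of _ "- q (\<ominus> x)"]) auto

lemma steepest_le: "x \<in> carrier E \<Longrightarrow> t \<ge> 0 \<Longrightarrow> steepest q y x \<le> q (x \<oplus> complex_of_real t \<odot> y) - t * q y"
  unfolding steepest_def using steepest_bdd by (auto intro: cINF_lower)

lemma steepest_greatest:
  "x \<in> carrier E \<Longrightarrow> (\<And>t. t \<ge> 0 \<Longrightarrow> c \<le> q (x \<oplus> complex_of_real t \<odot> y) - t * q y) \<Longrightarrow> c \<le> steepest q y x"
  unfolding steepest_def by (auto intro: cINF_greatest)

lemma steepest_le_self: "x \<in> carrier E \<Longrightarrow> steepest q y x \<le> q x"
  using steepest_le[of x 0] y by (simp add: smult_simps)

lemma steepest_uminus: "steepest q y (\<ominus> y) \<le> - q y"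
  using steepest_le[of "\<ominus> y" 1] y sublinear_zero[OF q] by (simp add: smult_simps M.l_neg)

lemma sublinear_steepest: "sublinear (steepest q y)"
  unfolding sublinear_def
proof (intro conjI ballI allI impI)
  fix a b assume ab: "a \<in> carrier E" "b \<in> carrier E"
  \<comment> \<open>The parameters of the two summands are independent and add up to an admissible
    parameter for the sum; the two infima are then taken one after the other.\<close>
  have *: "steepest q y (a \<oplus> b) \<le> (q (a \<oplus> complex_of_real s \<odot> y) - s * q y) + (q (b \<oplus> complex_of_real t \<odot> y) - t * q y)"
    if "s \<ge> 0" "t \<ge> 0" for s t
  proof -
    have "(a \<oplus> b) \<oplus> complex_of_real (s + t) \<odot> y = (a \<oplus> complex_of_real s \<odot> y) \<oplus> (b \<oplus> complex_of_real t \<odot> y)"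
      using ab y by (simp add: smult_simps M.a_ac)
    then show ?thesis
      using steepest_le[of "a \<oplus> b" "s + t"] that ab y
        sublinear_add[OF q, of "a \<oplus> complex_of_real s \<odot> y" "b \<oplus> complex_of_real t \<odot> y"]
      by (simp add: smult_simps algebra_simps)
  qed
  have "steepest q y (a \<oplus> b) - (q (a \<oplus> complex_of_real s \<odot> y) - s * q y) \<le> steepest q y b" if "s \<ge> 0" for s
    using *[OF that] ab by (intro steepest_greatest) (auto simp: algebra_simps)
  then have "steepest q y (a \<oplus> b) - steepest q y b \<le> steepest q y a"
    using ab by (intro steepest_greatest) (auto simp: algebra_simps)
  then show "steepest q y (a \<oplus> b) \<le> steepest q y a + steepest q y b" by simp
next
  fix c :: real and a assume c: "c \<ge> 0" and a: "a \<in> carrier E"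
  show "steepest q y (complex_of_real c \<odot> a) \<le> c * steepest q y a"
  proof (cases "c = 0")
    case True
    then show ?thesis using steepest_le[of \<zero> 0] sublinear_zero[OF q] a y by (simp add: smult_simps)
  next
    case False
    have "inverse c * steepest q y (complex_of_real c \<odot> a) \<le> steepest q y a"
    proof (rule steepest_greatest[OF a])
      fix t :: real assume t: "t \<ge> 0"
      have "complex_of_real c \<odot> a \<oplus> complex_of_real (c * t) \<odot> y = complex_of_real c \<odot> (a \<oplus> complex_of_real t \<odot> y)"
        using a y by (simp add: smult_simps)
      then have "steepest q y (complex_of_real c \<odot> a) \<le> c * q (a \<oplus> complex_of_real t \<odot> y) - c * t * q y"
        using steepest_le[of "complex_of_real c \<odot> a" "c * t"] c t a y
          sublinear_scale[OF q c, of "a \<oplus> complex_of_real t \<odot> y"] by (simp add: smult_simps)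
      then show "inverse c * steepest q y (complex_of_real c \<odot> a) \<le> q (a \<oplus> complex_of_real t \<odot> y) - t * q y"
        using False c by (simp add: field_simps)
    qed
    then show ?thesis using False c by (simp add: field_simps)
  qed
qed

end

text \<open>The functional is a minimal sublinear functional below the norm: replacing \<open>q\<close> by
  \<^term>\<open>steepest q y\<close> shows that a minimal one satisfies \<open>q (- y) \<le> - q y\<close>, so it is additive.\<close>

lemma Hahn_Banach_real:
  assumes v: "v \<in> carrier E"
  shows "\<exists>q. (\<forall>a\<in>carrier E. \<forall>b\<in>carrier E. q (a \<oplus> b) = q a + q b) \<and>
    (\<forall>t. \<forall>a\<in>carrier E. q (complex_of_real t \<odot> a) = t * q a) \<and>
    (\<forall>a\<in>carrier E. q a \<le> nrm E a) \<and> q v = nrm E v"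
proof -
  \<comment> \<open>The condition at the negative of v passes to smaller functionals and becomes a
    lower bound for the value at v once q is additive. Fixing the values off the carrier makes
    comparison of members there trivial.\<close>
  define S where "S = {q. sublinear q \<and> (\<forall>a\<in>carrier E. q a \<le> nrm E a) \<and> (\<forall>a. a \<notin> carrier E \<longrightarrow> q a = 0) \<and>
    q (\<ominus> v) \<le> - nrm E v}"
  \<comment> \<open>The order is reversed: a maximal element for \<open>P\<close> is a minimal
    functional, and an upper bound of a chain is its pointwise infimum.\<close>
  define P where "P p q \<longleftrightarrow> (\<forall>a. (q a :: real) \<le> p a)" for p q :: "'a \<Rightarrow> real"
  have nrm: "sublinear (nrm E)"
    by (auto simp: sublinear_def nrm_triangle nrm_smult)
  have S0: "steepest (nrm E) v \<in> S"
    unfolding S_def using sublinear_steepest[OF nrm v] steepest_le_self[OF nrm v] steepest_uminus[OF nrm v]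
    by (auto simp: steepest_def)
  have "\<exists>m\<in>S. \<forall>a\<in>S. P m a \<longrightarrow> a = m"
  proof (rule predicate_Zorn)
    show "partial_order_on S (relation_of P S)"
      by (rule partial_order_on_relation_ofI) (auto simp: P_def fun_eq_iff intro: order_trans antisym)
    fix C assume "C \<in> Chains (relation_of P S)"
    then have CS: "C \<subseteq> S" and ch: "\<And>p q. p \<in> C \<Longrightarrow> q \<in> C \<Longrightarrow> P p q \<or> P q p"
      unfolding Chains_def relation_of_def by auto
    have CS': "sublinear q" "\<And>a. a \<in> carrier E \<Longrightarrow> q a \<le> nrm E a" "\<And>a. a \<notin> carrier E \<Longrightarrow> q a = 0"
      "q (\<ominus> v) \<le> - nrm E v" if "q \<in> C" for q
      using subsetD[OF CS that] by (simp_all add: S_def)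
    show "\<exists>u\<in>S. \<forall>a\<in>C. P a u"
    proof (cases "C = {}")
      case True
      then show ?thesis using S0 by auto
    next
      case False
      define u where "u a = (if a \<in> carrier E then INF q\<in>C. q a else 0)" for a
      have low: "- nrm E a \<le> q a" if "q \<in> C" "a \<in> carrier E" for q a
      proof -
        have "q (\<ominus> a) \<le> nrm E a" using CS'(2)[OF that(1), of "\<ominus> a"] that by simp
        moreover have "- q (\<ominus> a) \<le> q a" by (rule sublinear_lower[OF CS'(1)[OF that(1)] that(2)])
        ultimately show ?thesis by linarith
      qed
      have bdd: "bdd_below ((\<lambda>q. q a) ` C)" if "a \<in> carrier E" for a
        using low[OF _ that] by (intro bdd_belowI[of _ "- nrm E a"]) auto
      have ule: "u a \<le> q a" if "q \<in> C" for a q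
        using that CS'(3)[OF that, of a] bdd[of a] by (auto simp: u_def intro: cINF_lower)
      have uge: "c \<le> u a" if "a \<in> carrier E" "\<And>q. q \<in> C \<Longrightarrow> c \<le> q a" for c a
        using that False by (auto simp: u_def intro: cINF_greatest)
      obtain q0 where q0: "q0 \<in> C" using False by auto
      have "sublinear u"
        unfolding sublinear_def
      proof (intro conjI ballI allI impI)
        fix a b assume ab: "a \<in> carrier E" "b \<in> carrier E"
        \<comment> \<open>Members of a chain are comparable, so the smaller of p and q serves both
          arguments.\<close>
        have *: "u (a \<oplus> b) \<le> p a + q b" if pq: "p \<in> C" "q \<in> C" for p q
        proof -
          obtain r where r: "r \<in> C" "r a \<le> p a" "r b \<le> q b"
            using ch[OF pq] pq unfolding P_def by auto
          have "r (a \<oplus> b) \<le> r a + r b" by (rule sublinear_add[OF CS'(1)[OF r(1)] ab])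
          then show ?thesis using ule[OF r(1), of "a \<oplus> b"] r by linarith
        qed
        have **: "u (a \<oplus> b) - p a \<le> u b" if "p \<in> C" for p
        proof (rule uge[OF ab(2)])
          show "u (a \<oplus> b) - p a \<le> q b" if "q \<in> C" for q
            using *[OF \<open>p \<in> C\<close> that] by simp
        qed
        have "u (a \<oplus> b) - u b \<le> u a"
        proof (rule uge[OF ab(1)])
          show "u (a \<oplus> b) - u b \<le> p a" if "p \<in> C" for p
            using **[OF that] by simp
        qed
        then show "u (a \<oplus> b) \<le> u a + u b" by simp
      next
        fix t :: real and a assume t: "t \<ge> 0" and a: "a \<in> carrier E"
        show "u (complex_of_real t \<odot> a) \<le> t * u a"
        proof (cases "t = 0")
          case True
          have "u \<zero> \<le> 0" using ule[OF q0, of \<zero>] sublinear_zero[OF CS'(1)[OF q0]] by simp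
          then show ?thesis using True a by (simp add: smult_simps)
        next
          case False
          have "u (complex_of_real t \<odot> a) / t \<le> u a"
          proof (rule uge[OF a])
            fix q assume q: "q \<in> C"
            have "q (complex_of_real t \<odot> a) \<le> t * q a" by (rule sublinear_scale[OF CS'(1)[OF q] t a])
            with ule[OF q] have "u (complex_of_real t \<odot> a) \<le> t * q a" by (rule order_trans)
            then show "u (complex_of_real t \<odot> a) / t \<le> q a" using False t by (simp add: field_simps)
          qed
          then show ?thesis using False t by (simp add: field_simps)
        qed
      qed
      moreover have "u a \<le> nrm E a" if "a \<in> carrier E" for a
        using ule[OF q0] CS'(2)[OF q0 that] by (rule order_trans)
      moreover have "u (\<ominus> v) \<le> - nrm E v"
        using ule[OF q0] CS'(4)[OF q0] by (rule order_trans)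
      ultimately have "u \<in> S" unfolding S_def by (simp add: u_def)
      then show ?thesis using ule by (intro bexI[of _ u] ballI) (simp_all add: P_def)
    qed
  qed
  then obtain m where m: "m \<in> S" and min: "\<forall>p\<in>S. P m p \<longrightarrow> p = m"
    by blast
  have ms: "sublinear m" and mn: "\<And>a. a \<in> carrier E \<Longrightarrow> m a \<le> nrm E a" and mv: "m (\<ominus> v) \<le> - nrm E v"
    and m0: "\<And>a. a \<notin> carrier E \<Longrightarrow> m a = 0"
    using m by (simp_all add: S_def)
  have neg: "m (\<ominus> y) = - m y" if y: "y \<in> carrier E" for y
  proof -
    have le: "steepest m y a \<le> m a" for a
      using steepest_le_self[OF ms y, of a] m0[of a] by (cases "a \<in> carrier E") (auto simp: steepest_def)
    have "steepest m y a \<le> nrm E a" if "a \<in> carrier E" for a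
      using le mn[OF that] by (rule order_trans)
    moreover have "steepest m y (\<ominus> v) \<le> - nrm E v"
      using le mv by (rule order_trans)
    moreover have "steepest m y a = 0" if "a \<notin> carrier E" for a
      using that by (simp add: steepest_def)
    ultimately have "steepest m y \<in> S"
      unfolding S_def using sublinear_steepest[OF ms y] by blast
    then have "steepest m y = m" using min le by (simp add: P_def)
    then have "m (\<ominus> y) \<le> - m y" using steepest_uminus[OF ms y] by simp
    moreover have "- m y \<le> m (\<ominus> y)" using sublinear_lower[OF ms, of "\<ominus> y"] y by simp
    ultimately show ?thesis by simp
  qed
  have madd: "m (a \<oplus> b) = m a + m b" if ab: "a \<in> carrier E" "b \<in> carrier E" for a b
  proof -
    have "(a \<oplus> b) \<oplus> \<ominus> b = a" using add_minus_cancel[OF ab] unfolding a_minus_def .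
    then have "m a \<le> m (a \<oplus> b) + m (\<ominus> b)" using sublinear_add[OF ms, of "a \<oplus> b" "\<ominus> b"] ab by simp
    then have "m a \<le> m (a \<oplus> b) - m b" using neg[OF ab(2)] by simp
    then show ?thesis using sublinear_add[OF ms ab] by simp
  qed
  have mscale: "m (complex_of_real t \<odot> a) = t * m a" if a: "a \<in> carrier E" for t a
  proof (cases "t \<ge> 0")
    case True
    then show ?thesis using sublinear_scale_eq[OF ms _ a] by simp
  next
    case False
    have "complex_of_real t \<odot> a = \<ominus> (complex_of_real (- t) \<odot> a)"
      using a by (simp add: uminus_eq_smult smult_simps(1) flip: smult_simps(4))
    then show ?thesis using sublinear_scale_eq[OF ms _ a, of "- t"] neg[of "complex_of_real (- t) \<odot> a"] False a
      by (simp add: smult_simps)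
  qed
  have mv': "m v = nrm E v"
    using mn[OF v] mv neg[OF v] by simp
  show ?thesis
    by (intro exI[of _ m] conjI ballI allI madd mscale mn mv')
qed

section \<open>Complex functionals: norming functionals and extension\<close>

lemma linear_maps_complexI:
  assumes "\<And>a b. a \<in> carrier E \<Longrightarrow> b \<in> carrier E \<Longrightarrow> f (a \<oplus> b) = f a + f b"
    and "\<And>c a. a \<in> carrier E \<Longrightarrow> f (c \<odot> a) = c * f a"
  shows "f \<in> linear_maps E complex_ring"
  using assms by (auto simp: linear_maps_def)

lemma Hahn_Banach:
  assumes v: "v \<in> carrier E"
  shows "\<exists>f\<in>contractions E complex_ring. f v = complex_of_real (nrm E v)"
proof -
  obtain q where add: "\<And>a b. a \<in> carrier E \<Longrightarrow> b \<in> carrier E \<Longrightarrow> q (a \<oplus> b) = q a + q b"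
    and scale: "\<And>t a. a \<in> carrier E \<Longrightarrow> q (complex_of_real t \<odot> a) = t * q a"
    and le: "\<And>a. a \<in> carrier E \<Longrightarrow> q a \<le> nrm E a" and qv: "q v = nrm E v"
    using Hahn_Banach_real[OF v] by blast
  \<comment> \<open>This is the only complex linear functional with real part q.\<close>
  define f where "f a = Complex (q a) (- q (\<i> \<odot> a))" for a
  have fadd: "f (a \<oplus> b) = f a + f b" if "a \<in> carrier E" "b \<in> carrier E" for a b
    using that by (simp add: f_def add smult_simps complex_eq_iff)
  have fscale: "f (c \<odot> a) = c * f a" if a: "a \<in> carrier E" for c a
  proof -
    have lin: "q (c \<odot> a) = Re c * q a + Im c * q (\<i> \<odot> a)" if a: "a \<in> carrier E" for c a
    proof -
      have "c \<odot> a = complex_of_real (Re c) \<odot> a \<oplus> complex_of_real (Im c) \<odot> (\<i> \<odot> a)"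
      proof -
        have "c = complex_of_real (Re c) + complex_of_real (Im c) * \<i>" by (simp add: complex_eq_iff)
        then have "c \<odot> a = (complex_of_real (Re c) + complex_of_real (Im c) * \<i>) \<odot> a"
          by (rule arg_cong[of _ _ "\<lambda>c. c \<odot> a"])
        then show ?thesis using a by (simp only: smult_simps)
      qed
      then show ?thesis using a by (simp add: add scale smult_simps)
    qed
    have "\<i> \<odot> (c \<odot> a) = (\<i> * c) \<odot> a" using a by (simp only: smult_simps)
    then have "q (\<i> \<odot> (c \<odot> a)) = - Im c * q a + Re c * q (\<i> \<odot> a)"
      using lin[OF a, of "\<i> * c"] by simp
    then show ?thesis using lin[OF a, of c] by (simp add: f_def complex_eq_iff algebra_simps)
  qed
  have fle: "cmod (f a) \<le> nrm E a" if a: "a \<in> carrier E" for a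
  proof (cases "f a = 0")
    case False
    \<comment> \<open>Multiplying a by this unit makes the value of f real, where the bound on the
      real part q applies.\<close>
    define u where "u = cnj (sgn (f a))"
    have "f a * cnj (f a) = (complex_of_real (cmod (f a)))\<^sup>2"
      using complex_norm_square[of "f a"] by simp
    then have "u * f a = complex_of_real (cmod (f a))"
      using False by (simp add: u_def sgn_eq power2_eq_square mult.commute)
    then have "cmod (f a) = Re (f (u \<odot> a))" using fscale[OF a] by simp
    also have "\<dots> = q (u \<odot> a)" by (simp add: f_def)
    also have "\<dots> \<le> cmod u * nrm E a" using le[of "u \<odot> a"] a by (simp add: smult_simps nrm_smult)
    also have "cmod u = 1" using False by (simp add: u_def norm_sgn)
    finally show ?thesis by simp
  qed (use a in simp)
  have "f v = complex_of_real (nrm E v)"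
  proof -
    \<comment> \<open>A real part equal to the norm leaves no room for an imaginary part under the
      modulus bound.\<close>
    have re: "Re (f v) = nrm E v" using qv by (simp add: f_def)
    have "(Re (f v))\<^sup>2 + (Im (f v))\<^sup>2 \<le> (nrm E v)\<^sup>2"
      using power_mono[OF fle[OF v] norm_ge_zero, of 2] by (simp only: cmod_power2)
    then show ?thesis using re by (simp add: complex_eq_iff)
  qed
  moreover have "f \<in> linear_maps E complex_ring"
    using fadd fscale by (rule linear_maps_complexI)
  ultimately show ?thesis
    using fle by (intro bexI[of _ f]) (simp_all add: contractions_def)
qed

text \<open>With c = 0 the bound makes \<alpha> Lipschitz along the dense sequence, which gives a
  continuous extension. With general c it says that \<alpha> respects a linear combination up to the
  error with which a member of the sequence approximates it, and this makes the extension
  linear.\<close>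

lemma extend_from_dense:
  fixes \<alpha> :: "nat \<Rightarrow> complex"
  assumes \<phi>: "\<And>i. \<phi> i \<in> carrier E" and dense: "norm_topology E closure_of range \<phi> = carrier E" and C: "C \<ge> 0"
    and bound: "\<And>c i j k. cmod (c * \<alpha> i + \<alpha> j - \<alpha> k) \<le> C * nrm E (c \<odot> \<phi> i \<oplus> \<phi> j \<ominus> \<phi> k)"
  shows "\<exists>f\<in>linear_maps E complex_ring. (\<forall>i. f (\<phi> i) = \<alpha> i) \<and> (\<forall>v\<in>carrier E. cmod (f v) \<le> C * nrm E v)"
proof -
  have near: "\<exists>i. nrm E (\<phi> i \<ominus> v) < e" if "v \<in> carrier E" "e > 0" for v e
    using dense_iff[of "range \<phi>"] \<phi> dense that by auto
  have lip: "cmod (\<alpha> i - \<alpha> j) \<le> C * nrm E (\<phi> i \<ominus> \<phi> j)" for i j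
    using bound[of 0 i i j] \<phi> by (simp add: smult_simps)
  define N where "N v n = (SOME i. nrm E (\<phi> i \<ominus> v) < 1 / real (Suc n))" for v and n :: nat
  have N: "nrm E (\<phi> (N v n) \<ominus> v) < 1 / real (Suc n)" if "v \<in> carrier E" for v n
  proof -
    have "1 / real (Suc n) > 0" by simp
    from near[OF that this] show ?thesis unfolding N_def by (rule someI_ex)
  qed
  have N0: "(\<lambda>n. nrm E (\<phi> (N v n) \<ominus> v)) \<longlonglongrightarrow> 0" if "v \<in> carrier E" for v
    by (rule tendsto_sandwich[OF _ _ tendsto_const LIMSEQ_Suc[OF lim_1_over_n]])
      (use N[OF that] \<phi> that in \<open>auto intro!: always_eventually less_imp_le simp del: of_nat_Suc\<close>)
  have "Cauchy (\<lambda>n. \<alpha> (N v n))" if v: "v \<in> carrier E" for v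
  proof (rule metric_CauchyI)
    fix e :: real assume e: "e > 0"
    \<comment> \<open>The summand 1 keeps d positive and finite when C = 0.\<close>
    define d where "d = e / (2 * (C + 1))"
    have d: "d > 0" using e C by (simp add: d_def)
    obtain M where M: "\<And>n. n \<ge> M \<Longrightarrow> nrm E (\<phi> (N v n) \<ominus> v) < d"
      using order_tendstoD(2)[OF N0[OF v] d] unfolding eventually_sequentially by blast
    have "dist (\<alpha> (N v m)) (\<alpha> (N v n)) < e" if "m \<ge> M" "n \<ge> M" for m n
    proof -
      have "nrm E (\<phi> (N v m) \<ominus> \<phi> (N v n)) \<le> 2 * d"
        using nrm_minus_triangle[of "\<phi> (N v m)" v "\<phi> (N v n)"] nrm_minus_commute[of v "\<phi> (N v n)"]
          M[OF that(1)] M[OF that(2)] \<phi> v by simp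
      then have "C * nrm E (\<phi> (N v m) \<ominus> \<phi> (N v n)) \<le> C * (2 * d)" using C by (rule mult_left_mono)
      also have "\<dots> < e" using e C by (simp add: d_def field_simps)
      finally show ?thesis using lip[of "N v m" "N v n"] by (simp add: dist_norm)
    qed
    then show "\<exists>M. \<forall>m\<ge>M. \<forall>n\<ge>M. dist (\<alpha> (N v m)) (\<alpha> (N v n)) < e" by blast
  qed
  then have "\<forall>v\<in>carrier E. \<exists>z. (\<lambda>n. \<alpha> (N v n)) \<longlonglongrightarrow> z"
    unfolding convergent_def[symmetric] by (intro ballI Cauchy_convergent)
  then obtain f where f: "\<And>v. v \<in> carrier E \<Longrightarrow> (\<lambda>n. \<alpha> (N v n)) \<longlonglongrightarrow> f v"
    unfolding bchoice_iff by blast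
  have key: "cmod (\<alpha> i - f v) \<le> C * nrm E (\<phi> i \<ominus> v)" if v: "v \<in> carrier E" for i v
  proof (rule LIMSEQ_le)
    show "(\<lambda>n. cmod (\<alpha> i - \<alpha> (N v n))) \<longlonglongrightarrow> cmod (\<alpha> i - f v)"
      by (intro tendsto_intros f v)
    show "(\<lambda>n. C * (nrm E (\<phi> i \<ominus> v) + nrm E (\<phi> (N v n) \<ominus> v))) \<longlonglongrightarrow> C * nrm E (\<phi> i \<ominus> v)"
      using tendsto_mult[OF tendsto_const tendsto_add[OF tendsto_const N0[OF v]]] by simp
    have "cmod (\<alpha> i - \<alpha> (N v n)) \<le> C * (nrm E (\<phi> i \<ominus> v) + nrm E (\<phi> (N v n) \<ominus> v))" for n
      using lip[of i "N v n"] mult_left_mono[OF nrm_minus_triangle[of "\<phi> i" v "\<phi> (N v n)"] C]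
        nrm_minus_commute[of v "\<phi> (N v n)"] \<phi> v by simp
    then show "\<exists>N'. \<forall>n\<ge>N'. cmod (\<alpha> i - \<alpha> (N v n)) \<le> C * (nrm E (\<phi> i \<ominus> v) + nrm E (\<phi> (N v n) \<ominus> v))"
      by blast
  qed
  have f\<phi>: "f (\<phi> i) = \<alpha> i" for i
    using key[OF \<phi>, of i i] \<phi> by (simp add: minus_self)
  have lin: "c * f v + f w = f (c \<odot> v \<oplus> w)" if v: "v \<in> carrier E" and w: "w \<in> carrier E" for c v w
  proof -
    let ?u = "c \<odot> v \<oplus> w"
    have u: "?u \<in> carrier E" using v w by (simp add: smult_simps)
    \<comment> \<open>Half of K comes from the three-term bound at vectors within d of v, w and
      their combination, the other half from replacing the three values of f by values of
      \<alpha>.\<close>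
    define K where "K = 2 * C * (cmod c + 2)"
    have Kd: "cmod (c * f v + f w - f ?u) \<le> K * d" if d: "d > 0" for d
    proof -
      obtain i j k where ijk: "nrm E (\<phi> i \<ominus> v) < d" "nrm E (\<phi> j \<ominus> w) < d" "nrm E (\<phi> k \<ominus> ?u) < d"
        using near[OF v d] near[OF w d] near[OF u d] by blast
      have "nrm E (c \<odot> \<phi> i \<oplus> \<phi> j \<ominus> \<phi> k) \<le> nrm E (c \<odot> \<phi> i \<oplus> \<phi> j \<ominus> ?u) + nrm E (\<phi> k \<ominus> ?u)"
        using nrm_minus_triangle[of "c \<odot> \<phi> i \<oplus> \<phi> j" ?u "\<phi> k"] nrm_minus_commute[of ?u "\<phi> k"] \<phi> v w u
        by (simp add: smult_simps)
      also have "nrm E (c \<odot> \<phi> i \<oplus> \<phi> j \<ominus> ?u) \<le> cmod c * nrm E (\<phi> i \<ominus> v) + nrm E (\<phi> j \<ominus> w)"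
        using nrm_add_minus_add[of "c \<odot> \<phi> i" "\<phi> j" "c \<odot> v" w] \<phi> v w by (simp add: smult_simps nrm_smult_minus)
      also have "cmod c * nrm E (\<phi> i \<ominus> v) \<le> cmod c * d"
        using ijk by (intro mult_left_mono) auto
      finally have "nrm E (c \<odot> \<phi> i \<oplus> \<phi> j \<ominus> \<phi> k) \<le> (cmod c + 2) * d"
        using ijk by (simp add: algebra_simps)
      then have 1: "cmod (c * \<alpha> i + \<alpha> j - \<alpha> k) \<le> C * ((cmod c + 2) * d)"
        using bound[of c i j k] mult_left_mono[OF _ C] order_trans by blast
      have *: "cmod (\<alpha> l - f x) \<le> C * d" if "x \<in> carrier E" "nrm E (\<phi> l \<ominus> x) < d" for l x
        using key[OF that(1), of l] mult_left_mono[OF less_imp_le[OF that(2)] C] by simp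
      have eq: "c * f v + f w - f ?u = (c * \<alpha> i + \<alpha> j - \<alpha> k) - c * (\<alpha> i - f v) - (\<alpha> j - f w) + (\<alpha> k - f ?u)"
        by (simp add: algebra_simps)
      have "cmod (c * f v + f w - f ?u) \<le> cmod (c * \<alpha> i + \<alpha> j - \<alpha> k) + cmod (c * (\<alpha> i - f v)) + cmod (\<alpha> j - f w) + cmod (\<alpha> k - f ?u)"
        unfolding eq using norm_triangle_ineq[of "(c * \<alpha> i + \<alpha> j - \<alpha> k) - c * (\<alpha> i - f v) - (\<alpha> j - f w)" "\<alpha> k - f ?u"]
          norm_triangle_ineq4[of "(c * \<alpha> i + \<alpha> j - \<alpha> k) - c * (\<alpha> i - f v)" "\<alpha> j - f w"]
          norm_triangle_ineq4[of "c * \<alpha> i + \<alpha> j - \<alpha> k" "c * (\<alpha> i - f v)"]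
        by linarith
      also have "cmod (c * (\<alpha> i - f v)) \<le> cmod c * (C * d)"
        unfolding norm_mult using *[OF v ijk(1)] by (intro mult_left_mono) auto
      finally show ?thesis using 1 *[OF w ijk(2)] *[OF u ijk(3)] by (simp add: K_def algebra_simps)
    qed
    have "cmod (c * f v + f w - f ?u) \<le> e" if "e > 0" for e
    proof -
      have K: "K \<ge> 0" using C by (simp add: K_def)
      have "K * (e / (K + 1)) \<le> e" using K that by (simp add: field_simps)
      then show ?thesis using Kd[of "e / (K + 1)"] K that by simp
    qed
    then have "cmod (c * f v + f w - f ?u) \<le> 0" by (rule field_le_epsilon[of _ 0, simplified])
    then show ?thesis by simp
  qed
  have f0: "f \<zero> = 0" using lin[of \<zero> \<zero> 1] by (simp add: smult_simps)
  have "f (a \<oplus> b) = f a + f b" if "a \<in> carrier E" "b \<in> carrier E" for a b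
    using lin[of a b 1] that by (simp add: smult_simps)
  moreover have "f (c \<odot> a) = c * f a" if "a \<in> carrier E" for a c
    using lin[of a \<zero> c] that f0 by (simp add: smult_simps)
  moreover have "cmod (f v) \<le> C * nrm E v" if v: "v \<in> carrier E" for v
  proof (rule LIMSEQ_le)
    show "(\<lambda>n. cmod (\<alpha> (N v n))) \<longlonglongrightarrow> cmod (f v)" by (intro tendsto_intros f v)
    show "(\<lambda>n. C * (nrm E v + nrm E (\<phi> (N v n) \<ominus> v))) \<longlonglongrightarrow> C * nrm E v"
      using tendsto_mult[OF tendsto_const tendsto_add[OF tendsto_const N0[OF v]]] by simp
    have "cmod (\<alpha> (N v n)) \<le> C * (nrm E v + nrm E (\<phi> (N v n) \<ominus> v))" for n
    proof -
      \<comment> \<open>Equal indices and scalar 1 reduce the three-term bound to a bound on a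
        single value.\<close>
      have "1 \<odot> \<phi> i \<oplus> \<phi> i \<ominus> \<phi> i = \<phi> i" for i
        using \<phi>[of i] by (simp add: smult_simps add_minus_cancel)
      from bound[of 1 "N v n" "N v n" "N v n", unfolded this]
      have "cmod (\<alpha> (N v n)) \<le> C * nrm E (\<phi> (N v n))" by simp
      also have "\<dots> \<le> C * (nrm E v + nrm E (\<phi> (N v n) \<ominus> v))"
        by (rule mult_left_mono[OF nrm_le_add_minus[OF \<phi> v] C])
      finally show ?thesis .
    qed
    then show "\<exists>N'. \<forall>n\<ge>N'. cmod (\<alpha> (N v n)) \<le> C * (nrm E v + nrm E (\<phi> (N v n) \<ominus> v))" by blast
  qed
  ultimately show ?thesis
    using f\<phi> linear_maps_complexI[of f] by (intro bexI[of _ f]) blast+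
qed

end

section \<open>Completions\<close>

context complex_normed_space
begin

lemma MCauchy_carrier: "Met.MCauchy s \<Longrightarrow> s n \<in> carrier E"
  by (auto simp: Met.MCauchy_def)

lemma MCauchy_iff:
  "Met.MCauchy s \<longleftrightarrow> (\<forall>n. s n \<in> carrier E) \<and> (\<forall>e>0. \<exists>N. \<forall>m\<ge>N. \<forall>n\<ge>N. nrm E (s m \<ominus> s n) < e)"
proof -
  have "(\<forall>n. s n \<in> carrier E) \<Longrightarrow> ndist E (s m) (s n) = nrm E (s m \<ominus> s n)" for m n
    by (simp add: ndist_eq)
  then show ?thesis unfolding Met.MCauchy_def by (auto simp: image_subset_iff)
qed

lemma MCauchy_add: "Met.MCauchy s \<Longrightarrow> Met.MCauchy t \<Longrightarrow> Met.MCauchy (\<lambda>n. s n \<oplus> t n)"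
  unfolding MCauchy_iff
proof (intro conjI allI impI)
  fix e :: real assume "e > 0"
    and s: "(\<forall>n. s n \<in> carrier E) \<and> (\<forall>e>0. \<exists>N. \<forall>m\<ge>N. \<forall>n\<ge>N. nrm E (s m \<ominus> s n) < e)"
    and t: "(\<forall>n. t n \<in> carrier E) \<and> (\<forall>e>0. \<exists>N. \<forall>m\<ge>N. \<forall>n\<ge>N. nrm E (t m \<ominus> t n) < e)"
  then obtain N1 N2 where N: "\<forall>m\<ge>N1. \<forall>n\<ge>N1. nrm E (s m \<ominus> s n) < e/2" "\<forall>m\<ge>N2. \<forall>n\<ge>N2. nrm E (t m \<ominus> t n) < e/2"
    by (meson half_gt_zero)
  have "nrm E ((s m \<oplus> t m) \<ominus> (s n \<oplus> t n)) < e" if "m \<ge> max N1 N2" "n \<ge> max N1 N2" for m n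
  proof -
    have "nrm E (s m \<ominus> s n) < e/2" "nrm E (t m \<ominus> t n) < e/2" using N that by auto
    moreover have "nrm E ((s m \<oplus> t m) \<ominus> (s n \<oplus> t n)) \<le> nrm E (s m \<ominus> s n) + nrm E (t m \<ominus> t n)"
      using s t by (intro nrm_add_minus_add) auto
    ultimately show ?thesis by linarith
  qed
  then show "\<exists>N. \<forall>m\<ge>N. \<forall>n\<ge>N. nrm E ((s m \<oplus> t m) \<ominus> (s n \<oplus> t n)) < e" by blast
qed auto

lemma MCauchy_smult: "Met.MCauchy s \<Longrightarrow> Met.MCauchy (\<lambda>n. c \<odot> s n)"
  unfolding MCauchy_iff
proof (intro conjI allI impI)
  fix e :: real assume e: "e > 0"
    and s: "(\<forall>n. s n \<in> carrier E) \<and> (\<forall>e>0. \<exists>N. \<forall>m\<ge>N. \<forall>n\<ge>N. nrm E (s m \<ominus> s n) < e)"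
  have "e / (cmod c + 1) > 0" using e by (intro divide_pos_pos) (auto intro: add_nonneg_pos)
  then obtain N where N: "\<forall>m\<ge>N. \<forall>n\<ge>N. nrm E (s m \<ominus> s n) < e / (cmod c + 1)"
    using s by blast
  have "nrm E (c \<odot> s m \<ominus> c \<odot> s n) < e" if "m \<ge> N" "n \<ge> N" for m n
  proof -
    have 1: "nrm E (s m \<ominus> s n) < e / (cmod c + 1)" using N that by auto
    have "cmod c * nrm E (s m \<ominus> s n) \<le> (cmod c + 1) * nrm E (s m \<ominus> s n)"
      using s by (intro mult_right_mono) auto
    also have "\<dots> < e" using 1 by (simp add: pos_less_divide_eq add_nonneg_pos mult.commute)
    finally show ?thesis using s by (simp add: nrm_smult_minus)
  qed
  then show "\<exists>N. \<forall>m\<ge>N. \<forall>n\<ge>N. nrm E (c \<odot> s m \<ominus> c \<odot> s n) < e" by blast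
qed (auto simp: smult_simps)

lemma cauchy_equiv_iff:
  "(s, t) \<in> cauchy_equiv E \<longleftrightarrow> Met.MCauchy s \<and> Met.MCauchy t \<and> (\<lambda>n. nrm E (s n \<ominus> t n)) \<longlonglongrightarrow> 0"
  unfolding cauchy_equiv_def by (auto simp: ndist_eq MCauchy_carrier)

lemma equiv_cauchy_equiv: "equiv {s. Met.MCauchy s} (cauchy_equiv E)"
proof (rule equivI)
  show "cauchy_equiv E \<subseteq> {s. Met.MCauchy s} \<times> {s. Met.MCauchy s}"
    by (auto simp: cauchy_equiv_iff)
  show "refl_on {s. Met.MCauchy s} (cauchy_equiv E)"
    by (auto simp: refl_on_def cauchy_equiv_iff minus_self MCauchy_carrier)
  show "sym (cauchy_equiv E)"
  proof (rule symI)
    fix s t assume st: "(s, t) \<in> cauchy_equiv E"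
    then have "(\<lambda>n. nrm E (t n \<ominus> s n)) = (\<lambda>n. nrm E (s n \<ominus> t n))"
      by (auto simp: cauchy_equiv_iff nrm_minus_commute MCauchy_carrier)
    then show "(t, s) \<in> cauchy_equiv E" using st by (simp add: cauchy_equiv_iff)
  qed
  show "trans (cauchy_equiv E)"
  proof (rule transI)
    fix s t u assume st: "(s, t) \<in> cauchy_equiv E" and tu: "(t, u) \<in> cauchy_equiv E"
    have "(\<lambda>n. nrm E (s n \<ominus> u n)) \<longlonglongrightarrow> 0"
    proof (rule tendsto_sandwich[OF _ _ tendsto_const])
      show "(\<lambda>n. nrm E (s n \<ominus> t n) + nrm E (t n \<ominus> u n)) \<longlonglongrightarrow> 0"
        using st tu by (intro tendsto_add_zero) (simp_all add: cauchy_equiv_iff)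
    qed (use st tu in \<open>auto simp: cauchy_equiv_iff MCauchy_carrier nrm_minus_triangle\<close>)
    then show "(s, u) \<in> cauchy_equiv E" using st tu by (simp add: cauchy_equiv_iff)
  qed
qed

definition lim_class :: "(nat \<Rightarrow> 'a) \<Rightarrow> (nat \<Rightarrow> 'a) set" where
  "lim_class s = cauchy_equiv E `` {s}"

lemma lim_class_eq_iff:
  "Met.MCauchy s \<Longrightarrow> Met.MCauchy t \<Longrightarrow> lim_class s = lim_class t \<longleftrightarrow> (\<lambda>n. nrm E (s n \<ominus> t n)) \<longlonglongrightarrow> 0"
  unfolding lim_class_def using eq_equiv_class_iff[OF equiv_cauchy_equiv] by (simp add: cauchy_equiv_iff)

lemma carrier_completion: "carrier (completion E) = {lim_class s | s. Met.MCauchy s}"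
  by (auto simp: completion_def lim_class_def quotient_def)

lemma completion_cases:
  assumes "A \<in> carrier (completion E)"
  obtains s where "Met.MCauchy s" "A = lim_class s"
  using assms by (auto simp: carrier_completion)

lemma zero_completion: "zero (completion E) = lim_class (\<lambda>n. \<zero>)"
  by (simp add: completion_def lim_class_def)

lemma to_completion_eq: "to_completion E a = lim_class (\<lambda>n. a)"
  by (simp add: to_completion_def lim_class_def)

lemma add_completion:
  assumes "Met.MCauchy s" "Met.MCauchy t"
  shows "lim_class s \<oplus>\<^bsub>completion E\<^esub> lim_class t = lim_class (\<lambda>n. s n \<oplus> t n)"
proof -
  have "congruent2 (cauchy_equiv E) (cauchy_equiv E) (\<lambda>s t. lim_class (\<lambda>n. s n \<oplus> t n))"
  proof (rule congruent2I')
    fix s s' t t' assume s: "(s, s') \<in> cauchy_equiv E" and t: "(t, t') \<in> cauchy_equiv E"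
    have "(\<lambda>n. nrm E ((s n \<oplus> t n) \<ominus> (s' n \<oplus> t' n))) \<longlonglongrightarrow> 0"
    proof (rule tendsto_sandwich[OF _ _ tendsto_const])
      show "(\<lambda>n. nrm E (s n \<ominus> s' n) + nrm E (t n \<ominus> t' n)) \<longlonglongrightarrow> 0"
        using s t by (intro tendsto_add_zero) (simp_all add: cauchy_equiv_iff)
    qed (use s t in \<open>auto simp: cauchy_equiv_iff MCauchy_carrier nrm_add_minus_add\<close>)
    then show "lim_class (\<lambda>n. s n \<oplus> t n) = lim_class (\<lambda>n. s' n \<oplus> t' n)"
      using s t by (simp add: cauchy_equiv_iff lim_class_eq_iff MCauchy_add)
  qed
  from UN_equiv_class2[OF equiv_cauchy_equiv equiv_cauchy_equiv this] assms
  show ?thesis by (simp add: completion_def lim_class_def)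
qed

lemma smult_completion:
  assumes "Met.MCauchy s"
  shows "c \<odot>\<^bsub>completion E\<^esub> lim_class s = lim_class (\<lambda>n. c \<odot> s n)"
proof -
  have "congruent (cauchy_equiv E) (\<lambda>s. lim_class (\<lambda>n. c \<odot> s n))"
  proof (rule congruentI)
    fix s s' assume s: "(s, s') \<in> cauchy_equiv E"
    have "(\<lambda>n. cmod c * nrm E (s n \<ominus> s' n)) \<longlonglongrightarrow> 0"
      using s tendsto_mult_right_zero by (auto simp: cauchy_equiv_iff)
    then show "lim_class (\<lambda>n. c \<odot> s n) = lim_class (\<lambda>n. c \<odot> s' n)"
      using s by (simp add: cauchy_equiv_iff lim_class_eq_iff MCauchy_smult nrm_smult_minus MCauchy_carrier)
  qed
  from UN_equiv_class[OF equiv_cauchy_equiv this] assms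
  show ?thesis by (simp add: completion_def lim_class_def)
qed

lemma convergent_nrm:
  assumes s: "Met.MCauchy s"
  shows "convergent (\<lambda>n. nrm E (s n))"
proof (rule Cauchy_convergent, rule metric_CauchyI)
  fix e :: real assume "e > 0"
  then obtain N where N: "\<forall>m\<ge>N. \<forall>n\<ge>N. nrm E (s m \<ominus> s n) < e" using s unfolding MCauchy_iff by blast
  have "dist (nrm E (s m)) (nrm E (s n)) < e" if "m \<ge> N" "n \<ge> N" for m n
    using abs_nrm_diff_le[of "s m" "s n"] N[rule_format, OF that] MCauchy_carrier[OF s]
    by (simp add: dist_real_def ndist_eq)
  then show "\<exists>M. \<forall>m\<ge>M. \<forall>n\<ge>M. dist (nrm E (s m)) (nrm E (s n)) < e" by blast
qed

text \<open>The description of the norm in \<open>completion\<close> denotes a value because norms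
  along equivalent Cauchy sequences have the same limit.\<close>

lemma tendsto_nrm_completion:
  assumes s: "Met.MCauchy s"
  shows "(\<lambda>n. nrm E (s n)) \<longlonglongrightarrow> nrm (completion E) (lim_class s)"
proof -
  obtain r where r: "(\<lambda>n. nrm E (s n)) \<longlonglongrightarrow> r" using convergent_nrm[OF s] unfolding convergent_def by blast
  have r': "(\<lambda>n. nrm E (t n)) \<longlonglongrightarrow> r" if "t \<in> lim_class s" for t
  proof -
    have st: "(s, t) \<in> cauchy_equiv E" using that by (simp add: lim_class_def)
    have "(\<lambda>n. nrm E (s n) - nrm E (t n)) \<longlonglongrightarrow> 0"
      by (rule Lim_null_comparison[of _ "\<lambda>n. nrm E (s n \<ominus> t n)"])
        (use st abs_nrm_diff_le in \<open>auto simp: cauchy_equiv_iff MCauchy_carrier ndist_eq\<close>)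
    from tendsto_diff[OF r this] show ?thesis by simp
  qed
  have ss: "s \<in> lim_class s" using s by (simp add: lim_class_def cauchy_equiv_iff minus_self MCauchy_carrier)
  have "(THE r. \<forall>t\<in>lim_class s. (\<lambda>n. nrm E (t n)) \<longlonglongrightarrow> r) = r"
    by (rule the_equality) (use r' ss LIMSEQ_unique in blast)+
  then show ?thesis using r by (simp add: completion_def)
qed

lemma nrm_completion_eq: "Met.MCauchy s \<Longrightarrow> (\<lambda>n. nrm E (s n)) \<longlonglongrightarrow> r \<Longrightarrow> nrm (completion E) (lim_class s) = r"
  using tendsto_nrm_completion LIMSEQ_unique by blast

lemma MCauchy_zero: "Met.MCauchy (\<lambda>n. \<zero>)" by simp

lemma complex_normed_space_completion: "complex_normed_space (completion E)"
proof (rule complex_normed_spaceI)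
  note simps = add_completion smult_completion zero_completion MCauchy_add MCauchy_smult MCauchy_carrier smult_simps
  show "abelian_group (completion E)"
  proof (rule abelian_groupI)
    fix A assume "A \<in> carrier (completion E)"
    then obtain s where s: "Met.MCauchy s" "A = lim_class s" by (rule completion_cases)
    have "(-1) \<odot> s n \<oplus> s n = \<zero>" for n
      using M.l_neg[OF MCauchy_carrier[OF s(1)], of n] by (simp add: uminus_eq_smult[OF MCauchy_carrier[OF s(1)]])
    then show "\<exists>B\<in>carrier (completion E). B \<oplus>\<^bsub>completion E\<^esub> A = \<zero>\<^bsub>completion E\<^esub>"
      using s by (intro bexI[of _ "lim_class (\<lambda>n. (-1) \<odot> s n)"])
        (auto simp: simps carrier_completion)
  qed (auto simp: simps carrier_completion M.a_ac; metis MCauchy_add MCauchy_zero)+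
next
  fix A assume A: "A \<in> carrier (completion E)" "nrm (completion E) A = 0"
  then obtain s where s: "Met.MCauchy s" "A = lim_class s" by (metis completion_cases)
  have "(\<lambda>n. nrm E (s n \<ominus> \<zero>)) \<longlonglongrightarrow> 0"
    using tendsto_nrm_completion[OF s(1)] A s by (simp add: minus_zero MCauchy_carrier)
  then show "A = \<zero>\<^bsub>completion E\<^esub>" using s by (simp add: zero_completion lim_class_eq_iff)
next
  fix c A assume "A \<in> carrier (completion E)"
  then obtain s where s: "Met.MCauchy s" "A = lim_class s" by (rule completion_cases)
  have "(\<lambda>n. nrm E (c \<odot> s n)) \<longlonglongrightarrow> cmod c * nrm (completion E) (lim_class s)"
    using tendsto_mult[OF tendsto_const tendsto_nrm_completion[OF s(1)]] by (simp add: nrm_smult MCauchy_carrier[OF s(1)])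
  then show "nrm (completion E) (c \<odot>\<^bsub>completion E\<^esub> A) = cmod c * nrm (completion E) A"
    using s by (simp add: smult_completion nrm_completion_eq MCauchy_smult)
next
  fix A B assume "A \<in> carrier (completion E)" "B \<in> carrier (completion E)"
  then obtain s t where s: "Met.MCauchy s" "A = lim_class s" and t: "Met.MCauchy t" "B = lim_class t" by (metis completion_cases)
  have "nrm (completion E) (lim_class (\<lambda>n. s n \<oplus> t n)) \<le> nrm (completion E) (lim_class s) + nrm (completion E) (lim_class t)"
    by (rule LIMSEQ_le[OF tendsto_nrm_completion[OF MCauchy_add[OF s(1) t(1)]]
          tendsto_add[OF tendsto_nrm_completion[OF s(1)] tendsto_nrm_completion[OF t(1)]]])
      (auto simp: nrm_triangle MCauchy_carrier s t)
  then show "nrm (completion E) (A \<oplus>\<^bsub>completion E\<^esub> B) \<le> nrm (completion E) A + nrm (completion E) B"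
    using s t by (simp add: add_completion)
qed (auto simp: carrier_completion add_completion smult_completion MCauchy_add MCauchy_smult MCauchy_carrier smult_simps;
    metis MCauchy_add MCauchy_smult)+

interpretation C: complex_normed_space "completion E"
  by (rule complex_normed_space_completion)

lemma to_completion_closed: "a \<in> carrier E \<Longrightarrow> to_completion E a \<in> carrier (completion E)"
  by (auto simp: to_completion_eq carrier_completion)

lemma to_completion_add:
  "a \<in> carrier E \<Longrightarrow> b \<in> carrier E \<Longrightarrow>
    to_completion E (a \<oplus> b) = to_completion E a \<oplus>\<^bsub>completion E\<^esub> to_completion E b"
  by (simp add: to_completion_eq add_completion)

lemma to_completion_smult: "a \<in> carrier E \<Longrightarrow> to_completion E (c \<odot> a) = c \<odot>\<^bsub>completion E\<^esub> to_completion E a"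
  by (simp add: to_completion_eq smult_completion)

lemma to_completion_minus:
  "a \<in> carrier E \<Longrightarrow> b \<in> carrier E \<Longrightarrow>
    to_completion E (a \<ominus> b) = to_completion E a \<ominus>\<^bsub>completion E\<^esub> to_completion E b"
  by (simp add: minus_eq_smult C.minus_eq_smult to_completion_add to_completion_smult to_completion_closed smult_simps)

lemma nrm_to_completion: "a \<in> carrier E \<Longrightarrow> nrm (completion E) (to_completion E a) = nrm E a"
  by (simp add: to_completion_eq nrm_completion_eq)

lemma nrm_completion_minus_to_completion:
  assumes s: "Met.MCauchy s" and a: "a \<in> carrier E"
  shows "(\<lambda>n. nrm E (s n \<ominus> a)) \<longlonglongrightarrow> ndiff (completion E) (lim_class s) (to_completion E a)"
proof -
  have eq: "lim_class s \<ominus>\<^bsub>completion E\<^esub> to_completion E a = lim_class (\<lambda>n. s n \<oplus> (-1) \<odot> a)"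
    using s a by (subst C.minus_eq_smult)
      (auto simp: to_completion_eq carrier_completion smult_completion add_completion smult_simps)
  show ?thesis
    unfolding eq using tendsto_nrm_completion[of "\<lambda>n. s n \<oplus> (-1) \<odot> a"] s a
    by (simp add: minus_eq_smult MCauchy_carrier MCauchy_add smult_simps)
qed

lemma to_completion_dense:
  assumes A: "A \<in> carrier (completion E)" and e: "e > 0"
  shows "\<exists>a\<in>carrier E. ndiff (completion E) A (to_completion E a) < e"
proof -
  obtain s where s: "Met.MCauchy s" "A = lim_class s" using A by (rule completion_cases)
  obtain N where N: "\<forall>m\<ge>N. \<forall>n\<ge>N. nrm E (s m \<ominus> s n) < e/2"
    using s(1) e unfolding MCauchy_iff by (meson half_gt_zero)
  have "ndiff (completion E) A (to_completion E (s N)) \<le> e/2"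
    unfolding s(2)
    by (rule LIMSEQ_le_const2[OF nrm_completion_minus_to_completion[OF s(1) MCauchy_carrier[OF s(1)]]])
      (use N in \<open>auto intro!: exI[of _ N] less_imp_le\<close>)
  then show ?thesis using e MCauchy_carrier[OF s(1)] by (intro bexI[of _ "s N"]) auto
qed

text \<open>The k-th member of a Cauchy sequence of classes is within 1/(k+1) of an embedded element
  a k. The sequence a is Cauchy in E, and its own class is the limit.\<close>

lemma complex_banach_space_completion: "complex_banach_space (completion E)"
  unfolding complex_banach_space_def
proof (intro conjI complex_normed_space_completion)
  let ?C = "completion E" and ?\<iota> = "to_completion E"
  show "C.Met.mcomplete"
    unfolding C.Met.mcomplete_def
  proof (intro allI impI)
    fix \<sigma> assume \<sigma>: "C.Met.MCauchy \<sigma>"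
    have \<sigma>c: "\<sigma> k \<in> carrier ?C" for k using C.MCauchy_carrier[OF \<sigma>] .
    have "\<forall>k. \<exists>a\<in>carrier E. ndiff ?C (\<sigma> k) (?\<iota> a) < 1 / real (Suc k)"
      using to_completion_dense[OF \<sigma>c] by simp
    then obtain a where a: "\<And>k. a k \<in> carrier E" and ak: "\<And>k. ndiff ?C (\<sigma> k) (?\<iota> (a k)) < 1 / real (Suc k)"
      by metis
    have \<iota>: "?\<iota> (a k) \<in> carrier ?C" for k using a to_completion_closed by blast
    have "Met.MCauchy a"
      unfolding MCauchy_iff
    proof (intro conjI allI impI a)
      fix e :: real assume e: "e > 0"
      obtain N1 where N1: "\<forall>m\<ge>N1. \<forall>n\<ge>N1. ndiff ?C (\<sigma> m) (\<sigma> n) < e/3"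
        using \<sigma> e unfolding C.MCauchy_iff by (metis divide_pos_pos zero_less_numeral)
      obtain N2 where N2: "inverse (real (Suc N2)) < e/3" using reals_Archimedean[of "e/3"] e by auto
      have "nrm E (a m \<ominus> a n) < e" if mn: "m \<ge> max N1 N2" "n \<ge> max N1 N2" for m n
      proof -
        have "1 / real (Suc m) \<le> inverse (real (Suc N2))" "1 / real (Suc n) \<le> inverse (real (Suc N2))"
          using mn by (auto simp: field_simps)
        then have "ndiff ?C (\<sigma> m) (?\<iota> (a m)) < e/3" "ndiff ?C (\<sigma> n) (?\<iota> (a n)) < e/3"
          using ak[of m] ak[of n] N2 by linarith+
        moreover have "ndiff ?C (\<sigma> m) (\<sigma> n) < e/3" using N1 mn by auto
        moreover have "nrm E (a m \<ominus> a n) = ndiff ?C (?\<iota> (a m)) (?\<iota> (a n))"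
          using a by (simp flip: to_completion_minus add: nrm_to_completion)
        moreover have "ndiff ?C (?\<iota> (a m)) (?\<iota> (a n)) \<le> ndiff ?C (?\<iota> (a m)) (\<sigma> m) + ndiff ?C (\<sigma> m) (?\<iota> (a n))"
          using \<sigma>c \<iota> by (intro C.nrm_minus_triangle)
        moreover have "ndiff ?C (\<sigma> m) (?\<iota> (a n)) \<le> ndiff ?C (\<sigma> m) (\<sigma> n) + ndiff ?C (\<sigma> n) (?\<iota> (a n))"
          using \<sigma>c \<iota> by (intro C.nrm_minus_triangle)
        moreover have "ndiff ?C (?\<iota> (a m)) (\<sigma> m) = ndiff ?C (\<sigma> m) (?\<iota> (a m))"
          using \<sigma>c \<iota> by (intro C.nrm_minus_commute)
        ultimately show ?thesis by linarith
      qed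
      then show "\<exists>N. \<forall>m\<ge>N. \<forall>n\<ge>N. nrm E (a m \<ominus> a n) < e" by blast
    qed
    note aC = this
    have L: "lim_class a \<in> carrier ?C" using aC by (auto simp: carrier_completion)
    have "limitin C.Met.mtopology \<sigma> (lim_class a) sequentially"
      unfolding C.Met.limit_metric_sequentially
    proof (intro conjI allI impI L)
      fix e :: real assume e: "e > 0"
      obtain N1 where N1: "\<forall>m\<ge>N1. \<forall>n\<ge>N1. nrm E (a m \<ominus> a n) < e/3"
        using aC e unfolding MCauchy_iff by (metis divide_pos_pos zero_less_numeral)
      obtain N2 where N2: "inverse (real (Suc N2)) < e/3" using reals_Archimedean[of "e/3"] e by auto
      have "\<sigma> n \<in> carrier ?C \<and> ndist ?C (\<sigma> n) (lim_class a) < e" if n: "n \<ge> max N1 N2" for n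
      proof -
        have "ndiff ?C (lim_class a) (?\<iota> (a n)) \<le> e/3"
          by (rule LIMSEQ_le_const2[OF nrm_completion_minus_to_completion[OF aC a]])
            (use N1 n in \<open>auto intro!: exI[of _ N1] less_imp_le\<close>)
        moreover have "1 / real (Suc n) \<le> inverse (real (Suc N2))" using n by (auto simp: field_simps)
        then have "ndiff ?C (\<sigma> n) (?\<iota> (a n)) < e/3" using ak[of n] N2 by linarith
        moreover have "ndiff ?C (\<sigma> n) (lim_class a) \<le> ndiff ?C (\<sigma> n) (?\<iota> (a n)) + ndiff ?C (?\<iota> (a n)) (lim_class a)"
          using \<sigma>c \<iota> L by (intro C.nrm_minus_triangle)
        moreover have "ndiff ?C (?\<iota> (a n)) (lim_class a) = ndiff ?C (lim_class a) (?\<iota> (a n))"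
          using \<iota> L by (intro C.nrm_minus_commute)
        ultimately show ?thesis using \<sigma>c L e by (simp add: C.ndist_eq)
      qed
      then show "\<exists>N. \<forall>n\<ge>N. \<sigma> n \<in> carrier ?C \<and> ndist ?C (\<sigma> n) (lim_class a) < e" by blast
    qed
    then show "\<exists>x. limitin C.Met.mtopology \<sigma> x sequentially" by blast
  qed
qed

end

section \<open>Tensor products of normed spaces\<close>

locale normed_pair = E: complex_normed_space E + F: complex_normed_space F
  for E :: "'a normed_module" and F :: "'b normed_module"
begin

abbreviation "BF \<equiv> bilinear_forms E F"
abbreviation "ts \<equiv> tensor_sum E F"

definition pairs :: "('a \<times> 'b) list \<Rightarrow> bool" where
  "pairs ps \<longleftrightarrow> set ps \<subseteq> carrier E \<times> carrier F"

definition cost :: "('a \<times> 'b) list \<Rightarrow> real" where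
  "cost ps = (\<Sum>(v, w)\<leftarrow>ps. nrm E v * nrm F w)"

lemma pairs_simps [simp]:
  "pairs []" "pairs ((v, w) # ps) \<longleftrightarrow> v \<in> carrier E \<and> w \<in> carrier F \<and> pairs ps"
  "pairs (ps @ qs) \<longleftrightarrow> pairs ps \<and> pairs qs"
  by (auto simp: pairs_def)

lemma cost_simps [simp]:
  "cost [] = 0" "cost ((v, w) # ps) = nrm E v * nrm F w + cost ps" "cost (ps @ qs) = cost ps + cost qs"
  by (simp_all add: cost_def)

lemma ts_apply: "\<beta> \<in> BF \<Longrightarrow> ts ps \<beta> = (\<Sum>(v, w)\<leftarrow>ps. \<beta> v w)"
  by (simp add: tensor_sum_def)

lemma ts_eq_iff: "ts ps = ts qs \<longleftrightarrow> (\<forall>\<beta>\<in>BF. (\<Sum>(v, w)\<leftarrow>ps. \<beta> v w) = (\<Sum>(v, w)\<leftarrow>qs. \<beta> v w))"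
  by (auto simp: tensor_sum_def restrict_def fun_eq_iff)

lemma bilinear_formD:
  assumes "\<beta> \<in> BF"
  shows "v \<in> carrier E \<Longrightarrow> v' \<in> carrier E \<Longrightarrow> w \<in> carrier F \<Longrightarrow> \<beta> (v \<oplus>\<^bsub>E\<^esub> v') w = \<beta> v w + \<beta> v' w"
    and "v \<in> carrier E \<Longrightarrow> w \<in> carrier F \<Longrightarrow> w' \<in> carrier F \<Longrightarrow> \<beta> v (w \<oplus>\<^bsub>F\<^esub> w') = \<beta> v w + \<beta> v w'"
    and "v \<in> carrier E \<Longrightarrow> w \<in> carrier F \<Longrightarrow> \<beta> (c \<odot>\<^bsub>E\<^esub> v) w = c * \<beta> v w"
    and "v \<in> carrier E \<Longrightarrow> w \<in> carrier F \<Longrightarrow> \<beta> v (c \<odot>\<^bsub>F\<^esub> w) = c * \<beta> v w"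
  using assms by (auto simp: bilinear_forms_def linear_maps_def)

lemma bilinear_form_product:
  assumes "f \<in> linear_maps E complex_ring" "g \<in> linear_maps F complex_ring"
  shows "(\<lambda>v w. f v * g w) \<in> BF"
  using assms by (auto simp: bilinear_forms_def linear_maps_def algebra_simps)

lemma carrier_alg_tensor: "carrier (alg_tensor \<alpha> E F) = {ts ps | ps. pairs ps}"
  by (simp add: alg_tensor_def pairs_def conj_commute)

lemma alg_tensor_cases:
  assumes "t \<in> carrier (alg_tensor \<alpha> E F)"
  obtains ps where "pairs ps" "t = ts ps"
  using assms by (auto simp: carrier_alg_tensor)

lemma ts_in_carrier [simp]: "pairs ps \<Longrightarrow> ts ps \<in> carrier (alg_tensor \<alpha> E F)"
  by (auto simp: carrier_alg_tensor)

lemma zero_alg_tensor: "\<zero>\<^bsub>alg_tensor \<alpha> E F\<^esub> = ts []"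
  by (simp add: alg_tensor_def tensor_sum_def)

lemma add_alg_tensor: "ts ps \<oplus>\<^bsub>alg_tensor \<alpha> E F\<^esub> ts qs = ts (ps @ qs)"
  by (auto simp: alg_tensor_def tensor_sum_def restrict_def fun_eq_iff)

definition scale :: "complex \<Rightarrow> ('a \<times> 'b) list \<Rightarrow> ('a \<times> 'b) list" where
  "scale c ps = map (\<lambda>(v, w). (c \<odot>\<^bsub>E\<^esub> v, w)) ps"

lemma scale_simps [simp]: "scale c [] = []" "scale c ((v, w) # ps) = (c \<odot>\<^bsub>E\<^esub> v, w) # scale c ps"
  by (simp_all add: scale_def)

lemma pairs_scale [simp]: "pairs ps \<Longrightarrow> pairs (scale c ps)"
  by (induction ps) (auto simp: E.smult_simps)

lemma cost_scale: "pairs ps \<Longrightarrow> cost (scale c ps) = cmod c * cost ps"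
  by (induction ps) (auto simp: E.nrm_smult algebra_simps)

lemma sum_scale: "pairs ps \<Longrightarrow> \<beta> \<in> BF \<Longrightarrow> (\<Sum>(v, w)\<leftarrow>scale c ps. \<beta> v w) = c * (\<Sum>(v, w)\<leftarrow>ps. \<beta> v w)"
  by (induction ps) (auto simp: bilinear_formD algebra_simps)

lemma smult_alg_tensor: "pairs ps \<Longrightarrow> c \<odot>\<^bsub>alg_tensor \<alpha> E F\<^esub> ts ps = ts (scale c ps)"
  by (auto simp: alg_tensor_def tensor_sum_def restrict_def fun_eq_iff sum_scale)

lemma nrm_alg_tensor [simp]: "nrm (alg_tensor \<alpha> E F) = \<alpha>"
  by (simp add: alg_tensor_def)

text \<open>An inequality for scalar multiples is enough: applied to the inverse scalar it gives the
  converse one.\<close>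

lemma complex_normed_space_alg_tensorI:
  assumes nonneg: "\<And>ps. pairs ps \<Longrightarrow> 0 \<le> \<alpha> (ts ps)"
    and definite: "\<And>ps. pairs ps \<Longrightarrow> \<alpha> (ts ps) = 0 \<Longrightarrow> ts ps = ts []"
    and scale_le: "\<And>c ps. pairs ps \<Longrightarrow> \<alpha> (ts (scale c ps)) \<le> cmod c * \<alpha> (ts ps)"
    and triangle: "\<And>ps qs. pairs ps \<Longrightarrow> pairs qs \<Longrightarrow> \<alpha> (ts (ps @ qs)) \<le> \<alpha> (ts ps) + \<alpha> (ts qs)"
  shows "complex_normed_space (alg_tensor \<alpha> E F)"
proof (rule complex_normed_spaceI)
  show "abelian_group (alg_tensor \<alpha> E F)"
  proof (rule abelian_groupI)
    fix t assume "t \<in> carrier (alg_tensor \<alpha> E F)"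
    then obtain ps where ps: "pairs ps" "t = ts ps" by (rule alg_tensor_cases)
    have "ts (scale (-1) ps @ ps) = ts []"
      using ps(1) by (simp add: ts_eq_iff sum_scale)
    then show "\<exists>s\<in>carrier (alg_tensor \<alpha> E F). s \<oplus>\<^bsub>alg_tensor \<alpha> E F\<^esub> t = \<zero>\<^bsub>alg_tensor \<alpha> E F\<^esub>"
      using ps by (intro bexI[of _ "ts (scale (-1) ps)"]) (simp_all add: add_alg_tensor zero_alg_tensor)
  next
    fix s t assume "s \<in> carrier (alg_tensor \<alpha> E F)" "t \<in> carrier (alg_tensor \<alpha> E F)"
    then show "s \<oplus>\<^bsub>alg_tensor \<alpha> E F\<^esub> t = t \<oplus>\<^bsub>alg_tensor \<alpha> E F\<^esub> s"
      by (elim alg_tensor_cases) (simp add: add_alg_tensor ts_eq_iff)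
  qed (auto elim!: alg_tensor_cases simp: add_alg_tensor zero_alg_tensor)
next
  fix c t assume "t \<in> carrier (alg_tensor \<alpha> E F)"
  then obtain ps where ps: "pairs ps" "t = ts ps" by (rule alg_tensor_cases)
  show "nrm (alg_tensor \<alpha> E F) (c \<odot>\<^bsub>alg_tensor \<alpha> E F\<^esub> t) = cmod c * nrm (alg_tensor \<alpha> E F) t"
  proof (cases "c = 0")
    case True
    then show ?thesis
      using scale_le[OF ps(1), of 0] nonneg[of "scale 0 ps"] ps by (simp add: smult_alg_tensor)
  next
    case False
    have "ts (scale (inverse c) (scale c ps)) = ts ps"
      using ps(1) False by (simp add: ts_eq_iff sum_scale)
    then have "\<alpha> (ts ps) \<le> cmod (inverse c) * \<alpha> (ts (scale c ps))"
      using scale_le[of "scale c ps" "inverse c"] ps(1) by simp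
    then have "cmod c * \<alpha> (ts ps) \<le> \<alpha> (ts (scale c ps))"
      using False by (simp add: norm_inverse norm_divide field_simps)
    then show ?thesis using scale_le[OF ps(1), of c] ps by (simp add: smult_alg_tensor)
  qed
next
  fix t assume "t \<in> carrier (alg_tensor \<alpha> E F)" "nrm (alg_tensor \<alpha> E F) t = 0"
  then show "t = \<zero>\<^bsub>alg_tensor \<alpha> E F\<^esub>"
    using definite by (elim alg_tensor_cases) (simp add: zero_alg_tensor)
next
  fix s t assume "s \<in> carrier (alg_tensor \<alpha> E F)" "t \<in> carrier (alg_tensor \<alpha> E F)"
  then show "nrm (alg_tensor \<alpha> E F) (s \<oplus>\<^bsub>alg_tensor \<alpha> E F\<^esub> t) \<le> nrm (alg_tensor \<alpha> E F) s + nrm (alg_tensor \<alpha> E F) t"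
    using triangle by (elim alg_tensor_cases) (simp add: add_alg_tensor)
qed (auto elim!: alg_tensor_cases simp: add_alg_tensor smult_alg_tensor ts_eq_iff sum_scale algebra_simps)

lemma contractions_linear: "f \<in> contractions G complex_ring \<Longrightarrow> f \<in> linear_maps G complex_ring"
  by (simp add: contractions_def)

section \<open>The injective and projective norms on the algebraic tensor product\<close>

lemma cmod_product_le_cost:
  assumes f: "f \<in> contractions E complex_ring" and g: "g \<in> contractions F complex_ring"
  shows "pairs ps \<Longrightarrow> cmod (\<Sum>(v, w)\<leftarrow>ps. f v * g w) \<le> cost ps"
proof (induction ps)
  case (Cons p ps)
  obtain v w where p: "p = (v, w)" by (cases p)
  have "cmod (f v) \<le> nrm E v" "cmod (g w) \<le> nrm F w"
    using f g Cons.prems p by (auto simp: contractions_def)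
  then have "cmod (f v * g w) \<le> nrm E v * nrm F w"
    unfolding norm_mult by (intro mult_mono) (use Cons.prems p in auto)
  then show ?case
    using Cons p norm_triangle_ineq[of "f v * g w" "\<Sum>(v, w)\<leftarrow>ps. f v * g w"] by auto
qed simp

lemma inj_norm_eq:
  "inj_norm E F (ts ps) = (SUP (f, g)\<in>contractions E complex_ring \<times> contractions F complex_ring.
     cmod (\<Sum>(v, w)\<leftarrow>ps. f v * g w))"
proof -
  have "ts ps (\<lambda>v w. f v * g w) = (\<Sum>(v, w)\<leftarrow>ps. f v * g w)"
    if "f \<in> contractions E complex_ring" "g \<in> contractions F complex_ring" for f g
    using that by (intro ts_apply bilinear_form_product contractions_linear)
  then have "(\<lambda>(f, g). cmod (ts ps (\<lambda>v w. f v * g w))) ` (contractions E complex_ring \<times> contractions F complex_ring)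
    = (\<lambda>(f, g). cmod (\<Sum>(v, w)\<leftarrow>ps. f v * g w)) ` (contractions E complex_ring \<times> contractions F complex_ring)"
    by (intro image_cong) auto
  moreover have "{cmod (ts ps (\<lambda>v w. f v * g w)) | f g. f \<in> contractions E complex_ring \<and> g \<in> contractions F complex_ring}
    = (\<lambda>(f, g). cmod (ts ps (\<lambda>v w. f v * g w))) ` (contractions E complex_ring \<times> contractions F complex_ring)"
    by auto
  ultimately show ?thesis unfolding inj_norm_def by simp
qed

lemma zero_contraction: "(\<lambda>_. 0) \<in> contractions E complex_ring" "(\<lambda>_. 0) \<in> contractions F complex_ring"
  by (auto simp: contractions_def linear_maps_def)

lemma inj_norm_upper:
  assumes "pairs ps" "f \<in> contractions E complex_ring" "g \<in> contractions F complex_ring"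
  shows "cmod (\<Sum>(v, w)\<leftarrow>ps. f v * g w) \<le> inj_norm E F (ts ps)"
proof -
  have "bdd_above ((\<lambda>(f, g). cmod (\<Sum>(v, w)\<leftarrow>ps. f v * g w)) ` (contractions E complex_ring \<times> contractions F complex_ring))"
    using cmod_product_le_cost assms(1) by (intro bdd_aboveI[of _ "cost ps"]) auto
  from cSUP_upper2[OF this, of "(f, g)"] assms show ?thesis by (simp add: inj_norm_eq)
qed

lemma inj_norm_least:
  assumes "\<And>f g. f \<in> contractions E complex_ring \<Longrightarrow> g \<in> contractions F complex_ring \<Longrightarrow> cmod (\<Sum>(v, w)\<leftarrow>ps. f v * g w) \<le> C"
  shows "inj_norm E F (ts ps) \<le> C"
  unfolding inj_norm_eq using zero_contraction assms by (intro cSUP_least) auto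

lemma less_inj_normD:
  assumes "r < inj_norm E F (ts ps)"
  shows "\<exists>f\<in>contractions E complex_ring. \<exists>g\<in>contractions F complex_ring. r < cmod (\<Sum>(v, w)\<leftarrow>ps. f v * g w)"
  using inj_norm_least[of ps r] assms by (meson not_le)

lemma inj_norm_le_cost: "pairs ps \<Longrightarrow> inj_norm E F (ts ps) \<le> cost ps"
  by (intro inj_norm_least cmod_product_le_cost)

lemma cost_nonneg: "pairs ps \<Longrightarrow> 0 \<le> cost ps"
  by (induction ps) auto

lemma proj_norm_eq: "proj_norm E F t = (INF ps\<in>{ps. pairs ps \<and> t = ts ps}. cost ps)"
  unfolding proj_norm_def pairs_def cost_def by (rule arg_cong[of _ _ Inf]) auto

lemma proj_norm_lower: "pairs ps \<Longrightarrow> proj_norm E F (ts ps) \<le> cost ps"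
  unfolding proj_norm_eq by (rule cINF_lower) (auto intro!: bdd_belowI[of _ 0] cost_nonneg)

lemma proj_norm_greatest:
  assumes "pairs ps" "\<And>qs. pairs qs \<Longrightarrow> ts qs = ts ps \<Longrightarrow> C \<le> cost qs"
  shows "C \<le> proj_norm E F (ts ps)"
  unfolding proj_norm_eq using assms by (intro cINF_greatest) auto

lemma inj_norm_le_proj_norm: "pairs ps \<Longrightarrow> inj_norm E F (ts ps) \<le> proj_norm E F (ts ps)"
  using inj_norm_le_cost by (intro proj_norm_greatest) metis+

text \<open>The slice of a tensor: the identity of E tensored with g, applied to the tensor
  represented by the list.\<close>

definition combine :: "('b \<Rightarrow> complex) \<Rightarrow> ('a \<times> 'b) list \<Rightarrow> 'a" where
  "combine g ps = foldr (\<lambda>(v, w) u. g w \<odot>\<^bsub>E\<^esub> v \<oplus>\<^bsub>E\<^esub> u) ps \<zero>\<^bsub>E\<^esub>"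

lemma combine_simps [simp]:
  "combine g [] = \<zero>\<^bsub>E\<^esub>" "combine g ((v, w) # ps) = g w \<odot>\<^bsub>E\<^esub> v \<oplus>\<^bsub>E\<^esub> combine g ps"
  by (simp_all add: combine_def)

lemma combine_closed [simp]: "pairs ps \<Longrightarrow> combine g ps \<in> carrier E"
  by (induction ps) (auto simp: E.smult_simps)

lemma linear_map_zero: "f \<in> linear_maps E complex_ring \<Longrightarrow> f \<zero>\<^bsub>E\<^esub> = 0"
  unfolding linear_maps_def using E.smult_simps(7)[of 0] E.M.zero_closed by (metis (mono_tags, lifting) complex_ring_simps(6) mem_Collect_eq mult_zero_left)

lemma linear_map_combine:
  assumes f: "f \<in> linear_maps E complex_ring"
  shows "pairs ps \<Longrightarrow> f (combine g ps) = (\<Sum>(v, w)\<leftarrow>ps. f v * g w)"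
proof (induction ps)
  case (Cons p ps)
  then show ?case using f by (cases p) (auto simp: linear_maps_def E.smult_simps)
qed (simp add: linear_map_zero[OF f])

text \<open>In a representation \<open>\<Sum>\<^sub>i v\<^sub>i \<otimes> w\<^sub>i\<close> of minimal length no nontrivial combination of the \<open>v\<^sub>i\<close> vanishes,
  so a functional with \<open>g w\<^sub>1 \<noteq> 0\<close> gives \<open>\<Sum>\<^sub>i g w\<^sub>i v\<^sub>i \<noteq> 0\<close>.\<close>

lemma inj_norm_definite:
  assumes ps: "pairs ps" and nz: "ts ps \<noteq> ts []"
  shows "0 < inj_norm E F (ts ps)"
proof -
  define R where "R n \<longleftrightarrow> (\<exists>qs. pairs qs \<and> ts qs = ts ps \<and> length qs = n)" for n
  define n where "n = (LEAST n. R n)"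
  have "R (length ps)" using ps by (auto simp: R_def)
  then have "R n" unfolding n_def by (rule LeastI)
  then obtain qs where qs: "pairs qs" "ts qs = ts ps" "length qs = n" by (auto simp: R_def)
  have min: "n \<le> length rs" if "pairs rs" "ts rs = ts ps" for rs
    unfolding n_def using that by (intro Least_le) (auto simp: R_def)
  have "qs \<noteq> []" using qs(2) nz by auto
  then obtain v w rs where qs_eq: "qs = (v, w) # rs" by (metis list.exhaust surj_pair)
  have v: "v \<in> carrier E" and w: "w \<in> carrier F" and rs: "pairs rs" using qs(1) qs_eq by auto
  \<comment> \<open>Otherwise the first pair could be dropped from a shortest
    representation.\<close>
  have "w \<noteq> \<zero>\<^bsub>F\<^esub>"
  proof
    assume w0: "w = \<zero>\<^bsub>F\<^esub>"
    have "\<beta> v w = 0" if "\<beta> \<in> BF" for \<beta>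
      using bilinear_formD(4)[OF that v w, of 0] w by (simp add: F.smult_simps w0)
    then have "ts rs = ts ps" unfolding qs(2)[symmetric] qs_eq ts_eq_iff by simp
    then show False using min[OF rs] qs(3) qs_eq by simp
  qed
  obtain g where g: "g \<in> contractions F complex_ring" and gw: "g w = complex_of_real (nrm F w)"
    using F.Hahn_Banach[OF w] by blast
  have gw0: "g w \<noteq> 0" using gw \<open>w \<noteq> \<zero>\<^bsub>F\<^esub>\<close> w by (simp add: F.nrm_eq_0)
  let ?u = "combine g qs"
  have u: "?u \<in> carrier E" using qs(1) by simp
  have "?u \<noteq> \<zero>\<^bsub>E\<^esub>"
  proof
    assume u0: "?u = \<zero>\<^bsub>E\<^esub>"
    \<comment> \<open>The vanishing combination expresses v as the sum of \<open>d w'\<close> times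
      v' over the remaining pairs. Moving these coefficients to the second factor absorbs the pair
      (v, w) and shortens the list.\<close>
    define d where "d w' = - g w' / g w" for w'
    define rs' where "rs' = map (\<lambda>(v', w'). (v', w' \<oplus>\<^bsub>F\<^esub> d w' \<odot>\<^bsub>F\<^esub> w)) rs"
    have rs': "pairs rs'" using rs w unfolding rs'_def by (auto simp: pairs_def F.smult_simps)
    have "(\<Sum>(v, w)\<leftarrow>rs'. \<beta> v w) = (\<Sum>(v, w)\<leftarrow>qs. \<beta> v w)" if \<beta>: "\<beta> \<in> BF" for \<beta>
    proof -
      have \<beta>w: "(\<lambda>v. \<beta> v w) \<in> linear_maps E complex_ring" using \<beta> w by (simp add: bilinear_forms_def)
      have "(\<Sum>(v', w')\<leftarrow>qs. \<beta> v' w * g w') = 0"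
        using linear_map_combine[OF \<beta>w qs(1), of g] linear_map_zero[OF \<beta>w] u0 by simp
      then have "\<beta> v w * g w = - (\<Sum>(v', w')\<leftarrow>rs. \<beta> v' w * g w')"
        unfolding qs_eq by (simp add: eq_neg_iff_add_eq_0)
      then have 1: "\<beta> v w = - (\<Sum>(v', w')\<leftarrow>rs. \<beta> v' w * g w') / g w" using gw0 by (simp add: field_simps)
      have "(\<Sum>(v, w)\<leftarrow>rs'. \<beta> v w) = (\<Sum>(v', w')\<leftarrow>rs. \<beta> v' w') - (\<Sum>(v', w')\<leftarrow>rs. \<beta> v' w * g w') / g w"
        unfolding rs'_def using rs w \<beta>
        by (induction rs) (auto simp: bilinear_formD F.smult_simps d_def add_divide_distrib algebra_simps)
      then show ?thesis unfolding qs_eq using 1 by simp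
    qed
    then have "ts rs' = ts ps" unfolding qs(2)[symmetric] ts_eq_iff by blast
    then show False using min[OF rs'] qs(3) qs_eq by (simp add: rs'_def)
  qed
  obtain f where f: "f \<in> contractions E complex_ring" and fu: "f ?u = complex_of_real (nrm E ?u)"
    using E.Hahn_Banach[OF u] by blast
  have "(\<Sum>(v, w)\<leftarrow>qs. f v * g w) = complex_of_real (nrm E ?u)"
    using linear_map_combine[OF contractions_linear[OF f] qs(1), of g] fu by simp
  then have "nrm E ?u \<le> inj_norm E F (ts qs)"
    using inj_norm_upper[OF qs(1) f g] u by simp
  moreover have "nrm E ?u > 0" using \<open>?u \<noteq> \<zero>\<^bsub>E\<^esub>\<close> E.nrm_nonneg[OF u] E.nrm_eq_0[OF u] by (simp add: less_le)
  ultimately show ?thesis using qs(2) by simp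
qed

lemma proj_norm_nonneg: "pairs ps \<Longrightarrow> 0 \<le> proj_norm E F (ts ps)"
  using cost_nonneg by (intro proj_norm_greatest)

lemma inj_norm_nonneg: "pairs ps \<Longrightarrow> 0 \<le> inj_norm E F (ts ps)"
  using inj_norm_upper[OF _ zero_contraction] by (meson norm_ge_zero order_trans)

lemma normed_inj: "complex_normed_space (alg_tensor (inj_norm E F) E F)"
proof (rule complex_normed_space_alg_tensorI)
  fix ps assume ps: "pairs ps"
  show "0 \<le> inj_norm E F (ts ps)" by (rule inj_norm_nonneg[OF ps])
  show "ts ps = ts []" if "inj_norm E F (ts ps) = 0" using inj_norm_definite[OF ps] that by force
  fix c
  show "inj_norm E F (ts (scale c ps)) \<le> cmod c * inj_norm E F (ts ps)"
  proof (rule inj_norm_least)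
    fix f g assume f: "f \<in> contractions E complex_ring" and g: "g \<in> contractions F complex_ring"
    have "(\<Sum>(v, w)\<leftarrow>scale c ps. f v * g w) = c * (\<Sum>(v, w)\<leftarrow>ps. f v * g w)"
      using sum_scale[OF ps bilinear_form_product[OF contractions_linear[OF f] contractions_linear[OF g]]] .
    then show "cmod (\<Sum>(v, w)\<leftarrow>scale c ps. f v * g w) \<le> cmod c * inj_norm E F (ts ps)"
      using inj_norm_upper[OF ps f g] by (simp add: norm_mult mult_left_mono)
  qed
next
  fix ps qs assume ps: "pairs ps" and qs: "pairs qs"
  show "inj_norm E F (ts (ps @ qs)) \<le> inj_norm E F (ts ps) + inj_norm E F (ts qs)"
  proof (rule inj_norm_least)
    fix f g assume f: "f \<in> contractions E complex_ring" and g: "g \<in> contractions F complex_ring"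
    show "cmod (\<Sum>(v, w)\<leftarrow>ps @ qs. f v * g w) \<le> inj_norm E F (ts ps) + inj_norm E F (ts qs)"
      using inj_norm_upper[OF ps f g] inj_norm_upper[OF qs f g]
        norm_triangle_ineq[of "\<Sum>(v, w)\<leftarrow>ps. f v * g w" "\<Sum>(v, w)\<leftarrow>qs. f v * g w"] by simp
  qed
qed

lemma normed_proj: "complex_normed_space (alg_tensor (proj_norm E F) E F)"
proof (rule complex_normed_space_alg_tensorI)
  fix ps assume ps: "pairs ps"
  show "0 \<le> proj_norm E F (ts ps)" by (rule proj_norm_nonneg[OF ps])
  \<comment> \<open>The injective norm is positive on nonzero tensors and lies below the projective
    norm.\<close>
  show "ts ps = ts []" if "proj_norm E F (ts ps) = 0"
    using inj_norm_definite[OF ps] inj_norm_le_proj_norm[OF ps] that by force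
  fix c
  show "proj_norm E F (ts (scale c ps)) \<le> cmod c * proj_norm E F (ts ps)"
  proof (cases "c = 0")
    case True
    then show ?thesis using proj_norm_lower[of "scale c ps"] ps by (simp add: cost_scale)
  next
    case False
    have "proj_norm E F (ts (scale c ps)) / cmod c \<le> proj_norm E F (ts ps)"
    proof (rule proj_norm_greatest[OF ps])
      fix qs assume qs: "pairs qs" "ts qs = ts ps"
      have "ts (scale c qs) = ts (scale c ps)"
        using qs ps unfolding ts_eq_iff by (simp add: sum_scale)
      then have "proj_norm E F (ts (scale c ps)) \<le> cmod c * cost qs"
        using proj_norm_lower[of "scale c qs"] qs by (simp add: cost_scale)
      then show "proj_norm E F (ts (scale c ps)) / cmod c \<le> cost qs"
        using False by (simp add: field_simps)
    qed
    then show ?thesis using False by (simp add: field_simps)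
  qed
next
  fix ps qs assume ps: "pairs ps" and qs: "pairs qs"
  have *: "proj_norm E F (ts (ps @ qs)) \<le> cost ps' + cost qs'"
    if "pairs ps'" "ts ps' = ts ps" "pairs qs'" "ts qs' = ts qs" for ps' qs'
  proof -
    have "ts (ps' @ qs') = ts (ps @ qs)" using that unfolding ts_eq_iff by simp
    then show ?thesis using proj_norm_lower[of "ps' @ qs'"] that by simp
  qed
  have "proj_norm E F (ts (ps @ qs)) - cost ps' \<le> proj_norm E F (ts qs)" if "pairs ps'" "ts ps' = ts ps" for ps'
  proof (rule proj_norm_greatest[OF qs])
    fix qs' assume "pairs qs'" "ts qs' = ts qs"
    from *[OF that this] show "proj_norm E F (ts (ps @ qs)) - cost ps' \<le> cost qs'" by simp
  qed
  then have "proj_norm E F (ts (ps @ qs)) - proj_norm E F (ts qs) \<le> proj_norm E F (ts ps)"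
    by (intro proj_norm_greatest[OF ps]) (simp add: algebra_simps)
  then show "proj_norm E F (ts (ps @ qs)) \<le> proj_norm E F (ts ps) + proj_norm E F (ts qs)" by simp
qed

end

section \<open>Tensor norms dominated by the cost of a representation, and their completions\<close>

locale tensor_norm = normed_pair E F
  for E :: "'a normed_module" and F :: "'b normed_module" +
  fixes \<alpha> :: "('a, 'b) tensor \<Rightarrow> real"
  assumes normed: "complex_normed_space (alg_tensor \<alpha> E F)"
    and cross: "pairs ps \<Longrightarrow> \<alpha> (ts ps) \<le> cost ps"
begin

sublocale T: complex_normed_space "alg_tensor \<alpha> E F" by (rule normed)

sublocale C: complex_normed_space "completion (alg_tensor \<alpha> E F)"
  by (rule T.complex_normed_space_completion)

abbreviation (input) "\<T> \<equiv> alg_tensor \<alpha> E F"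
abbreviation (input) "\<C> \<equiv> completion (alg_tensor \<alpha> E F)"

definition elem :: "'a \<Rightarrow> 'b \<Rightarrow> ('a, 'b) ctensor" where
  "elem v w = to_completion \<T> (ts [(v, w)])"

lemma elem_closed: "v \<in> carrier E \<Longrightarrow> w \<in> carrier F \<Longrightarrow> elem v w \<in> carrier \<C>"
  unfolding elem_def by (intro T.to_completion_closed) simp

lemma ts_minus: "pairs ps \<Longrightarrow> pairs qs \<Longrightarrow> ts ps \<ominus>\<^bsub>\<T>\<^esub> ts qs = ts (ps @ scale (-1) qs)"
  by (simp add: T.minus_eq_smult smult_alg_tensor add_alg_tensor)

text \<open>The factors are changed one at a time: the difference is (v - v') \<otimes> w + v'
  \<otimes> (w - w').\<close>

lemma ts_single_minus:
  assumes "v \<in> carrier E" "v' \<in> carrier E" "w \<in> carrier F" "w' \<in> carrier F"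
  shows "\<alpha> (ts [(v, w)] \<ominus>\<^bsub>\<T>\<^esub> ts [(v', w')]) \<le> ndiff E v v' * nrm F w + nrm E v' * ndiff F w w'"
proof -
  have "pairs [(v, w)]" "pairs [(v', w')]" using assms by simp_all
  from ts_minus[OF this] have "ts [(v, w)] \<ominus>\<^bsub>\<T>\<^esub> ts [(v', w')] = ts [(v \<ominus>\<^bsub>E\<^esub> v', w), (v', w \<ominus>\<^bsub>F\<^esub> w')]"
    using assms by (auto simp: ts_eq_iff bilinear_formD E.minus_eq_smult F.minus_eq_smult E.smult_simps F.smult_simps)
  then show ?thesis
    using cross[of "[(v \<ominus>\<^bsub>E\<^esub> v', w), (v', w \<ominus>\<^bsub>F\<^esub> w')]"] assms by simp
qed

lemma nrm_elem_minus_elem: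
  assumes "v \<in> carrier E" "v' \<in> carrier E" "w \<in> carrier F" "w' \<in> carrier F"
  shows "ndiff \<C> (elem v w) (elem v' w') \<le> ndiff E v v' * nrm F w + nrm E v' * ndiff F w w'"
  using ts_single_minus[OF assms] assms
  unfolding elem_def by (subst T.to_completion_minus[symmetric]) (simp_all add: T.nrm_to_completion)

text \<open>No scalar coefficients occur: multiples of the first factor are already approximated by
  the dense sequence, and the index lists remain countable in number.\<close>

definition sum_elems :: "(nat \<Rightarrow> 'a) \<Rightarrow> (nat \<Rightarrow> 'b) \<Rightarrow> (nat \<times> nat) list \<Rightarrow> ('a, 'b) ctensor" where
  "sum_elems \<phi> \<psi> I = to_completion \<T> (ts (map (\<lambda>(i, j). (\<phi> i, \<psi> j)) I))"

lemma sum_elems_Nil: "sum_elems \<phi> \<psi> [] = \<zero>\<^bsub>\<C>\<^esub>"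
  unfolding sum_elems_def by (simp add: T.to_completion_eq T.zero_completion zero_alg_tensor)

context
  fixes \<phi> :: "nat \<Rightarrow> 'a" and \<psi> :: "nat \<Rightarrow> 'b"
  assumes \<phi>: "\<And>i. \<phi> i \<in> carrier E" and \<psi>: "\<And>j. \<psi> j \<in> carrier F"
begin

lemma pairs_map: "pairs (map (\<lambda>(i, j). (\<phi> i, \<psi> j)) I)"
  using \<phi> \<psi> by (auto simp: pairs_def)

lemma sum_elems_closed: "sum_elems \<phi> \<psi> I \<in> carrier \<C>"
  unfolding sum_elems_def by (intro T.to_completion_closed ts_in_carrier pairs_map)

lemma sum_elems_Cons: "sum_elems \<phi> \<psi> ((i, j) # I) = elem (\<phi> i) (\<psi> j) \<oplus>\<^bsub>\<C>\<^esub> sum_elems \<phi> \<psi> I"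
  unfolding sum_elems_def elem_def
  by (subst T.to_completion_add[symmetric]) (use \<phi> \<psi> pairs_map in \<open>simp_all add: add_alg_tensor\<close>)

text \<open>Collects a three-term combination in the completion into one list with weights c, 1 and
  -1; norms of such weighted lists are the quantities whose dependence on the base point is studied
  later.\<close>

lemma nrm_combination_sum_elems:
  "ndiff \<C> (c \<odot>\<^bsub>\<C>\<^esub> sum_elems \<phi> \<psi> I \<oplus>\<^bsub>\<C>\<^esub> sum_elems \<phi> \<psi> J) (sum_elems \<phi> \<psi> K) =
    \<alpha> (ts (map (\<lambda>(c, i, j). (c \<odot>\<^bsub>E\<^esub> \<phi> i, \<psi> j))
      (map (\<lambda>(i, j). (c, i, j)) I @ map (\<lambda>(i, j). (1, i, j)) J @ map (\<lambda>(i, j). (-1, i, j)) K)))"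
proof -
  let ?m = "map (\<lambda>(i, j). (\<phi> i, \<psi> j))"
  have "c \<odot>\<^bsub>\<C>\<^esub> sum_elems \<phi> \<psi> I \<oplus>\<^bsub>\<C>\<^esub> sum_elems \<phi> \<psi> J \<ominus>\<^bsub>\<C>\<^esub> sum_elems \<phi> \<psi> K =
      to_completion \<T> (c \<odot>\<^bsub>\<T>\<^esub> ts (?m I) \<oplus>\<^bsub>\<T>\<^esub> ts (?m J) \<ominus>\<^bsub>\<T>\<^esub> ts (?m K))"
    unfolding sum_elems_def using pairs_map
    by (simp add: T.to_completion_minus T.to_completion_add T.to_completion_smult T.smult_simps)
  also have "c \<odot>\<^bsub>\<T>\<^esub> ts (?m I) \<oplus>\<^bsub>\<T>\<^esub> ts (?m J) \<ominus>\<^bsub>\<T>\<^esub> ts (?m K) = ts (scale c (?m I) @ ?m J @ scale (-1) (?m K))"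
    using pairs_map by (simp add: smult_alg_tensor add_alg_tensor ts_minus)
  also have "scale c (?m I) @ ?m J @ scale (-1) (?m K) = map (\<lambda>(c, i, j). (c \<odot>\<^bsub>E\<^esub> \<phi> i, \<psi> j))
      (map (\<lambda>(i, j). (c, i, j)) I @ map (\<lambda>(i, j). (1, i, j)) J @ map (\<lambda>(i, j). (-1, i, j)) K)"
    using \<phi> by (auto simp: scale_def E.smult_simps)
  finally show ?thesis
    using pairs_map by (simp only:) (intro T.nrm_to_completion[unfolded nrm_alg_tensor] ts_in_carrier, auto simp: pairs_def \<phi> \<psi> E.smult_simps)
qed

context
  assumes \<phi>d: "norm_topology E closure_of range \<phi> = carrier E"
    and \<psi>d: "norm_topology F closure_of range \<psi> = carrier F"
begin

lemma ts_single_approx: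
  assumes v: "v \<in> carrier E" and w: "w \<in> carrier F" and e: "e > 0"
  shows "\<exists>i j. \<alpha> (ts [(v, w)] \<ominus>\<^bsub>\<T>\<^esub> ts [(\<phi> i, \<psi> j)]) < e"
proof -
  have r: "range \<phi> \<subseteq> carrier E" "range \<psi> \<subseteq> carrier F" using \<phi> \<psi> by auto
  have near: "\<exists>i. ndiff E (\<phi> i) v < d" "\<exists>j. ndiff F (\<psi> j) w < d" if "d > 0" for d
    using E.dense_iff[OF r(1)] \<phi>d v that F.dense_iff[OF r(2)] \<psi>d w by simp_all
  have w1: "nrm F w + 1 > 0" using w by (simp add: add_nonneg_pos)
  obtain i where i: "ndiff E (\<phi> i) v < e / 2 / (nrm F w + 1)"
    using near(1)[of "e / 2 / (nrm F w + 1)"] e w1 by auto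
  have i1: "nrm E (\<phi> i) + 1 > 0" using \<phi> by (simp add: add_nonneg_pos)
  \<comment> \<open>The index j comes after i because its tolerance depends on the norm of
    \<open>\<phi> i\<close>; the summands 1 in the denominators avoid division by 0.\<close>
  obtain j where j: "ndiff F (\<psi> j) w < e / 2 / (nrm E (\<phi> i) + 1)"
    using near(2)[of "e / 2 / (nrm E (\<phi> i) + 1)"] e i1 by auto
  have "ndiff E v (\<phi> i) * (nrm F w + 1) < e / 2"
    using i unfolding E.nrm_minus_commute[OF v \<phi>] pos_less_divide_eq[OF w1] .
  moreover have "ndiff E v (\<phi> i) * nrm F w \<le> ndiff E v (\<phi> i) * (nrm F w + 1)"
    using v \<phi> by (intro mult_left_mono) auto
  moreover have "(nrm E (\<phi> i) + 1) * ndiff F w (\<psi> j) < e / 2"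
    using j unfolding F.nrm_minus_commute[OF w \<psi>] pos_less_divide_eq[OF i1] by (simp only: mult.commute)
  moreover have "nrm E (\<phi> i) * ndiff F w (\<psi> j) \<le> (nrm E (\<phi> i) + 1) * ndiff F w (\<psi> j)"
    using w \<psi> by (intro mult_right_mono) auto
  ultimately have "\<alpha> (ts [(v, w)] \<ominus>\<^bsub>\<T>\<^esub> ts [(\<phi> i, \<psi> j)]) < e"
    using ts_single_minus[OF v \<phi> w \<psi>, of i j] by linarith
  then show ?thesis by blast
qed

lemma ts_approx:
  "pairs ps \<Longrightarrow> e > 0 \<Longrightarrow> \<exists>I. \<alpha> (ts ps \<ominus>\<^bsub>\<T>\<^esub> ts (map (\<lambda>(i, j). (\<phi> i, \<psi> j)) I)) < e"
proof (induction ps arbitrary: e)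
  case Nil
  have "\<alpha> (ts [] \<ominus>\<^bsub>\<T>\<^esub> ts []) = 0"
    using T.minus_self[of "ts []"] T.nrm_zero by simp
  then show ?case using Nil by (intro exI[of _ "[]"]) simp
next
  case (Cons p ps)
  obtain v w where p: "p = (v, w)" by (cases p)
  have vw: "v \<in> carrier E" "w \<in> carrier F" and ps: "pairs ps" using Cons.prems p by auto
  obtain i j where ij: "\<alpha> (ts [(v, w)] \<ominus>\<^bsub>\<T>\<^esub> ts [(\<phi> i, \<psi> j)]) < e/2"
    using ts_single_approx[OF vw, of "e/2"] Cons.prems by auto
  obtain I where I: "\<alpha> (ts ps \<ominus>\<^bsub>\<T>\<^esub> ts (map (\<lambda>(i, j). (\<phi> i, \<psi> j)) I)) < e/2"
    using Cons.IH[OF ps, of "e/2"] Cons.prems by auto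
  have *: "ts [q] \<oplus>\<^bsub>\<T>\<^esub> ts qs = ts (q # qs)" for q qs by (simp add: add_alg_tensor)
  have "\<alpha> (ts (p # ps) \<ominus>\<^bsub>\<T>\<^esub> ts ((\<phi> i, \<psi> j) # map (\<lambda>(i, j). (\<phi> i, \<psi> j)) I)) < e"
    using T.nrm_add_minus_add[of "ts [(v, w)]" "ts ps" "ts [(\<phi> i, \<psi> j)]" "ts (map (\<lambda>(i, j). (\<phi> i, \<psi> j)) I)"]
      ij I vw ps \<phi> \<psi> pairs_map p by (simp add: *)
  then show ?case by (intro exI[of _ "(i, j) # I"]) simp
qed

lemma sum_elems_dense: "norm_topology \<C> closure_of range (\<lambda>n. sum_elems \<phi> \<psi> (from_nat n)) = carrier \<C>"
proof (subst C.dense_iff)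
  show "range (\<lambda>n. sum_elems \<phi> \<psi> (from_nat n)) \<subseteq> carrier \<C>" using sum_elems_closed by blast
  show "\<forall>A\<in>carrier \<C>. \<forall>e>0. \<exists>a\<in>range (\<lambda>n. sum_elems \<phi> \<psi> (from_nat n)). ndiff \<C> a A < e"
  proof (intro ballI allI impI)
    fix A and e :: real assume A: "A \<in> carrier \<C>" and e: "e > 0"
    obtain a where a: "a \<in> carrier \<T>" "ndiff \<C> A (to_completion \<T> a) < e/2"
      using T.to_completion_dense[OF A, of "e/2"] e by auto
    obtain ps where ps: "pairs ps" "a = ts ps" using a(1) by (rule alg_tensor_cases)
    obtain I where I: "\<alpha> (ts ps \<ominus>\<^bsub>\<T>\<^esub> ts (map (\<lambda>(i, j). (\<phi> i, \<psi> j)) I)) < e/2"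
      using ts_approx[OF ps(1), of "e/2"] e by auto
    have a\<C>: "to_completion \<T> a \<in> carrier \<C>" using a by (intro T.to_completion_closed)
    have "ndiff \<C> (to_completion \<T> a) (sum_elems \<phi> \<psi> I) < e/2"
      using I a ps pairs_map unfolding sum_elems_def
      by (subst T.to_completion_minus[symmetric]) (simp_all add: T.nrm_to_completion)
    then have "ndiff \<C> A (sum_elems \<phi> \<psi> I) < e"
      using C.nrm_minus_triangle[OF A a\<C> sum_elems_closed, of I] a(2) by linarith
    then have "ndiff \<C> (sum_elems \<phi> \<psi> (from_nat (to_nat I))) A < e"
      using C.nrm_minus_commute[OF A sum_elems_closed, of I] by simp
    then show "\<exists>a\<in>range (\<lambda>n. sum_elems \<phi> \<psi> (from_nat n)). ndiff \<C> a A < e" by blast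
  qed
qed

end

end

end

context normed_pair
begin

lemma tensor_norm_inj: "tensor_norm E F (inj_norm E F)"
  by (intro tensor_norm.intro tensor_norm_axioms.intro normed_pair_axioms normed_inj inj_norm_le_cost)

lemma tensor_norm_proj: "tensor_norm E F (proj_norm E F)"
  by (intro tensor_norm.intro tensor_norm_axioms.intro normed_pair_axioms normed_proj proj_norm_lower)

end

section \<open>Borel fields generated by dense sections\<close>

text \<open>F is the pointwise infimum of the countable family G. The two hypotheses are phrased the
  way the triangle inequality delivers them.\<close>

lemma borel_measurable_of_approx_inf:
  fixes F :: "'a \<Rightarrow> real" and G :: "'i::countable \<Rightarrow> 'a \<Rightarrow> real"
  assumes G: "\<And>i. G i \<in> borel_measurable M"
    and le: "\<And>i x. x \<in> space M \<Longrightarrow> F x \<le> G i x"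
    and approx: "\<And>x e. x \<in> space M \<Longrightarrow> e > 0 \<Longrightarrow> \<exists>i. G i x < F x + e"
  shows "F \<in> borel_measurable M"
proof (rule borel_measurableI_less)
  fix y
  have "{x \<in> space M. F x < y} = (\<Union>i. {x \<in> space M. G i x < y})"
  proof (intro equalityI subsetI)
    fix x assume x: "x \<in> {x \<in> space M. F x < y}"
    then obtain i where "G i x < F x + (y - F x)" using approx[of x "y - F x"] by auto
    then show "x \<in> (\<Union>i. {x \<in> space M. G i x < y})" using x by auto
  next
    fix x assume "x \<in> (\<Union>i. {x \<in> space M. G i x < y})"
    then obtain i where "x \<in> space M" "G i x < y" by auto
    then show "x \<in> {x \<in> space M. F x < y}" using le[of x i] by auto
  qed
  also have "\<dots> \<in> sets M" using G by measurable
  finally show "{x \<in> space M. F x < y} \<in> sets M" .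
qed

section \<open>The operations of a Borel field composed with measurable maps\<close>

lemma measurable_fibre_product:
  assumes "f \<in> N \<rightarrow>\<^sub>M A" "g \<in> N \<rightarrow>\<^sub>M B" "\<And>y. y \<in> space N \<Longrightarrow> fst (f y) = fst (g y)"
  shows "(\<lambda>y. (f y, g y)) \<in> N \<rightarrow>\<^sub>M fibre_product A B"
  unfolding fibre_product_def using assms by (intro measurable_restrict_space2) auto

context
  fixes X :: "'x measure" and V :: "'x \<Rightarrow> 'a normed_module" and M :: "('x \<times> 'a) measure"
  assumes field: "borel_banach_field X V M"
begin

lemma field_space: "space M = (SIGMA x:space X. carrier (V x))"
  using field by (simp add: borel_banach_field_def)

lemma field_normed: "x \<in> space X \<Longrightarrow> complex_normed_space (V x)"
  using field by (simp add: borel_banach_field_def complex_banach_space_def)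

lemma field_fst: "fst \<in> M \<rightarrow>\<^sub>M X"
  using field by (simp add: borel_banach_field_def)

lemma field_mem: "f \<in> N \<rightarrow>\<^sub>M M \<Longrightarrow> y \<in> space N \<Longrightarrow> fst (f y) \<in> space X \<and> snd (f y) \<in> carrier (V (fst (f y)))"
  using measurable_space[of f N M y] by (auto simp: field_space)

lemma field_nrm: "f \<in> N \<rightarrow>\<^sub>M M \<Longrightarrow> (\<lambda>y. nrm (V (fst (f y))) (snd (f y))) \<in> borel_measurable N"
  using measurable_compose[of f N M "\<lambda>(x, v). nrm (V x) v" borel] field
  by (simp add: borel_banach_field_def split_beta)

lemma field_add:
  assumes f: "f \<in> N \<rightarrow>\<^sub>M M" and g: "g \<in> N \<rightarrow>\<^sub>M M" and eq: "\<And>y. y \<in> space N \<Longrightarrow> fst (f y) = fst (g y)"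
  shows "(\<lambda>y. (fst (f y), snd (f y) \<oplus>\<^bsub>V (fst (f y))\<^esub> snd (g y))) \<in> N \<rightarrow>\<^sub>M M"
proof -
  have "(\<lambda>((x, v), (y, w)). (x, v \<oplus>\<^bsub>V x\<^esub> w)) \<in> fibre_product M M \<rightarrow>\<^sub>M M"
    using field by (simp add: borel_banach_field_def)
  from measurable_compose[OF measurable_fibre_product[OF f g eq] this] show ?thesis
    by (simp add: split_beta)
qed

lemma field_smult:
  assumes f: "f \<in> N \<rightarrow>\<^sub>M M" and c: "c \<in> borel_measurable N"
  shows "(\<lambda>y. (fst (f y), c y \<odot>\<^bsub>V (fst (f y))\<^esub> snd (f y))) \<in> N \<rightarrow>\<^sub>M M"
proof -
  have "(\<lambda>(c, (x, v)). (x, c \<odot>\<^bsub>V x\<^esub> v)) \<in> borel \<Otimes>\<^sub>M M \<rightarrow>\<^sub>M M"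
    using field by (simp add: borel_banach_field_def)
  from measurable_compose[OF measurable_Pair[OF c f] this] show ?thesis
    by (simp add: split_beta)
qed

lemma field_nrm_minus:
  assumes f: "f \<in> N \<rightarrow>\<^sub>M M" and g: "g \<in> N \<rightarrow>\<^sub>M M" and eq: "\<And>y. y \<in> space N \<Longrightarrow> fst (f y) = fst (g y)"
  shows "(\<lambda>y. ndiff (V (fst (f y))) (snd (f y)) (snd (g y))) \<in> borel_measurable N"
proof -
  have "(\<lambda>y. nrm (V (fst (f y))) (snd (f y) \<oplus>\<^bsub>V (fst (f y))\<^esub> (-1) \<odot>\<^bsub>V (fst (g y))\<^esub> snd (g y))) \<in> borel_measurable N"
    using field_nrm[OF field_add[OF f field_smult[OF g, of "\<lambda>_. -1"]]] eq by simp
  then show ?thesis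
  proof (rule measurable_cong[THEN iffD1, rotated])
    fix y assume y: "y \<in> space N"
    interpret complex_normed_space "V (fst (f y))" using field_normed field_mem[OF f y] by blast
    show "nrm (V (fst (f y))) (snd (f y) \<oplus>\<^bsub>V (fst (f y))\<^esub> (-1) \<odot>\<^bsub>V (fst (g y))\<^esub> snd (g y)) =
      ndiff (V (fst (f y))) (snd (f y)) (snd (g y))"
      using minus_eq_smult[of "snd (f y)" "snd (g y)"] field_mem[OF f y] field_mem[OF g y]
      unfolding eq[OF y, symmetric] by simp
  qed
qed

lemma field_section_compose:
  assumes \<phi>: "borel_section X M \<phi>" and f: "f \<in> N \<rightarrow>\<^sub>M X"
  shows "(\<lambda>y. (f y, \<phi> (f y))) \<in> N \<rightarrow>\<^sub>M M"
  using measurable_compose[OF f \<phi>[unfolded borel_section_def]] .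

lemma field_section_closed: "borel_section X M \<phi> \<Longrightarrow> x \<in> space X \<Longrightarrow> \<phi> x \<in> carrier (V x)"
  using field_mem[of "\<lambda>x. (x, \<phi> x)" X x] by (simp add: borel_section_def)

lemma field_combination:
  assumes "borel_section X M \<phi>" "borel_section X M \<psi>" "borel_section X M \<theta>"
  shows "(\<lambda>x. ndiff (V x) (c \<odot>\<^bsub>V x\<^esub> \<phi> x \<oplus>\<^bsub>V x\<^esub> \<psi> x) (\<theta> x)) \<in> borel_measurable X"
proof -
  note s = assms[unfolded borel_section_def]
  have "(\<lambda>x. (x, c \<odot>\<^bsub>V x\<^esub> \<phi> x)) \<in> X \<rightarrow>\<^sub>M M"
    using field_smult[OF s(1), of "\<lambda>_. c"] by simp
  from field_add[OF this s(2)] have "(\<lambda>x. (x, c \<odot>\<^bsub>V x\<^esub> \<phi> x \<oplus>\<^bsub>V x\<^esub> \<psi> x)) \<in> X \<rightarrow>\<^sub>M M"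
    by simp
  from field_nrm_minus[OF this s(3)] show ?thesis by simp
qed

end

text \<open>Only norms on the base are assumed Borel; the structure on the total space is built from
  them. The three-term norms contain the distances (c = 0, first two indices equal), the norms (c =
  1, all indices equal) and the distances to scalar multiples (c - 1 in place of c, first two
  indices equal).\<close>

locale dense_sections =
  fixes X :: "'x measure" and V :: "'x \<Rightarrow> 'a normed_module" and \<xi> :: "nat \<Rightarrow> 'x \<Rightarrow> 'a"
  assumes X: "standard_borel X"
    and banach: "x \<in> space X \<Longrightarrow> complex_banach_space (V x)"
    and closed: "x \<in> space X \<Longrightarrow> \<xi> n x \<in> carrier (V x)"
    and dense: "x \<in> space X \<Longrightarrow> norm_topology (V x) closure_of range (\<lambda>n. \<xi> n x) = carrier (V x)"
    and combination: "(\<lambda>x. ndiff (V x) (c \<odot>\<^bsub>V x\<^esub> \<xi> i x \<oplus>\<^bsub>V x\<^esub> \<xi> j x) (\<xi> k x)) \<in> borel_measurable X"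
begin

lemma normed: "x \<in> space X \<Longrightarrow> complex_normed_space (V x)"
  using banach by (simp add: complex_banach_space_def)

definition total :: "('x \<times> 'a) set" where
  "total = (SIGMA x:space X. carrier (V x))"

definition embX :: "'x \<Rightarrow> nat \<Rightarrow> real" where
  "embX = (SOME e. e \<in> borel_measurable X \<and> inj_on e (space X) \<and> (\<forall>A\<in>sets X. e ` A \<in> sets borel))"

lemma embX: "embX \<in> borel_measurable X" "inj_on embX (space X)" "\<And>A. A \<in> sets X \<Longrightarrow> embX ` A \<in> sets borel"
  using someI_ex[OF standard_borel_embedding[OF X]] unfolding embX_def by blast+

text \<open>Base point and distances are interleaved so that the code is a single real sequence, the
  form in which the embedding results are stated.\<close>

definition code :: "'x \<times> 'a \<Rightarrow> nat \<Rightarrow> real" where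
  "code p n = (if even n then embX (fst p) (n div 2)
     else ndiff (V (fst p)) (snd p) (\<xi> (n div 2) (fst p)))"

lemma code_even: "code p (2 * n) = embX (fst p) n"
  and code_odd: "code p (2 * n + 1) = ndiff (V (fst p)) (snd p) (\<xi> n (fst p))"
  by (simp_all add: code_def)

lemma near: "x \<in> space X \<Longrightarrow> v \<in> carrier (V x) \<Longrightarrow> e > 0 \<Longrightarrow> \<exists>n. ndiff (V x) v (\<xi> n x) < e"
proof -
  assume x: "x \<in> space X" and v: "v \<in> carrier (V x)" and e: "e > 0"
  interpret complex_normed_space "V x" by (rule normed[OF x])
  have r: "range (\<lambda>n. \<xi> n x) \<subseteq> carrier (V x)" using closed[OF x] by auto
  have "\<exists>n. ndiff (V x) (\<xi> n x) v < e"
    using dense_iff[OF r] dense[OF x] v e by simp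
  then show ?thesis using nrm_minus_commute[OF v closed[OF x]] by simp
qed

lemma inj_code: "inj_on code total"
proof (rule inj_onI)
  fix p q assume p: "p \<in> total" and q: "q \<in> total" and eq: "code p = code q"
  have xp: "fst p \<in> space X" "snd p \<in> carrier (V (fst p))" and xq: "fst q \<in> space X" "snd q \<in> carrier (V (fst q))"
    using p q by (auto simp: total_def)
  have "embX (fst p) = embX (fst q)"
    using code_even[of p] code_even[of q] eq by (intro ext) simp
  then have x: "fst q = fst p" using embX(2) xp xq by (auto dest: inj_onD)
  interpret complex_normed_space "V (fst p)" by (rule normed[OF xp(1)])
  have nn: "ndiff (V (fst p)) (snd p) (\<xi> n (fst p)) = ndiff (V (fst p)) (snd q) (\<xi> n (fst p))" for n
    using code_odd[of p n] code_odd[of q n] eq x by simp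
  have xq': "snd q \<in> carrier (V (fst p))" using xq x by simp
  have "ndiff (V (fst p)) (snd p) (snd q) \<le> e" if e: "e > 0" for e
  proof -
    obtain n where n: "ndiff (V (fst p)) (snd p) (\<xi> n (fst p)) < e / 2"
      using near[OF xp, of "e / 2"] e by auto
    show ?thesis
      using nrm_minus_triangle[OF xp(2) closed[OF xp(1)] xq', of n] nn[of n] n
        nrm_minus_commute[OF closed[OF xp(1)] xq', of n] by simp
  qed
  then have "ndiff (V (fst p)) (snd p) (snd q) \<le> 0" by (rule field_le_epsilon[of _ 0, simplified])
  then have "ndiff (V (fst p)) (snd p) (snd q) = 0"
    using nrm_nonneg[OF minus_closed'[OF xp(2) xq']] by linarith
  then have "snd p = snd q" using xp(2) xq' by (simp add: nrm_eq_0 minus_eq_zero_iff)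
  then show "p = q" using x by (simp add: prod_eq_iff)
qed

lemma section_diff: "(\<lambda>x. ndiff (V x) (\<xi> i x) (\<xi> j x)) \<in> borel_measurable X"
proof (rule measurable_cong[THEN iffD1, OF _ combination[of 0 i i j]])
  fix x assume x: "x \<in> space X"
  interpret complex_normed_space "V x" by (rule normed[OF x])
  show "ndiff (V x) (0 \<odot>\<^bsub>V x\<^esub> \<xi> i x \<oplus>\<^bsub>V x\<^esub> \<xi> i x) (\<xi> j x) = ndiff (V x) (\<xi> i x) (\<xi> j x)"
    using closed[OF x] by (simp add: smult_simps)
qed

lemma section_nrm: "(\<lambda>x. nrm (V x) (\<xi> i x)) \<in> borel_measurable X"
proof (rule measurable_cong[THEN iffD1, OF _ combination[of 1 i i i]])
  fix x assume x: "x \<in> space X"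
  interpret complex_normed_space "V x" by (rule normed[OF x])
  show "ndiff (V x) (1 \<odot>\<^bsub>V x\<^esub> \<xi> i x \<oplus>\<^bsub>V x\<^esub> \<xi> i x) (\<xi> i x) = nrm (V x) (\<xi> i x)"
    using closed[OF x] by (simp add: smult_simps add_minus_cancel)
qed

lemma section_smult_diff: "(\<lambda>x. ndiff (V x) (c \<odot>\<^bsub>V x\<^esub> \<xi> i x) (\<xi> j x)) \<in> borel_measurable X"
proof (rule measurable_cong[THEN iffD1, OF _ combination[of "c - 1" i i j]])
  fix x assume x: "x \<in> space X"
  interpret complex_normed_space "V x" by (rule normed[OF x])
  have "(c - 1) \<odot>\<^bsub>V x\<^esub> \<xi> i x \<oplus>\<^bsub>V x\<^esub> \<xi> i x = (c - 1) \<odot>\<^bsub>V x\<^esub> \<xi> i x \<oplus>\<^bsub>V x\<^esub> 1 \<odot>\<^bsub>V x\<^esub> \<xi> i x"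
    using closed[OF x] by (simp add: smult_simps)
  also have "\<dots> = (c - 1 + 1) \<odot>\<^bsub>V x\<^esub> \<xi> i x" using closed[OF x] by (simp only: smult_simps)
  finally show "ndiff (V x) ((c - 1) \<odot>\<^bsub>V x\<^esub> \<xi> i x \<oplus>\<^bsub>V x\<^esub> \<xi> i x) (\<xi> j x) = ndiff (V x) (c \<odot>\<^bsub>V x\<^esub> \<xi> i x) (\<xi> j x)"
    by simp
qed

text \<open>The distances between two sections depend on the base point, so they are first rewritten
  as Borel functions \<open>D n m\<close> of its code. The conditions of
  \<open>distance_sequence_iff\<close> then become countably many Borel conditions on the sequence
  alone, together with membership of its even part in the Borel range of
  \<open>embX\<close>.\<close>

lemma code_image: "code ` total \<in> sets borel"
proof -
  have "\<exists>k\<in>borel_measurable borel. \<forall>x\<in>space X. k (embX x) = ndiff (V x) (\<xi> n x) (\<xi> m x)" for n m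
    by (rule measurable_factor_embedding[OF embX(2) _ section_diff]) (rule embX(3))
  then have "\<forall>n m. \<exists>k. k \<in> borel_measurable borel \<and> (\<forall>x\<in>space X. k (embX x) = ndiff (V x) (\<xi> n x) (\<xi> m x))"
    by (meson bexE)
  then obtain D where D': "\<forall>n m. D n m \<in> borel_measurable borel \<and> (\<forall>x\<in>space X. D n m (embX x) = ndiff (V x) (\<xi> n x) (\<xi> m x))"
    unfolding choice_iff by (elim exE)
  then have D: "D n m \<in> borel_measurable borel" and D_eq: "x \<in> space X \<Longrightarrow> D n m (embX x) = ndiff (V x) (\<xi> n x) (\<xi> m x)" for n m x
    by simp_all
  define r :: "(nat \<Rightarrow> real) \<Rightarrow> nat \<Rightarrow> real" where "r a n = a (2 * n)" for a n
  define K where "K = {a. r a \<in> embX ` space X \<and>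
    (\<forall>n m. \<bar>a (2 * n + 1) - a (2 * m + 1)\<bar> \<le> D n m (r a) \<and> D n m (r a) \<le> a (2 * n + 1) + a (2 * m + 1)) \<and>
    (\<forall>k. \<exists>n. a (2 * n + 1) < 1 / real (Suc k))}"
  have "code ` total = K"
  proof (rule Set.set_eqI)
    fix a
    have "a \<in> code ` total \<longleftrightarrow> (\<exists>x\<in>space X. r a = embX x \<and> (\<exists>v\<in>carrier (V x). \<forall>n. a (2 * n + 1) = ndist (V x) v (\<xi> n x)))"
    proof
      assume "a \<in> code ` total"
      then obtain x v where x: "x \<in> space X" and v: "v \<in> carrier (V x)" and a: "a = code (x, v)"
        unfolding total_def by auto
      have "r a = embX x" unfolding r_def a using code_even[of "(x, v)"] by (intro ext) simp
      moreover have "a (2 * n + 1) = ndist (V x) v (\<xi> n x)" for n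
        unfolding a code_odd using v closed[OF x] by (simp add: ndist_def)
      ultimately show "\<exists>x\<in>space X. r a = embX x \<and> (\<exists>v\<in>carrier (V x). \<forall>n. a (2 * n + 1) = ndist (V x) v (\<xi> n x))"
        using x v by blast
    next
      assume "\<exists>x\<in>space X. r a = embX x \<and> (\<exists>v\<in>carrier (V x). \<forall>n. a (2 * n + 1) = ndist (V x) v (\<xi> n x))"
      then obtain x v where x: "x \<in> space X" "r a = embX x" and v: "v \<in> carrier (V x)"
        and n: "\<And>n. a (2 * n + 1) = ndist (V x) v (\<xi> n x)" by auto
      have "a k = code (x, v) k" for k
      proof (cases "even k")
        case True
        then obtain n where k: "k = 2 * n" by (rule evenE)
        have "r a n = embX x n" using x(2) by simp
        then show ?thesis unfolding k code_even by (simp add: r_def)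
      next
        case False
        then obtain n where k: "k = 2 * n + 1" by (rule oddE)
        show ?thesis unfolding k code_odd n using v closed[OF x(1)] by (simp add: ndist_def)
      qed
      then have "a = code (x, v)" by (rule ext)
      then show "a \<in> code ` total" using x v by (auto simp: total_def)
    qed
    also have "\<dots> \<longleftrightarrow> (\<exists>x\<in>space X. r a = embX x \<and>
      ((\<forall>n m. \<bar>a (2 * n + 1) - a (2 * m + 1)\<bar> \<le> ndist (V x) (\<xi> n x) (\<xi> m x) \<and>
         ndist (V x) (\<xi> n x) (\<xi> m x) \<le> a (2 * n + 1) + a (2 * m + 1)) \<and>
       (\<forall>k. \<exists>n. a (2 * n + 1) < 1 / real (Suc k))))"
    proof (intro bex_cong conj_cong refl)
      fix x assume x: "x \<in> space X"
      interpret complex_normed_space "V x" by (rule normed[OF x])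
      show "(\<exists>v\<in>carrier (V x). \<forall>n. a (2 * n + 1) = ndist (V x) v (\<xi> n x)) \<longleftrightarrow>
        ((\<forall>n m. \<bar>a (2 * n + 1) - a (2 * m + 1)\<bar> \<le> ndist (V x) (\<xi> n x) (\<xi> m x) \<and>
         ndist (V x) (\<xi> n x) (\<xi> m x) \<le> a (2 * n + 1) + a (2 * m + 1)) \<and>
       (\<forall>k. \<exists>n. a (2 * n + 1) < 1 / real (Suc k)))"
        by (rule Met.distance_sequence_iff)
          (use banach[OF x] dense[OF x] closed[OF x] in \<open>auto simp: complex_banach_space_def\<close>)
    qed
    also have "\<dots> \<longleftrightarrow> a \<in> K"
      unfolding K_def by (auto simp: D_eq ndist_def closed)
    finally show "a \<in> code ` total \<longleftrightarrow> a \<in> K" .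
  qed
  also have "K \<in> sets borel"
  proof -
    have r: "r \<in> borel_measurable borel"
      unfolding r_def by (intro measurable_to_fun_borel measurable_product_coordinates)
    define u :: "nat \<Rightarrow> (nat \<Rightarrow> real) \<Rightarrow> real" where "u n a = a (2 * n + 1)" for n a
    have u: "u n \<in> borel_measurable borel" for n
      unfolding u_def by (rule measurable_product_coordinates)
    have Dr: "(\<lambda>a. D n m (r a)) \<in> borel_measurable borel" for n m
      by (rule measurable_compose[OF r D])
    have "r -` (embX ` space X) \<in> sets borel"
      using measurable_sets[OF r embX(3)[OF sets.top]] by simp
    moreover have "{a. \<bar>u n a - u m a\<bar> \<le> D n m (r a)} \<in> sets borel" for n m
      using borel_measurable_le[OF borel_measurable_abs[OF borel_measurable_diff[OF u u]] Dr, of n m] by simp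
    moreover have "{a. D n m (r a) \<le> u n a + u m a} \<in> sets borel" for n m
      using borel_measurable_le[OF Dr borel_measurable_add[OF u u]] by simp
    moreover have "{a. u n a < c} \<in> sets borel" for n c
      using borel_measurable_less[OF u borel_measurable_const, of n c] by simp
    ultimately have "r -` (embX ` space X) \<inter> (\<Inter>n m. {a. \<bar>u n a - u m a\<bar> \<le> D n m (r a)} \<inter> {a. D n m (r a) \<le> u n a + u m a}) \<inter>
      (\<Inter>k. \<Union>n. {a. u n a < 1 / real (Suc k)}) \<in> sets borel"
      by (intro sets.Int sets.countable_INT'' sets.countable_UN) auto
    moreover have "K = r -` (embX ` space X) \<inter> (\<Inter>n m. {a. \<bar>u n a - u m a\<bar> \<le> D n m (r a)} \<inter> {a. D n m (r a) \<le> u n a + u m a}) \<inter>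
      (\<Inter>k. \<Union>n. {a. u n a < 1 / real (Suc k)})"
      unfolding K_def u_def by blast
    ultimately show ?thesis by simp
  qed
  finally show ?thesis .
qed

section \<open>The structure generated by the distances to the sections\<close>

definition M0 :: "('x \<times> 'a) measure" where
  "M0 = vimage_algebra total code borel"

lemma space_M0: "space M0 = total"
  by (simp add: M0_def)

lemma standard_borel_M0: "standard_borel M0"
  unfolding M0_def using inj_code code_image by (rule standard_borel_vimage)

lemma code_M0: "code \<in> borel_measurable M0"
  unfolding M0_def by (rule measurable_vimage_algebra1) simp

lemma M0_mem: "p \<in> space M0 \<Longrightarrow> fst p \<in> space X \<and> snd p \<in> carrier (V (fst p))"
  by (auto simp: space_M0 total_def)

lemma fst_M0: "fst \<in> M0 \<rightarrow>\<^sub>M X"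
proof (rule measurableI)
  fix A assume A: "A \<in> sets X"
  \<comment> \<open>The even coordinates carry the base point, and a measurable set of base points
    has a Borel image under \<open>embX\<close>.\<close>
  have "(\<lambda>p. \<lambda>n. code p (2 * n)) \<in> borel_measurable M0"
    by (intro measurable_to_fun_borel measurable_compose[OF code_M0 measurable_product_coordinates])
  then have "(\<lambda>p. embX (fst p)) \<in> borel_measurable M0"
    by (simp add: code_even)
  from measurable_sets[OF this embX(3)[OF A]]
  have "(\<lambda>p. embX (fst p)) -` (embX ` A) \<inter> space M0 \<in> sets M0" .
  moreover have "(\<lambda>p. embX (fst p)) -` (embX ` A) \<inter> space M0 = fst -` A \<inter> space M0"
    using inj_on_image_mem_iff[OF embX(2) _ sets.sets_into_space[OF A]] M0_mem by auto
  ultimately show "fst -` A \<inter> space M0 \<in> sets M0" by simp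
qed (use M0_mem in blast)

lemma dist_M0: "(\<lambda>p. ndiff (V (fst p)) (snd p) (\<xi> n (fst p))) \<in> borel_measurable M0"
  using measurable_compose[OF code_M0 measurable_product_coordinates[of "2 * n + 1"]] unfolding code_odd .

lemma measurable_codeI:
  assumes "(\<lambda>y. fst (h y)) \<in> N \<rightarrow>\<^sub>M X"
    and "\<And>n. (\<lambda>y. ndiff (V (fst (h y))) (snd (h y)) (\<xi> n (fst (h y)))) \<in> borel_measurable N"
  shows "(\<lambda>y. code (h y)) \<in> borel_measurable N"
proof (rule measurable_to_fun_borel)
  fix k
  show "(\<lambda>y. code (h y) k) \<in> borel_measurable N"
  proof (cases "even k")
    case True
    then obtain n where k: "k = 2 * n" by (rule evenE)
    show ?thesis unfolding k code_even
      by (rule measurable_compose[OF measurable_compose[OF assms(1) embX(1)] measurable_product_coordinates])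
  next
    case False
    then obtain n where k: "k = 2 * n + 1" by (rule oddE)
    show ?thesis unfolding k code_odd by (rule assms(2))
  qed
qed

lemma measurable_M0I:
  assumes "h \<in> space N \<rightarrow> total" "(\<lambda>y. fst (h y)) \<in> N \<rightarrow>\<^sub>M X"
    and "\<And>n. (\<lambda>y. ndiff (V (fst (h y))) (snd (h y)) (\<xi> n (fst (h y)))) \<in> borel_measurable N"
  shows "h \<in> N \<rightarrow>\<^sub>M M0"
  unfolding M0_def by (rule measurable_vimage_algebra2[OF assms(1) measurable_codeI[OF assms(2,3)]])

lemma section_M0: "borel_section X M0 (\<xi> n)"
  unfolding borel_section_def
  by (rule measurable_M0I) (use section_diff closed in \<open>auto simp: total_def\<close>)

lemma nrm_M0: "(\<lambda>(x, v). nrm (V x) v) \<in> borel_measurable M0"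
proof (rule borel_measurable_of_approx_inf)
  let ?G = "\<lambda>i p. ndiff (V (fst p)) (snd p) (\<xi> i (fst p)) + nrm (V (fst p)) (\<xi> i (fst p))"
  show "?G i \<in> borel_measurable M0" for i
    by (intro borel_measurable_add dist_M0 measurable_compose[OF fst_M0 section_nrm])
  fix p assume p: "p \<in> space M0"
  interpret complex_normed_space "V (fst p)" using normed M0_mem[OF p] by blast
  note cl = closed[of "fst p"] M0_mem[OF p]
  show "(case p of (x, v) \<Rightarrow> nrm (V x) v) \<le> ?G i p" for i
    using nrm_le_add_minus[of "snd p" "\<xi> i (fst p)"] cl by (simp add: split_beta)
  fix e :: real assume e: "e > 0"
  \<comment> \<open>Half of e suffices because the distance enters twice: in \<open>?G\<close>
    itself and in comparing the two norms.\<close>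
  obtain i where i: "ndiff (V (fst p)) (snd p) (\<xi> i (fst p)) < e / 2"
    using near[of "fst p" "snd p" "e / 2"] cl e by auto
  have "?G i p < (case p of (x, v) \<Rightarrow> nrm (V x) v) + e"
    using nrm_le_add_minus[of "\<xi> i (fst p)" "snd p"] nrm_minus_commute[of "\<xi> i (fst p)" "snd p"] cl i
    by (simp add: split_beta)
  then show "\<exists>i. ?G i p < (case p of (x, v) \<Rightarrow> nrm (V x) v) + e" by blast
qed

lemma space_fibre_product: "space (fibre_product A B) = {(p, q) \<in> space A \<times> space B. fst p = fst q}"
  by (auto simp: fibre_product_def space_restrict_space space_pair_measure)

lemma measurable_fibre_product_fst: "fst \<in> fibre_product A B \<rightarrow>\<^sub>M A"
  unfolding fibre_product_def by (rule measurable_restrict_space1) simp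

lemma measurable_fibre_product_snd: "snd \<in> fibre_product A B \<rightarrow>\<^sub>M B"
  unfolding fibre_product_def by (rule measurable_restrict_space1) simp

lemma add_M0: "(\<lambda>((x, v), (y, w)). (x, v \<oplus>\<^bsub>V x\<^esub> w)) \<in> fibre_product M0 M0 \<rightarrow>\<^sub>M M0"
proof -
  let ?h = "\<lambda>z. (fst (fst z), snd (fst z) \<oplus>\<^bsub>V (fst (fst z))\<^esub> snd (snd z))"
  have "?h \<in> fibre_product M0 M0 \<rightarrow>\<^sub>M M0"
  proof (rule measurable_M0I)
    let ?P = "fibre_product M0 M0"
    have mem: "fst (fst z) \<in> space X \<and> snd (fst z) \<in> carrier (V (fst (fst z))) \<and> snd (snd z) \<in> carrier (V (fst (fst z))) \<and>
       fst (snd z) = fst (fst z)" if "z \<in> space ?P" for z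
      using that M0_mem[of "fst z"] M0_mem[of "snd z"] by (auto simp: space_fibre_product)
    have x: "(\<lambda>z. fst (fst z)) \<in> ?P \<rightarrow>\<^sub>M X"
      by (rule measurable_compose[OF measurable_fibre_product_fst fst_M0])
    show "?h \<in> space ?P \<rightarrow> total"
    proof
      fix z assume z: "z \<in> space ?P"
      interpret complex_normed_space "V (fst (fst z))" using normed mem[OF z] by blast
      show "?h z \<in> total"
        using mem[OF z] by (auto simp: total_def)
    qed
    show "(\<lambda>z. fst (?h z)) \<in> ?P \<rightarrow>\<^sub>M X"
      using x by simp
    fix n
    let ?F = "\<lambda>z. ndiff (V (fst (fst z))) (snd (fst z) \<oplus>\<^bsub>V (fst (fst z))\<^esub> snd (snd z)) (\<xi> n (fst (fst z)))"
    have "?F \<in> borel_measurable ?P"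
    proof (rule borel_measurable_of_approx_inf)
      let ?d = "\<lambda>i p. ndiff (V (fst p)) (snd p) (\<xi> i (fst p))"
      \<comment> \<open>The sum of v and w is replaced by the sum of two sections; the factor 1
        brings the last term into the shape of \<open>combination\<close>.\<close>
      let ?G = "\<lambda>(i, j) z. ?d i (fst z) + ?d j (snd z) +
        ndiff (V (fst (fst z))) (1 \<odot>\<^bsub>V (fst (fst z))\<^esub> \<xi> i (fst (fst z)) \<oplus>\<^bsub>V (fst (fst z))\<^esub> \<xi> j (fst (fst z))) (\<xi> n (fst (fst z)))"
      show "?G ij \<in> borel_measurable ?P" for ij
        unfolding split_beta
        by (intro borel_measurable_add measurable_compose[OF measurable_fibre_product_fst dist_M0]
            measurable_compose[OF measurable_fibre_product_snd dist_M0] measurable_compose[OF x combination])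
      fix z assume z: "z \<in> space ?P"
      define E where "E = V (fst (fst z))"
      define v where "v = snd (fst z)"
      define w where "w = snd (snd z)"
      define s where "s i = \<xi> i (fst (fst z))" for i
      interpret complex_normed_space E unfolding E_def using normed mem[OF z] by blast
      have cl: "v \<in> carrier E" "w \<in> carrier E" "s i \<in> carrier E" for i
        using mem[OF z] closed[of "fst (fst z)"] by (auto simp: E_def v_def w_def s_def)
      have G: "?G (i, j) z = ndiff E v (s i) + ndiff E w (s j) + ndiff E (s i \<oplus>\<^bsub>E\<^esub> s j) (s n)" for i j
      proof -
        have "1 \<odot>\<^bsub>E\<^esub> s i = s i" using cl(3) by (rule smult_simps(5))
        then show ?thesis using mem[OF z] by (simp add: E_def v_def w_def s_def)
      qed
      have F: "?F z = ndiff E (v \<oplus>\<^bsub>E\<^esub> w) (s n)" by (simp add: E_def v_def w_def s_def)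
      have 1: "ndiff E (v \<oplus>\<^bsub>E\<^esub> w) (s i \<oplus>\<^bsub>E\<^esub> s j) \<le> ndiff E v (s i) + ndiff E w (s j)" for i j
        by (rule nrm_add_minus_add) (use cl in auto)
      show "?F z \<le> ?G ij z" for ij
      proof -
        obtain i j where ij: "ij = (i, j)" by (cases ij)
        show ?thesis
          unfolding ij G F using nrm_minus_triangle[of "v \<oplus>\<^bsub>E\<^esub> w" "s i \<oplus>\<^bsub>E\<^esub> s j" "s n"] 1[of i j] cl by simp
      qed
      fix e :: real assume e: "e > 0"
      \<comment> \<open>A quarter of e for each of the two errors, since each is counted
        twice.\<close>
      obtain i j where i: "ndiff E v (s i) < e / 4" and j: "ndiff E w (s j) < e / 4"
        using near[of "fst (fst z)" v "e / 4"] near[of "fst (fst z)" w "e / 4"] mem[OF z] cl e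
        by (auto simp: E_def s_def)
      have "?G (i, j) z < ?F z + e"
        unfolding G F using nrm_minus_triangle[of "s i \<oplus>\<^bsub>E\<^esub> s j" "v \<oplus>\<^bsub>E\<^esub> w" "s n"] 1[of i j] cl i j
          nrm_minus_commute[of "s i \<oplus>\<^bsub>E\<^esub> s j" "v \<oplus>\<^bsub>E\<^esub> w"] by simp
      then show "\<exists>ij. ?G ij z < ?F z + e" by (rule exI)
    qed
    then show "(\<lambda>z. ndiff (V (fst (?h z))) (snd (?h z)) (\<xi> n (fst (?h z)))) \<in> borel_measurable ?P"
      by simp
  qed
  then show ?thesis by (simp add: split_beta')
qed

lemma smult_M0: "(\<lambda>(c, (x, v)). (x, c \<odot>\<^bsub>V x\<^esub> v)) \<in> borel \<Otimes>\<^sub>M M0 \<rightarrow>\<^sub>M M0"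
proof (rule measurable_M0I)
  let ?P = "borel \<Otimes>\<^sub>M M0 :: (complex \<times> ('x \<times> 'a)) measure"
  have mem: "fst (snd z) \<in> space X \<and> snd (snd z) \<in> carrier (V (fst (snd z)))" if "z \<in> space ?P" for z
    using that M0_mem[of "snd z"] by (auto simp: space_pair_measure)
  have x: "(\<lambda>z. fst (snd z)) \<in> ?P \<rightarrow>\<^sub>M X"
    by (rule measurable_compose[OF measurable_snd fst_M0])
  show "(\<lambda>(c, (x, v)). (x, c \<odot>\<^bsub>V x\<^esub> v)) \<in> space ?P \<rightarrow> total"
  proof
    fix z assume z: "z \<in> space ?P"
    interpret complex_normed_space "V (fst (snd z))" using normed mem[OF z] by blast
    show "(case z of (c, (x, v)) \<Rightarrow> (x, c \<odot>\<^bsub>V x\<^esub> v)) \<in> total"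
      using mem[OF z] by (auto simp: split_beta total_def smult_simps)
  qed
  show "(\<lambda>z. fst (case z of (c, (x, v)) \<Rightarrow> (x, c \<odot>\<^bsub>V x\<^esub> v))) \<in> ?P \<rightarrow>\<^sub>M X"
    using x by (simp add: split_beta)
  fix n
  let ?F = "\<lambda>z. ndiff (V (fst (snd z))) (fst z \<odot>\<^bsub>V (fst (snd z))\<^esub> snd (snd z)) (\<xi> n (fst (snd z)))"
  have "?F \<in> borel_measurable ?P"
  proof (rule borel_measurable_of_approx_inf)
    let ?d = "\<lambda>i p. ndiff (V (fst p)) (snd p) (\<xi> i (fst p))"
    let ?q = "\<lambda>q r. Complex (of_rat q) (of_rat r)"
    \<comment> \<open>The scalar varies with the point while \<open>section_smult_diff\<close>
      concerns constant scalars. It is therefore replaced by rational ones, at a cost proportional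
      to the norm of the section.\<close>
    let ?G = "\<lambda>(q, r, i) z. cmod (fst z) * ?d i (snd z) + cmod (fst z - ?q q r) * nrm (V (fst (snd z))) (\<xi> i (fst (snd z))) +
      ndiff (V (fst (snd z))) (?q q r \<odot>\<^bsub>V (fst (snd z))\<^esub> \<xi> i (fst (snd z))) (\<xi> n (fst (snd z)))"
    show "?G qi \<in> borel_measurable ?P" for qi
    proof -
      have 1: "(\<lambda>z. cmod (fst z)) \<in> borel_measurable ?P" "(\<lambda>z. cmod (fst z - q)) \<in> borel_measurable ?P" for q
        by measurable
      show ?thesis
        unfolding split_beta
        by (intro borel_measurable_add borel_measurable_times 1 measurable_compose[OF measurable_snd dist_M0]
          measurable_compose[OF x section_nrm] measurable_compose[OF x section_smult_diff])
    qed
    fix z assume z: "z \<in> space ?P"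
    define E where "E = V (fst (snd z))"
    define c where "c = fst z"
    define v where "v = snd (snd z)"
    define s where "s i = \<xi> i (fst (snd z))" for i
    interpret complex_normed_space E unfolding E_def using normed mem[OF z] by blast
    have cl: "v \<in> carrier E" "s i \<in> carrier E" for i
      using mem[OF z] closed[of "fst (snd z)"] by (auto simp: E_def v_def s_def)
    have G: "?G (q, r, i) z = cmod c * ndiff E v (s i) + cmod (c - ?q q r) * nrm E (s i) + ndiff E (?q q r \<odot>\<^bsub>E\<^esub> s i) (s n)" for q r i
      by (simp add: E_def v_def c_def s_def)
    have F: "?F z = ndiff E (c \<odot>\<^bsub>E\<^esub> v) (s n)" by (simp add: E_def v_def c_def s_def)
    have 1: "ndiff E (c \<odot>\<^bsub>E\<^esub> v) (b \<odot>\<^bsub>E\<^esub> s i) \<le> cmod c * ndiff E v (s i) + cmod (c - b) * nrm E (s i)" for i b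
      using nrm_minus_triangle[of "c \<odot>\<^bsub>E\<^esub> v" "c \<odot>\<^bsub>E\<^esub> s i" "b \<odot>\<^bsub>E\<^esub> s i"] cl
      by (simp add: smult_simps(1) nrm_smult_minus nrm_smult_minus_smult)
    show "?F z \<le> ?G qi z" for qi
    proof -
      obtain q r i where qi: "qi = (q, r, i)" by (cases qi)
      show ?thesis
        unfolding qi G F
        using nrm_minus_triangle[of "c \<odot>\<^bsub>E\<^esub> v" "?q q r \<odot>\<^bsub>E\<^esub> s i" "s n"] 1[of "?q q r" i] cl by (simp add: smult_simps(1))
    qed
    fix e :: real assume e: "e > 0"
    have c1: "cmod c + 1 > 0" by (simp add: add_nonneg_pos)
    \<comment> \<open>The section is chosen before the rational scalar, whose tolerance depends on
      the norm of that section.\<close>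
    obtain i where i: "ndiff E v (s i) < e / 4 / (cmod c + 1)"
      using near[of "fst (snd z)" v "e / 4 / (cmod c + 1)"] mem[OF z] cl e c1 by (auto simp: E_def s_def)
    have n1: "nrm E (s i) + 1 > 0" using cl by (simp add: add_nonneg_pos)
    obtain q r where q: "cmod (c - ?q q r) < e / 4 / (nrm E (s i) + 1)"
      using complex_rational_approx[of "e / 4 / (nrm E (s i) + 1)" c] e n1 by auto
    have "ndiff E v (s i) * (cmod c + 1) < e / 4" using i unfolding pos_less_divide_eq[OF c1] .
    moreover have "cmod c * ndiff E v (s i) \<le> ndiff E v (s i) * (cmod c + 1)"
      using cl by (simp add: algebra_simps)
    moreover have "cmod (c - ?q q r) * (nrm E (s i) + 1) < e / 4" using q unfolding pos_less_divide_eq[OF n1] .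
    moreover have "cmod (c - ?q q r) * nrm E (s i) \<le> cmod (c - ?q q r) * (nrm E (s i) + 1)"
      by (intro mult_left_mono) auto
    moreover have "ndiff E (?q q r \<odot>\<^bsub>E\<^esub> s i) (s n) \<le> ndiff E (?q q r \<odot>\<^bsub>E\<^esub> s i) (c \<odot>\<^bsub>E\<^esub> v) + ndiff E (c \<odot>\<^bsub>E\<^esub> v) (s n)"
      using cl by (intro nrm_minus_triangle) (auto simp: smult_simps(1))
    moreover have "ndiff E (?q q r \<odot>\<^bsub>E\<^esub> s i) (c \<odot>\<^bsub>E\<^esub> v) = ndiff E (c \<odot>\<^bsub>E\<^esub> v) (?q q r \<odot>\<^bsub>E\<^esub> s i)"
      using cl by (intro nrm_minus_commute) (auto simp: smult_simps(1))
    ultimately have "?G (q, r, i) z < ?F z + e"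
      unfolding G F using 1[of "?q q r" i] by linarith
    then show "\<exists>qi. ?G qi z < ?F z + e" by (rule exI)
  qed
  then show "(\<lambda>z. nrm (V (fst (case z of (c, (x, v)) \<Rightarrow> (x, c \<odot>\<^bsub>V x\<^esub> v))))
     (snd (case z of (c, (x, v)) \<Rightarrow> (x, c \<odot>\<^bsub>V x\<^esub> v)) \<ominus>\<^bsub>V (fst (case z of (c, (x, v)) \<Rightarrow> (x, c \<odot>\<^bsub>V x\<^esub> v)))\<^esub>
       \<xi> n (fst (case z of (c, (x, v)) \<Rightarrow> (x, c \<odot>\<^bsub>V x\<^esub> v))))) \<in> borel_measurable ?P"
    by (simp add: split_beta)
qed

lemma borel_banach_field_M0: "borel_banach_field X V M0"
  unfolding borel_banach_field_def
proof (intro conjI ballI)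
  show "space M0 = (SIGMA x:space X. carrier (V x))" by (simp add: space_M0 total_def)
  show "\<exists>\<phi> :: nat \<Rightarrow> 'x \<Rightarrow> 'a. (\<forall>n. borel_section X M0 (\<phi> n)) \<and> (\<forall>x\<in>space X. norm_topology (V x) closure_of range (\<lambda>n. \<phi> n x) = carrier (V x))"
    by (intro exI[of _ \<xi>] conjI allI ballI section_M0 dense)
  fix x assume x: "x \<in> space X"
  interpret complex_normed_space "V x" by (rule normed[OF x])
  show "separable_space (norm_topology (V x))"
    unfolding separable_space_def using dense[OF x] closed[OF x]
    by (intro exI[of _ "range (\<lambda>n. \<xi> n x)"]) auto
qed (use X banach standard_borel_M0 fst_M0 nrm_M0 add_M0 smult_M0 in auto)

lemma sets_field_eq:
  assumes M: "borel_banach_field X V M" and \<xi>: "\<And>n. borel_section X M (\<xi> n)"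
  shows "sets M = sets M0"
proof -
  have sp: "space M = total" using field_space[OF M] by (simp add: total_def)
  have "(\<lambda>p. code p) \<in> borel_measurable M"
  proof (rule measurable_codeI)
    show "fst \<in> M \<rightarrow>\<^sub>M X" by (rule field_fst[OF M])
    fix n
    show "(\<lambda>p. ndiff (V (fst p)) (snd p) (\<xi> n (fst p))) \<in> borel_measurable M"
      using field_nrm_minus[OF M measurable_ident field_section_compose[OF M \<xi> field_fst[OF M]]] by simp
  qed
  then have "sets M = sets (vimage_algebra (space M) code borel)"
    using M inj_code by (intro standard_borel_eq_vimage_algebra) (simp_all add: sp borel_banach_field_def)
  then show ?thesis by (simp add: M0_def sp)
qed

end

section \<open>Measurability of tensor norms\<close>

lemma linear_maps_add: "f \<in> linear_maps E complex_ring \<Longrightarrow> a \<in> carrier E \<Longrightarrow> b \<in> carrier E \<Longrightarrow> f (a \<oplus>\<^bsub>E\<^esub> b) = f a + f b"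
  and linear_maps_smult: "f \<in> linear_maps E complex_ring \<Longrightarrow> a \<in> carrier E \<Longrightarrow> f (c \<odot>\<^bsub>E\<^esub> a) = c * f a"
  by (auto simp: linear_maps_def)

context complex_normed_space
begin

lemma linear_maps_combination:
  assumes f: "f \<in> linear_maps E complex_ring" and "a \<in> carrier E" "b \<in> carrier E" "d \<in> carrier E"
  shows "f (c \<odot> a \<oplus> b \<ominus> d) = c * f a + f b - f d"
  using assms(2-) by (simp add: minus_eq_smult smult_simps(1) linear_maps_add[OF f] linear_maps_smult[OF f])

text \<open>Both sides are Lipschitz in the scalar, so the bound passes from rational to arbitrary
  complex scalars. This is what keeps the constraints on a code countable.\<close>

lemma rational_bound_extend:
  fixes \<alpha> :: "nat \<Rightarrow> complex"
  assumes \<phi>: "\<And>i. \<phi> i \<in> carrier E" and C: "C \<ge> 0"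
    and bound: "\<And>q r i j k. cmod (Complex (of_rat q) (of_rat r) * \<alpha> i + \<alpha> j - \<alpha> k) \<le>
      C * nrm E (Complex (of_rat q) (of_rat r) \<odot> \<phi> i \<oplus> \<phi> j \<ominus> \<phi> k)"
  shows "cmod (c * \<alpha> i + \<alpha> j - \<alpha> k) \<le> C * nrm E (c \<odot> \<phi> i \<oplus> \<phi> j \<ominus> \<phi> k)"
proof (rule field_le_epsilon)
  fix e :: real assume e: "e > 0"
  \<comment> \<open>The sum of the Lipschitz constants of the two sides in c: the norm of
    \<open>\<phi> i\<close> times C on the right, the modulus of \<open>\<alpha> i\<close> on the
    left.\<close>
  define K where "K = C * nrm E (\<phi> i) + cmod (\<alpha> i)"
  have K: "K + 1 > 0" using C \<phi> by (simp add: K_def add_nonneg_pos)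
  obtain q r where "cmod (c - Complex (of_rat q) (of_rat r)) < e / (K + 1)"
    using complex_rational_approx[of "e / (K + 1)" c] e K by auto
  then obtain b where b: "cmod (c - b) < e / (K + 1)" and
    bb: "cmod (b * \<alpha> i + \<alpha> j - \<alpha> k) \<le> C * nrm E (b \<odot> \<phi> i \<oplus> \<phi> j \<ominus> \<phi> k)"
    using bound by blast
  have "cmod (c - b) * (K + 1) < e" using b unfolding pos_less_divide_eq[OF K] .
  moreover have "cmod (c - b) * K \<le> cmod (c - b) * (K + 1)" by (intro mult_left_mono) auto
  ultimately have small: "cmod (c - b) * K < e" by linarith
  have "nrm E (b \<odot> \<phi> i \<oplus> \<phi> j \<ominus> (c \<odot> \<phi> i \<oplus> \<phi> j)) \<le> cmod (b - c) * nrm E (\<phi> i)"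
    using nrm_add_minus_add[of "b \<odot> \<phi> i" "\<phi> j" "c \<odot> \<phi> i" "\<phi> j"] \<phi>
    by (simp add: smult_simps(1) nrm_smult_minus_smult minus_self)
  then have "nrm E (b \<odot> \<phi> i \<oplus> \<phi> j \<ominus> \<phi> k) \<le> nrm E (c \<odot> \<phi> i \<oplus> \<phi> j \<ominus> \<phi> k) + cmod (c - b) * nrm E (\<phi> i)"
    using nrm_minus_triangle[of "b \<odot> \<phi> i \<oplus> \<phi> j" "c \<odot> \<phi> i \<oplus> \<phi> j" "\<phi> k"] \<phi>
    by (simp add: smult_simps(1) norm_minus_commute)
  from mult_left_mono[OF this C] bb
  have 1: "cmod (b * \<alpha> i + \<alpha> j - \<alpha> k) \<le> C * nrm E (c \<odot> \<phi> i \<oplus> \<phi> j \<ominus> \<phi> k) + C * (cmod (c - b) * nrm E (\<phi> i))"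
    by (simp add: distrib_left)
  have eq: "c * \<alpha> i + \<alpha> j - \<alpha> k = (b * \<alpha> i + \<alpha> j - \<alpha> k) + (c - b) * \<alpha> i" by (simp add: algebra_simps)
  have "cmod (c * \<alpha> i + \<alpha> j - \<alpha> k) \<le> cmod (b * \<alpha> i + \<alpha> j - \<alpha> k) + cmod (c - b) * cmod (\<alpha> i)"
    using norm_triangle_ineq[of "b * \<alpha> i + \<alpha> j - \<alpha> k" "(c - b) * \<alpha> i"] unfolding eq norm_mult .
  also have "\<dots> \<le> C * nrm E (c \<odot> \<phi> i \<oplus> \<phi> j \<ominus> \<phi> k) + cmod (c - b) * K"
    using 1 by (simp add: K_def algebra_simps)
  finally show "cmod (c * \<alpha> i + \<alpha> j - \<alpha> k) \<le> C * nrm E (c \<odot> \<phi> i \<oplus> \<phi> j \<ominus> \<phi> k) + e"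
    using small by linarith
qed

text \<open>The crude bound B supplies continuity only, and by continuity the sharp bound K spreads
  from the dense sequence to the whole space. With K = 0 it shows that a functional
  vanishes.\<close>

lemma bound_from_dense:
  assumes \<phi>: "\<And>i. \<phi> i \<in> carrier E" and dense: "norm_topology E closure_of range \<phi> = carrier E"
    and h: "h \<in> linear_maps E complex_ring" and B: "\<And>v. v \<in> carrier E \<Longrightarrow> cmod (h v) \<le> B * nrm E v"
    and K: "\<And>i. cmod (h (\<phi> i)) \<le> K * nrm E (\<phi> i)" and K0: "K \<ge> 0" and B0: "B \<ge> 0" and v: "v \<in> carrier E"
  shows "cmod (h v) \<le> K * nrm E v"
proof (rule field_le_epsilon)
  fix e :: real assume e: "e > 0"
  have r: "range \<phi> \<subseteq> carrier E" using \<phi> by auto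
  have KB: "K + B + 1 > 0" using K0 B0 by simp
  have "\<exists>i. nrm E (\<phi> i \<ominus> v) < e / (K + B + 1)"
    using dense_iff[OF r] dense v divide_pos_pos[OF e KB] by simp
  then obtain i where i: "nrm E (\<phi> i \<ominus> v) < e / (K + B + 1)" by blast
  then have d: "nrm E (v \<ominus> \<phi> i) < e / (K + B + 1)" using nrm_minus_commute[OF v \<phi>] by simp
  have hv: "h v = h (\<phi> i) + h (v \<ominus> \<phi> i)"
    using v \<phi> by (simp add: minus_eq_smult smult_simps(1) linear_maps_add[OF h] linear_maps_smult[OF h])
  have "cmod (h v) \<le> K * nrm E (\<phi> i) + B * nrm E (v \<ominus> \<phi> i)"
    unfolding hv using norm_triangle_ineq[of "h (\<phi> i)" "h (v \<ominus> \<phi> i)"] K[of i] B[of "v \<ominus> \<phi> i"] v \<phi> by simp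
  moreover have "K * nrm E (\<phi> i) \<le> K * (nrm E v + nrm E (\<phi> i \<ominus> v))"
    by (rule mult_left_mono[OF nrm_le_add_minus[OF \<phi> v] K0])
  moreover have "nrm E (\<phi> i \<ominus> v) = nrm E (v \<ominus> \<phi> i)" by (rule nrm_minus_commute[OF \<phi> v])
  moreover have "nrm E (v \<ominus> \<phi> i) * (K + B + 1) < e" using d unfolding pos_less_divide_eq[OF KB] .
  moreover have "0 \<le> nrm E (v \<ominus> \<phi> i)" using v \<phi> by simp
  ultimately show "cmod (h v) \<le> K * nrm E v + e" by (simp add: algebra_simps)
qed

end

text \<open>\<open>None\<close> stands for the demand that the value at the tensor be large. In
  \<open>Some (t, q, r, i, j, k, l)\<close> the flag t selects the factor in which the three-term
  bound is taken, q and r give the scalar, i, j and k the vectors; for bilinear forms l is the index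
  held fixed in the other factor.\<close>

type_synonym constraint = "(bool \<times> rat \<times> rat \<times> nat \<times> nat \<times> nat \<times> nat) option"

lemma all_constraint:
  "(\<forall>k :: constraint. P k) \<longleftrightarrow> P None \<and> (\<forall>q r i j k l. P (Some (True, q, r, i, j, k, l))) \<and>
    (\<forall>q r i j k l. P (Some (False, q, r, i, j, k, l)))"
proof (intro iffI allI conjI)
  fix k :: constraint
  assume P: "P None \<and> (\<forall>q r i j k l. P (Some (True, q, r, i, j, k, l))) \<and> (\<forall>q r i j k l. P (Some (False, q, r, i, j, k, l)))"
  show "P k"
  proof (cases k)
    case (Some p)
    obtain t q r i j k l where p: "p = (t, q, r, i, j, k, l)" by (cases p)
    show ?thesis using P Some p by (cases t) simp_all
  qed (use P in simp)
qed simp_all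

definition ratc :: "rat \<Rightarrow> rat \<Rightarrow> complex" where
  "ratc q r = Complex (of_rat q) (of_rat r)"

text \<open>A pair of functionals is coded by its values on the dense sequences, a bilinear form by its values
  on pairs; the contractivity conditions are countably many closed conditions on these values.\<close>

definition inj_lhs :: "real \<Rightarrow> (complex \<times> nat \<times> nat) list \<Rightarrow> constraint \<Rightarrow> (nat + nat \<Rightarrow> complex) \<Rightarrow> real" where
  "inj_lhs s L k z = (case k of None \<Rightarrow> s - cmod (\<Sum>(c, i, j)\<leftarrow>L. c * z (Inl i) * z (Inr j))
    | Some (t, q, r, i, j, k, l) \<Rightarrow> (if t then cmod (ratc q r * z (Inl i) + z (Inl j) - z (Inl k))
        else cmod (ratc q r * z (Inr i) + z (Inr j) - z (Inr k))))"

definition inj_rhs :: "'a normed_module \<Rightarrow> 'b normed_module \<Rightarrow> (nat \<Rightarrow> 'a) \<Rightarrow> (nat \<Rightarrow> 'b) \<Rightarrow> constraint \<Rightarrow> real" where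
  "inj_rhs E F \<phi> \<psi> k = (case k of None \<Rightarrow> 0
    | Some (t, q, r, i, j, k, l) \<Rightarrow> (if t then ndiff E (ratc q r \<odot>\<^bsub>E\<^esub> \<phi> i \<oplus>\<^bsub>E\<^esub> \<phi> j) (\<phi> k)
        else ndiff F (ratc q r \<odot>\<^bsub>F\<^esub> \<psi> i \<oplus>\<^bsub>F\<^esub> \<psi> j) (\<psi> k)))"

definition proj_lhs :: "real \<Rightarrow> (complex \<times> nat \<times> nat) list \<Rightarrow> constraint \<Rightarrow> (nat \<times> nat \<Rightarrow> complex) \<Rightarrow> real" where
  "proj_lhs s L k z = (case k of None \<Rightarrow> s - cmod (\<Sum>(c, i, j)\<leftarrow>L. c * z (i, j))
    | Some (t, q, r, i, j, k, l) \<Rightarrow> (if t then cmod (ratc q r * z (i, l) + z (j, l) - z (k, l))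
        else cmod (ratc q r * z (l, i) + z (l, j) - z (l, k))))"

definition proj_rhs :: "'a normed_module \<Rightarrow> 'b normed_module \<Rightarrow> (nat \<Rightarrow> 'a) \<Rightarrow> (nat \<Rightarrow> 'b) \<Rightarrow> constraint \<Rightarrow> real" where
  "proj_rhs E F \<phi> \<psi> k = (case k of None \<Rightarrow> 0
    | Some (t, q, r, i, j, k, l) \<Rightarrow> (if t then nrm F (\<psi> l) * ndiff E (ratc q r \<odot>\<^bsub>E\<^esub> \<phi> i \<oplus>\<^bsub>E\<^esub> \<phi> j) (\<phi> k)
        else nrm E (\<phi> l) * ndiff F (ratc q r \<odot>\<^bsub>F\<^esub> \<psi> i \<oplus>\<^bsub>F\<^esub> \<psi> j) (\<psi> k)))"

lemma continuous_on_sum_list: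
  fixes f :: "'c \<Rightarrow> 'a::topological_space \<Rightarrow> complex"
  assumes "\<And>x. continuous_on UNIV (f x)"
  shows "continuous_on UNIV (\<lambda>z. \<Sum>x\<leftarrow>L. f x z)"
  by (induction L) (auto intro!: continuous_intros assms)

lemma continuous_inj_lhs: "continuous_on UNIV (inj_lhs s L k)"
proof -
  have c: "continuous_on UNIV (\<lambda>z :: nat + nat \<Rightarrow> complex. z i)" for i by simp
  have "continuous_on UNIV (\<lambda>z :: nat + nat \<Rightarrow> complex. \<Sum>(c, i, j)\<leftarrow>L. c * z (Inl i) * z (Inr j))"
    unfolding split_beta by (intro continuous_on_sum_list continuous_intros c)
  note L = this
  show ?thesis
  proof (cases k)
    case None
    show ?thesis unfolding inj_lhs_def None using L by (auto intro!: continuous_intros)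
  next
    case (Some p)
    obtain t q r i j k l where p: "p = (t, q, r, i, j, k, l)" by (cases p)
    show ?thesis unfolding inj_lhs_def Some p by (cases t) (auto intro!: continuous_intros c)
  qed
qed

lemma continuous_proj_lhs: "continuous_on UNIV (proj_lhs s L k)"
proof -
  have c: "continuous_on UNIV (\<lambda>z :: nat \<times> nat \<Rightarrow> complex. z i)" for i by simp
  have "continuous_on UNIV (\<lambda>z :: nat \<times> nat \<Rightarrow> complex. \<Sum>(c, i, j)\<leftarrow>L. c * z (i, j))"
    unfolding split_beta by (intro continuous_on_sum_list continuous_intros c)
  note L = this
  show ?thesis
  proof (cases k)
    case None
    show ?thesis unfolding proj_lhs_def None using L by (auto intro!: continuous_intros)
  next
    case (Some p)
    obtain t q r i j k l where p: "p = (t, q, r, i, j, k, l)" by (cases p)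
    show ?thesis unfolding proj_lhs_def Some p by (cases t) (auto intro!: continuous_intros c)
  qed
qed

lemma ratc_one: "ratc 1 0 = 1"
  by (simp add: ratc_def complex_eq_iff)

text \<open>With scalar 1 and three equal indices a constraint reduces to the modulus of one
  coordinate. This is the coordinatewise boundedness from which \<open>measurable_feasible\<close>
  gets compactness.\<close>

lemma inj_lhs_bounded: "\<exists>k. \<forall>z. cmod (z i) \<le> inj_lhs s L k z"
proof (cases i)
  case (Inl a)
  then show ?thesis by (intro exI[of _ "Some (True, 1, 0, a, a, a, a)"]) (simp add: inj_lhs_def ratc_one)
next
  case (Inr b)
  then show ?thesis by (intro exI[of _ "Some (False, 1, 0, b, b, b, b)"]) (simp add: inj_lhs_def ratc_one)
qed

lemma proj_lhs_bounded: "\<exists>k. \<forall>z. cmod (z i) \<le> proj_lhs s L k z"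
proof (cases i)
  case (Pair a b)
  then show ?thesis by (intro exI[of _ "Some (True, 1, 0, a, a, a, b)"]) (simp add: proj_lhs_def ratc_one)
qed

lemma ex_between: "(r::real) < y \<Longrightarrow> \<exists>n. r + 1 / real (Suc n) \<le> y"
proof -
  assume "r < y"
  then obtain n where "inverse (real (Suc n)) < y - r" using reals_Archimedean[of "y - r"] by auto
  then show ?thesis by (intro exI[of _ n]) (simp add: inverse_eq_divide)
qed

section \<open>The tensor norms expressed by feasibility of coded constraints\<close>

context normed_pair
begin

context
  fixes \<phi> :: "nat \<Rightarrow> 'a" and \<psi> :: "nat \<Rightarrow> 'b"
  assumes \<phi>: "\<And>i. \<phi> i \<in> carrier E" and \<psi>: "\<And>j. \<psi> j \<in> carrier F"
    and \<phi>d: "norm_topology E closure_of range \<phi> = carrier E"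
    and \<psi>d: "norm_topology F closure_of range \<psi> = carrier F"
begin

abbreviation (input) wt :: "(complex \<times> nat \<times> nat) list \<Rightarrow> ('a \<times> 'b) list" where
  "wt L \<equiv> map (\<lambda>(c, i, j). (c \<odot>\<^bsub>E\<^esub> \<phi> i, \<psi> j)) L"

lemma pairs_wt: "pairs (wt L)"
  using \<phi> \<psi> by (auto simp: pairs_def E.smult_simps)

lemma sum_wt: "\<beta> \<in> BF \<Longrightarrow> (\<Sum>(v, w)\<leftarrow>wt L. \<beta> v w) = (\<Sum>(c, i, j)\<leftarrow>L. c * \<beta> (\<phi> i) (\<psi> j))"
  by (induction L) (auto simp: bilinear_formD \<phi> \<psi>)

text \<open>The margin 1/(n+1) replaces the strict inequality by closed ones. A feasible z extends,
  separately on its two halves, to a pair of contractions by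
  \<open>extend_from_dense\<close>.\<close>

lemma less_inj_norm_iff:
  "r < inj_norm E F (ts (wt L)) \<longleftrightarrow> (\<exists>n z. \<forall>k. inj_lhs (r + 1 / real (Suc n)) L k z \<le> inj_rhs E F \<phi> \<psi> k)"
proof
  assume "r < inj_norm E F (ts (wt L))"
  then obtain f g where f: "f \<in> contractions E complex_ring" and g: "g \<in> contractions F complex_ring"
    and r: "r < cmod (\<Sum>(v, w)\<leftarrow>wt L. f v * g w)" using less_inj_normD by blast
  have lf: "f \<in> linear_maps E complex_ring" and lg: "g \<in> linear_maps F complex_ring"
    using f g by (simp_all add: contractions_def)
  obtain n where n: "r + 1 / real (Suc n) \<le> cmod (\<Sum>(v, w)\<leftarrow>wt L. f v * g w)" using ex_between[OF r] by blast
  define z where "z = case_sum (\<lambda>i. f (\<phi> i)) (\<lambda>j. g (\<psi> j))"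
  have "cmod (c * f (\<phi> i) + f (\<phi> j) - f (\<phi> k)) \<le> ndiff E (c \<odot>\<^bsub>E\<^esub> \<phi> i \<oplus>\<^bsub>E\<^esub> \<phi> j) (\<phi> k)" for c i j k
    using f \<phi> unfolding E.linear_maps_combination[OF lf \<phi> \<phi> \<phi>, symmetric] by (simp add: contractions_def E.smult_simps(1))
  moreover have "cmod (c * g (\<psi> i) + g (\<psi> j) - g (\<psi> k)) \<le> ndiff F (c \<odot>\<^bsub>F\<^esub> \<psi> i \<oplus>\<^bsub>F\<^esub> \<psi> j) (\<psi> k)" for c i j k
    using g \<psi> unfolding F.linear_maps_combination[OF lg \<psi> \<psi> \<psi>, symmetric] by (simp add: contractions_def F.smult_simps(1))
  moreover have "(\<Sum>(v, w)\<leftarrow>wt L. f v * g w) = (\<Sum>(c, i, j)\<leftarrow>L. c * z (Inl i) * z (Inr j))"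
    unfolding sum_wt[OF bilinear_form_product[OF lf lg]] by (simp add: z_def mult.assoc)
  ultimately have "\<forall>k. inj_lhs (r + 1 / real (Suc n)) L k z \<le> inj_rhs E F \<phi> \<psi> k"
    unfolding all_constraint using n by (simp add: inj_lhs_def inj_rhs_def z_def)
  then show "\<exists>n z. \<forall>k. inj_lhs (r + 1 / real (Suc n)) L k z \<le> inj_rhs E F \<phi> \<psi> k" by blast
next
  assume "\<exists>n z. \<forall>k. inj_lhs (r + 1 / real (Suc n)) L k z \<le> inj_rhs E F \<phi> \<psi> k"
  then obtain n z where z: "\<forall>k. inj_lhs (r + 1 / real (Suc n)) L k z \<le> inj_rhs E F \<phi> \<psi> k" by blast
  then have val: "r + 1 / real (Suc n) \<le> cmod (\<Sum>(c, i, j)\<leftarrow>L. c * z (Inl i) * z (Inr j))"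
    and b1: "\<And>q r i j k. cmod (ratc q r * z (Inl i) + z (Inl j) - z (Inl k)) \<le> 1 * ndiff E (ratc q r \<odot>\<^bsub>E\<^esub> \<phi> i \<oplus>\<^bsub>E\<^esub> \<phi> j) (\<phi> k)"
    and b2: "\<And>q r i j k. cmod (ratc q r * z (Inr i) + z (Inr j) - z (Inr k)) \<le> 1 * ndiff F (ratc q r \<odot>\<^bsub>F\<^esub> \<psi> i \<oplus>\<^bsub>F\<^esub> \<psi> j) (\<psi> k)"
    unfolding all_constraint by (simp_all add: inj_lhs_def inj_rhs_def)
  obtain f where lf: "f \<in> linear_maps E complex_ring" and f: "\<forall>i. f (\<phi> i) = z (Inl i)" "\<forall>v\<in>carrier E. cmod (f v) \<le> 1 * nrm E v"
    using E.extend_from_dense[OF \<phi> \<phi>d zero_le_one E.rational_bound_extend[OF \<phi> zero_le_one b1[unfolded ratc_def]]]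
    by (elim bexE conjE)
  obtain g where lg: "g \<in> linear_maps F complex_ring" and g: "\<forall>j. g (\<psi> j) = z (Inr j)" "\<forall>w\<in>carrier F. cmod (g w) \<le> 1 * nrm F w"
    using F.extend_from_dense[OF \<psi> \<psi>d zero_le_one F.rational_bound_extend[OF \<psi> zero_le_one b2[unfolded ratc_def]]]
    by (elim bexE conjE)
  have "f \<in> contractions E complex_ring" "g \<in> contractions F complex_ring"
    using lf lg f g by (simp_all add: contractions_def)
  from inj_norm_upper[OF pairs_wt this]
  have "cmod (\<Sum>(c, i, j)\<leftarrow>L. c * z (Inl i) * z (Inr j)) \<le> inj_norm E F (ts (wt L))"
    unfolding sum_wt[OF bilinear_form_product[OF lf lg]] using f g by (simp add: mult.assoc)
  moreover have "0 < 1 / real (Suc n)" by simp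
  ultimately show "r < inj_norm E F (ts (wt L))" using val by linarith
qed

interpretation P: complex_normed_space "alg_tensor (proj_norm E F) E F" by (rule normed_proj)

text \<open>From left to right, a functional norming the tensor defines a bilinear form bounded by
  the product of the norms. From right to left, a feasible array is extended to such a form in two
  rounds, first in E and then in F; its value at the tensor is bounded by the cost of every
  representation.\<close>

lemma less_proj_norm_iff:
  "r < proj_norm E F (ts (wt L)) \<longleftrightarrow> (\<exists>n z. \<forall>k. proj_lhs (r + 1 / real (Suc n)) L k z \<le> proj_rhs E F \<phi> \<psi> k)"
proof
  let ?T = "alg_tensor (proj_norm E F) E F"
  assume r: "r < proj_norm E F (ts (wt L))"
  obtain l where l: "l \<in> contractions ?T complex_ring"
    and lt: "l (ts (wt L)) = complex_of_real (proj_norm E F (ts (wt L)))"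
    using P.Hahn_Banach[OF ts_in_carrier[OF pairs_wt[of L]]] unfolding nrm_alg_tensor by (elim bexE)
  have ll: "l \<in> linear_maps ?T complex_ring" using l by (simp add: contractions_def)
  have bd: "cmod (l (ts ps)) \<le> cost ps" if "pairs ps" for ps
  proof -
    have "cmod (l (ts ps)) \<le> proj_norm E F (ts ps)"
      using l ts_in_carrier[OF that, of "proj_norm E F"] by (simp add: contractions_def)
    then show ?thesis using proj_norm_lower[OF that] by (rule order_trans)
  qed
  obtain n where n: "r + 1 / real (Suc n) \<le> proj_norm E F (ts (wt L))" using ex_between[OF r] by blast
  \<comment> \<open>The values on the dense sequences of the bilinear form belonging to l.\<close>
  define z where "z = (\<lambda>(i, j). l (ts [(\<phi> i, \<psi> j)]))"
  have p1: "pairs [(\<phi> i, \<psi> j)]" for i j using \<phi> \<psi> by simp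
  have lin: "l (ts (ps @ qs)) = l (ts ps) + l (ts qs)" if "pairs ps" "pairs qs" for ps qs
    using linear_maps_add[OF ll, of "ts ps" "ts qs"] that by (simp add: add_alg_tensor)
  have lsc: "l (ts (scale c ps)) = c * l (ts ps)" if "pairs ps" for c ps
    using linear_maps_smult[OF ll, of "ts ps" c] that by (simp add: smult_alg_tensor)
  have l0: "l (ts []) = 0" using lsc[of "[]" 0] by simp
  have "l (ts (wt L)) = (\<Sum>(c, i, j)\<leftarrow>L. c * z (i, j))"
  proof (induction L)
    case (Cons a L)
    obtain c i j where a: "a = (c, i, j)" by (cases a)
    show ?case
      using lin[of "scale c [(\<phi> i, \<psi> j)]" "wt L"] lsc[OF p1, of c i j] pairs_scale[OF p1, of c i j] pairs_wt[of L] Cons.IH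
      by (simp add: a z_def)
  qed (simp add: l0)
  then have e: "(\<Sum>(c, i, j)\<leftarrow>L. c * z (i, j)) = complex_of_real (proj_norm E F (ts (wt L)))"
    using lt by (rule trans[OF sym])
  have val: "cmod (\<Sum>(c, i, j)\<leftarrow>L. c * z (i, j)) = proj_norm E F (ts (wt L))"
    unfolding e norm_of_real by (rule abs_of_nonneg[OF proj_norm_nonneg[OF pairs_wt]])
  have b1: "cmod (c * z (i, m) + z (j, m) - z (k, m)) \<le> nrm F (\<psi> m) * ndiff E (c \<odot>\<^bsub>E\<^esub> \<phi> i \<oplus>\<^bsub>E\<^esub> \<phi> j) (\<phi> k)" for c i j k m
  proof -
    let ?v = "c \<odot>\<^bsub>E\<^esub> \<phi> i \<oplus>\<^bsub>E\<^esub> \<phi> j \<ominus>\<^bsub>E\<^esub> \<phi> k"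
    have v: "pairs [(?v, \<psi> m)]" using \<phi> \<psi> by (simp add: E.smult_simps(1))
    have "ts [(?v, \<psi> m)] = ts (scale c [(\<phi> i, \<psi> m)] @ [(\<phi> j, \<psi> m)] @ scale (-1) [(\<phi> k, \<psi> m)])"
      using \<phi> \<psi> by (simp add: ts_eq_iff E.minus_eq_smult E.smult_simps(1) bilinear_formD)
    then have "l (ts [(?v, \<psi> m)]) = l (ts (scale c [(\<phi> i, \<psi> m)] @ [(\<phi> j, \<psi> m)] @ scale (-1) [(\<phi> k, \<psi> m)]))"
      by (rule arg_cong)
    also have "\<dots> = l (ts (scale c [(\<phi> i, \<psi> m)])) + (l (ts [(\<phi> j, \<psi> m)]) + l (ts (scale (-1) [(\<phi> k, \<psi> m)])))"
      using lin[OF pairs_scale[OF p1], of "[(\<phi> j, \<psi> m)] @ scale (-1) [(\<phi> k, \<psi> m)]" c i m]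
        lin[OF p1 pairs_scale[OF p1], of j m "-1" k m] \<phi> \<psi> by (simp add: E.smult_simps(1))
    finally have "l (ts [(?v, \<psi> m)]) = l (ts (scale c [(\<phi> i, \<psi> m)])) + (l (ts [(\<phi> j, \<psi> m)]) + l (ts (scale (-1) [(\<phi> k, \<psi> m)])))" .
    then show ?thesis
      using bd[OF v] unfolding lsc[OF p1] by (simp add: z_def mult.commute add_diff_eq)
  qed
  have b2: "cmod (c * z (m, i) + z (m, j) - z (m, k)) \<le> nrm E (\<phi> m) * ndiff F (c \<odot>\<^bsub>F\<^esub> \<psi> i \<oplus>\<^bsub>F\<^esub> \<psi> j) (\<psi> k)" for c i j k m
  proof -
    let ?w = "c \<odot>\<^bsub>F\<^esub> \<psi> i \<oplus>\<^bsub>F\<^esub> \<psi> j \<ominus>\<^bsub>F\<^esub> \<psi> k"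
    have v: "pairs [(\<phi> m, ?w)]" using \<phi> \<psi> by (simp add: F.smult_simps(1))
    have "ts [(\<phi> m, ?w)] = ts (scale c [(\<phi> m, \<psi> i)] @ [(\<phi> m, \<psi> j)] @ scale (-1) [(\<phi> m, \<psi> k)])"
      using \<phi> \<psi> by (simp add: ts_eq_iff F.minus_eq_smult F.smult_simps(1) bilinear_formD)
    then have "l (ts [(\<phi> m, ?w)]) = l (ts (scale c [(\<phi> m, \<psi> i)] @ [(\<phi> m, \<psi> j)] @ scale (-1) [(\<phi> m, \<psi> k)]))"
      by (rule arg_cong)
    also have "\<dots> = l (ts (scale c [(\<phi> m, \<psi> i)])) + (l (ts [(\<phi> m, \<psi> j)]) + l (ts (scale (-1) [(\<phi> m, \<psi> k)])))"
      using lin[OF pairs_scale[OF p1], of "[(\<phi> m, \<psi> j)] @ scale (-1) [(\<phi> m, \<psi> k)]" c m i]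
        lin[OF p1 pairs_scale[OF p1], of m j "-1" m k] \<phi> \<psi> by (simp add: E.smult_simps(1))
    finally have "l (ts [(\<phi> m, ?w)]) = l (ts (scale c [(\<phi> m, \<psi> i)])) + (l (ts [(\<phi> m, \<psi> j)]) + l (ts (scale (-1) [(\<phi> m, \<psi> k)])))" .
    then show ?thesis
      using bd[OF v] unfolding lsc[OF p1] by (simp add: z_def add_diff_eq)
  qed
  have "\<forall>k. proj_lhs (r + 1 / real (Suc n)) L k z \<le> proj_rhs E F \<phi> \<psi> k"
    unfolding all_constraint using n val b1 b2 by (simp add: proj_lhs_def proj_rhs_def)
  then show "\<exists>n z. \<forall>k. proj_lhs (r + 1 / real (Suc n)) L k z \<le> proj_rhs E F \<phi> \<psi> k" by blast
next
  assume "\<exists>n z. \<forall>k. proj_lhs (r + 1 / real (Suc n)) L k z \<le> proj_rhs E F \<phi> \<psi> k"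
  then obtain n z where z: "\<forall>k. proj_lhs (r + 1 / real (Suc n)) L k z \<le> proj_rhs E F \<phi> \<psi> k" by blast
  then have val: "r + 1 / real (Suc n) \<le> cmod (\<Sum>(c, i, j)\<leftarrow>L. c * z (i, j))"
    and b1: "\<And>q r i j k l. cmod (ratc q r * z (i, l) + z (j, l) - z (k, l)) \<le> nrm F (\<psi> l) * ndiff E (ratc q r \<odot>\<^bsub>E\<^esub> \<phi> i \<oplus>\<^bsub>E\<^esub> \<phi> j) (\<phi> k)"
    and b2: "\<And>q r i j k l. cmod (ratc q r * z (l, i) + z (l, j) - z (l, k)) \<le> nrm E (\<phi> l) * ndiff F (ratc q r \<odot>\<^bsub>F\<^esub> \<psi> i \<oplus>\<^bsub>F\<^esub> \<psi> j) (\<psi> k)"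
    unfolding all_constraint by (simp_all add: proj_lhs_def proj_rhs_def)
  have E0: "0 \<le> nrm E (\<phi> l)" and F0: "0 \<le> nrm F (\<psi> l)" for l using \<phi> \<psi> by simp_all
  have c2: "cmod (c * z (l, i) + z (l, j) - z (l, k)) \<le> nrm E (\<phi> l) * ndiff F (c \<odot>\<^bsub>F\<^esub> \<psi> i \<oplus>\<^bsub>F\<^esub> \<psi> j) (\<psi> k)" for c i j k l
    by (rule F.rational_bound_extend[OF \<psi> E0 b2[unfolded ratc_def]])
  have "\<forall>l. \<exists>f. f \<in> linear_maps E complex_ring \<and> (\<forall>i. f (\<phi> i) = z (i, l)) \<and> (\<forall>v\<in>carrier E. cmod (f v) \<le> nrm F (\<psi> l) * nrm E v)"
  proof
    fix l
    from E.extend_from_dense[where \<alpha> = "\<lambda>i. z (i, l)", OF \<phi> \<phi>d F0 E.rational_bound_extend[OF \<phi> F0 b1[unfolded ratc_def]]]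
    show "\<exists>f. f \<in> linear_maps E complex_ring \<and> (\<forall>i. f (\<phi> i) = z (i, l)) \<and> (\<forall>v\<in>carrier E. cmod (f v) \<le> nrm F (\<psi> l) * nrm E v)"
      by (simp only: Bex_def)
  qed
  then obtain f where "\<forall>l. f l \<in> linear_maps E complex_ring \<and> (\<forall>i. f l (\<phi> i) = z (i, l)) \<and> (\<forall>v\<in>carrier E. cmod (f l v) \<le> nrm F (\<psi> l) * nrm E v)"
    unfolding choice_iff by (elim exE)
  then have fl: "f l \<in> linear_maps E complex_ring" and fz: "f l (\<phi> i) = z (i, l)"
    and fb: "v \<in> carrier E \<Longrightarrow> cmod (f l v) \<le> nrm F (\<psi> l) * nrm E v" for l i v by simp_all
  \<comment> \<open>For fixed v the values \<open>f j v\<close> satisfy the three-term bound of the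
    second factor. At the vectors \<open>\<phi> l\<close> this is c2; it spreads to every v because
    the combination is linear in v and bounded.\<close>
  have fc: "cmod (c * f i v + f j v - f k v) \<le> nrm E v * ndiff F (c \<odot>\<^bsub>F\<^esub> \<psi> i \<oplus>\<^bsub>F\<^esub> \<psi> j) (\<psi> k)"
    if v: "v \<in> carrier E" for c i j k v
  proof -
    let ?h = "\<lambda>v. c * f i v + f j v - f k v"
    let ?B = "cmod c * nrm F (\<psi> i) + nrm F (\<psi> j) + nrm F (\<psi> k)"
    let ?K = "ndiff F (c \<odot>\<^bsub>F\<^esub> \<psi> i \<oplus>\<^bsub>F\<^esub> \<psi> j) (\<psi> k)"
    have h: "?h \<in> linear_maps E complex_ring"
      by (rule E.linear_maps_complexI) (simp_all add: linear_maps_add[OF fl] linear_maps_smult[OF fl] algebra_simps)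
    have "cmod (?h v) \<le> ?K * nrm E v"
    proof (rule E.bound_from_dense[OF \<phi> \<phi>d h])
      fix u assume u: "u \<in> carrier E"
      have "cmod (?h u) \<le> cmod c * cmod (f i u) + cmod (f j u) + cmod (f k u)"
        using norm_triangle_ineq4[of "c * f i u + f j u" "f k u"] norm_triangle_ineq[of "c * f i u" "f j u"]
        by (simp add: norm_mult)
      also have "\<dots> \<le> cmod c * (nrm F (\<psi> i) * nrm E u) + nrm F (\<psi> j) * nrm E u + nrm F (\<psi> k) * nrm E u"
        by (intro add_mono mult_left_mono fb u) simp
      finally show "cmod (?h u) \<le> ?B * nrm E u" by (simp add: algebra_simps)
    next
      show "cmod (?h (\<phi> l)) \<le> ?K * nrm E (\<phi> l)" for l
        using c2[of c l i j k] by (simp add: fz mult.commute)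
    qed (use v F0 \<psi> in \<open>simp_all add: F.smult_simps(1)\<close>)
    then show ?thesis by (simp add: mult.commute)
  qed
  have "\<forall>v\<in>carrier E. \<exists>g. g \<in> linear_maps F complex_ring \<and> (\<forall>j. g (\<psi> j) = f j v) \<and> (\<forall>w\<in>carrier F. cmod (g w) \<le> nrm E v * nrm F w)"
  proof
    fix v assume v: "v \<in> carrier E"
    from F.extend_from_dense[where \<alpha> = "\<lambda>j. f j v", OF \<psi> \<psi>d E.nrm_nonneg[OF v] fc[OF v]]
    show "\<exists>g. g \<in> linear_maps F complex_ring \<and> (\<forall>j. g (\<psi> j) = f j v) \<and> (\<forall>w\<in>carrier F. cmod (g w) \<le> nrm E v * nrm F w)"
      by (simp only: Bex_def)
  qed
  then obtain G where "\<forall>v\<in>carrier E. G v \<in> linear_maps F complex_ring \<and> (\<forall>j. G v (\<psi> j) = f j v) \<and> (\<forall>w\<in>carrier F. cmod (G v w) \<le> nrm E v * nrm F w)"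
    unfolding bchoice_iff by (elim exE)
  then have Gl: "G v \<in> linear_maps F complex_ring" and Gf: "G v (\<psi> j) = f j v"
    and Gb: "w \<in> carrier F \<Longrightarrow> cmod (G v w) \<le> nrm E v * nrm F w" if "v \<in> carrier E" for v w j
    using that by simp_all
  \<comment> \<open>The functionals \<open>G v\<close> are chosen separately for each v, so
    linearity in v has to be recovered: the defect is a bounded functional that vanishes at all
    \<open>\<psi> j\<close>.\<close>
  have Glin: "G (c \<odot>\<^bsub>E\<^esub> u \<oplus>\<^bsub>E\<^esub> v) w = c * G u w + G v w" if u: "u \<in> carrier E" and v: "v \<in> carrier E" and w: "w \<in> carrier F" for c u v w
  proof -
    let ?x = "c \<odot>\<^bsub>E\<^esub> u \<oplus>\<^bsub>E\<^esub> v"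
    have x: "?x \<in> carrier E" using u v by (simp add: E.smult_simps(1))
    let ?h = "\<lambda>w. c * G u w + G v w - G ?x w"
    let ?B = "cmod c * nrm E u + nrm E v + nrm E ?x"
    have h: "?h \<in> linear_maps F complex_ring"
      by (rule F.linear_maps_complexI)
        (simp_all add: linear_maps_add[OF Gl[OF u]] linear_maps_smult[OF Gl[OF u]] linear_maps_add[OF Gl[OF v]]
          linear_maps_smult[OF Gl[OF v]] linear_maps_add[OF Gl[OF x]] linear_maps_smult[OF Gl[OF x]] algebra_simps)
    have "cmod (?h w) \<le> 0 * nrm F w"
    proof (rule F.bound_from_dense[OF \<psi> \<psi>d h])
      fix y assume y: "y \<in> carrier F"
      have "cmod (?h y) \<le> cmod c * cmod (G u y) + cmod (G v y) + cmod (G ?x y)"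
        using norm_triangle_ineq4[of "c * G u y + G v y" "G ?x y"] norm_triangle_ineq[of "c * G u y" "G v y"]
        by (simp add: norm_mult)
      also have "\<dots> \<le> cmod c * (nrm E u * nrm F y) + nrm E v * nrm F y + nrm E ?x * nrm F y"
        by (intro add_mono mult_left_mono Gb u v x y) simp
      finally show "cmod (?h y) \<le> ?B * nrm F y" by (simp add: algebra_simps)
    next
      show "cmod (?h (\<psi> j)) \<le> 0 * nrm F (\<psi> j)" for j
        using u v by (simp add: Gf x linear_maps_add[OF fl] linear_maps_smult[OF fl] E.smult_simps(1))
    qed (use u v x w in \<open>simp_all\<close>)
    then show ?thesis by simp
  qed
  have G0: "G \<zero>\<^bsub>E\<^esub> w = 0" if "w \<in> carrier F" for w
    using Glin[of "\<zero>\<^bsub>E\<^esub>" "\<zero>\<^bsub>E\<^esub>" w 1] that by (simp add: E.smult_simps)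
  have "(\<lambda>v. G v w) \<in> linear_maps E complex_ring" if w: "w \<in> carrier F" for w
  proof (rule E.linear_maps_complexI)
    show "G (a \<oplus>\<^bsub>E\<^esub> b) w = G a w + G b w" if "a \<in> carrier E" "b \<in> carrier E" for a b
      using Glin[of a b w 1] that w by (simp add: E.smult_simps)
    show "G (c \<odot>\<^bsub>E\<^esub> a) w = c * G a w" if "a \<in> carrier E" for a c
      using Glin[of a "\<zero>\<^bsub>E\<^esub>" w c] that w G0[OF w] by (simp add: E.smult_simps)
  qed
  then have GB: "G \<in> BF" using Gl by (simp add: bilinear_forms_def)
  have Gz: "G (\<phi> i) (\<psi> j) = z (i, j)" for i j using Gf[OF \<phi>] fz by simp
  have "cmod (\<Sum>(c, i, j)\<leftarrow>L. c * z (i, j)) \<le> proj_norm E F (ts (wt L))"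
  proof (rule proj_norm_greatest[OF pairs_wt])
    fix qs assume qs: "pairs qs" "ts qs = ts (wt L)"
    have "(\<Sum>(c, i, j)\<leftarrow>L. c * z (i, j)) = (\<Sum>(v, w)\<leftarrow>wt L. G v w)"
      unfolding sum_wt[OF GB] Gz ..
    also have "\<dots> = (\<Sum>(v, w)\<leftarrow>qs. G v w)" using qs(2) GB unfolding ts_eq_iff by simp
    also have "cmod \<dots> \<le> cost qs"
      using qs(1)
    proof (induction qs)
      case (Cons p qs)
      obtain v w where p: "p = (v, w)" by (cases p)
      then show ?case
        using Cons Gb[of v w] norm_triangle_ineq[of "G v w" "\<Sum>(v, w)\<leftarrow>qs. G v w"] by auto
    qed simp
    finally show "cmod (\<Sum>(c, i, j)\<leftarrow>L. c * z (i, j)) \<le> cost qs" .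
  qed
  moreover have "0 < 1 / real (Suc n)" by simp
  ultimately show "r < proj_norm E F (ts (wt L))" using val by linarith
qed

end

end

locale section_pair =
  fixes X :: "'x measure" and V :: "'x \<Rightarrow> 'v normed_module" and W :: "'x \<Rightarrow> 'w normed_module"
    and \<phi> :: "nat \<Rightarrow> 'x \<Rightarrow> 'v" and \<psi> :: "nat \<Rightarrow> 'x \<Rightarrow> 'w"
  assumes normed: "x \<in> space X \<Longrightarrow> complex_normed_space (V x)" "x \<in> space X \<Longrightarrow> complex_normed_space (W x)"
    and closed: "x \<in> space X \<Longrightarrow> \<phi> n x \<in> carrier (V x)" "x \<in> space X \<Longrightarrow> \<psi> n x \<in> carrier (W x)"
    and dense: "x \<in> space X \<Longrightarrow> norm_topology (V x) closure_of range (\<lambda>n. \<phi> n x) = carrier (V x)"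
      "x \<in> space X \<Longrightarrow> norm_topology (W x) closure_of range (\<lambda>n. \<psi> n x) = carrier (W x)"
    and combination: "(\<lambda>x. ndiff (V x) (c \<odot>\<^bsub>V x\<^esub> \<phi> i x \<oplus>\<^bsub>V x\<^esub> \<phi> j x) (\<phi> k x)) \<in> borel_measurable X"
      "(\<lambda>x. ndiff (W x) (c \<odot>\<^bsub>W x\<^esub> \<psi> i x \<oplus>\<^bsub>W x\<^esub> \<psi> j x) (\<psi> k x)) \<in> borel_measurable X"
    and nrm_sections: "(\<lambda>x. nrm (V x) (\<phi> i x)) \<in> borel_measurable X" "(\<lambda>x. nrm (W x) (\<psi> i x)) \<in> borel_measurable X"
begin

lemma normed_pair: "x \<in> space X \<Longrightarrow> normed_pair (V x) (W x)"
  using normed by (simp add: normed_pair_def)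

lemma measurable_inj_norm:
  "(\<lambda>x. inj_norm (V x) (W x) (tensor_sum (V x) (W x) (map (\<lambda>(c, i, j). (c \<odot>\<^bsub>V x\<^esub> \<phi> i x, \<psi> j x)) L))) \<in> borel_measurable X"
proof (rule borel_measurableI_greater)
  fix r
  have b: "(\<lambda>x. inj_rhs (V x) (W x) (\<lambda>i. \<phi> i x) (\<lambda>j. \<psi> j x) k) \<in> borel_measurable X" for k
    unfolding inj_rhs_def using combination by (cases k) (auto simp: split_beta)
  have "{x \<in> space X. r < inj_norm (V x) (W x) (tensor_sum (V x) (W x) (map (\<lambda>(c, i, j). (c \<odot>\<^bsub>V x\<^esub> \<phi> i x, \<psi> j x)) L))} =
    (\<Union>n. {x \<in> space X. \<exists>z. \<forall>k. inj_lhs (r + 1 / real (Suc n)) L k z \<le> inj_rhs (V x) (W x) (\<lambda>i. \<phi> i x) (\<lambda>j. \<psi> j x) k})"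
  proof (rule Set.set_eqI)
    fix x
    show "x \<in> {x \<in> space X. r < inj_norm (V x) (W x) (tensor_sum (V x) (W x) (map (\<lambda>(c, i, j). (c \<odot>\<^bsub>V x\<^esub> \<phi> i x, \<psi> j x)) L))} \<longleftrightarrow>
      x \<in> (\<Union>n. {x \<in> space X. \<exists>z. \<forall>k. inj_lhs (r + 1 / real (Suc n)) L k z \<le> inj_rhs (V x) (W x) (\<lambda>i. \<phi> i x) (\<lambda>j. \<psi> j x) k})"
    proof (cases "x \<in> space X")
      case True
      show ?thesis
        using normed_pair.less_inj_norm_iff[OF normed_pair[OF True] closed(1)[OF True] closed(2)[OF True] dense(1)[OF True] dense(2)[OF True], of r L] True
        by (simp del: of_nat_Suc)
    qed simp
  qed
  also have "\<dots> \<in> sets X"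
    by (intro sets.countable_UN) (auto intro: measurable_feasible[OF continuous_inj_lhs b inj_lhs_bounded])
  finally show "{x \<in> space X. r < inj_norm (V x) (W x) (tensor_sum (V x) (W x) (map (\<lambda>(c, i, j). (c \<odot>\<^bsub>V x\<^esub> \<phi> i x, \<psi> j x)) L))} \<in> sets X" .
qed

lemma measurable_proj_norm:
  "(\<lambda>x. proj_norm (V x) (W x) (tensor_sum (V x) (W x) (map (\<lambda>(c, i, j). (c \<odot>\<^bsub>V x\<^esub> \<phi> i x, \<psi> j x)) L))) \<in> borel_measurable X"
proof (rule borel_measurableI_greater)
  fix r
  have b: "(\<lambda>x. proj_rhs (V x) (W x) (\<lambda>i. \<phi> i x) (\<lambda>j. \<psi> j x) k) \<in> borel_measurable X" for k
    unfolding proj_rhs_def using combination nrm_sections by (cases k) (auto simp: split_beta intro!: borel_measurable_times)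
  have "{x \<in> space X. r < proj_norm (V x) (W x) (tensor_sum (V x) (W x) (map (\<lambda>(c, i, j). (c \<odot>\<^bsub>V x\<^esub> \<phi> i x, \<psi> j x)) L))} =
    (\<Union>n. {x \<in> space X. \<exists>z. \<forall>k. proj_lhs (r + 1 / real (Suc n)) L k z \<le> proj_rhs (V x) (W x) (\<lambda>i. \<phi> i x) (\<lambda>j. \<psi> j x) k})"
  proof (rule Set.set_eqI)
    fix x
    show "x \<in> {x \<in> space X. r < proj_norm (V x) (W x) (tensor_sum (V x) (W x) (map (\<lambda>(c, i, j). (c \<odot>\<^bsub>V x\<^esub> \<phi> i x, \<psi> j x)) L))} \<longleftrightarrow>
      x \<in> (\<Union>n. {x \<in> space X. \<exists>z. \<forall>k. proj_lhs (r + 1 / real (Suc n)) L k z \<le> proj_rhs (V x) (W x) (\<lambda>i. \<phi> i x) (\<lambda>j. \<psi> j x) k})"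
    proof (cases "x \<in> space X")
      case True
      show ?thesis
        using normed_pair.less_proj_norm_iff[OF normed_pair[OF True] closed(1)[OF True] closed(2)[OF True] dense(1)[OF True] dense(2)[OF True], of r L] True
        by (simp del: of_nat_Suc)
    qed simp
  qed
  also have "\<dots> \<in> sets X"
    by (intro sets.countable_UN) (auto intro: measurable_feasible[OF continuous_proj_lhs b proj_lhs_bounded])
  finally show "{x \<in> space X. r < proj_norm (V x) (W x) (tensor_sum (V x) (W x) (map (\<lambda>(c, i, j). (c \<odot>\<^bsub>V x\<^esub> \<phi> i x, \<psi> j x)) L))} \<in> sets X" .
qed

end

section \<open>Tensor products of Borel fields\<close>

lemma linear_maps_zero:
  assumes "complex_normed_space E" "complex_normed_space F" and f: "f \<in> linear_maps E F"
  shows "f \<zero>\<^bsub>E\<^esub> = \<zero>\<^bsub>F\<^esub>"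
proof -
  interpret E: complex_normed_space E by fact
  interpret F: complex_normed_space F by fact
  have "f (0 \<odot>\<^bsub>E\<^esub> \<zero>\<^bsub>E\<^esub>) = 0 \<odot>\<^bsub>F\<^esub> f \<zero>\<^bsub>E\<^esub>"
    using f E.M.zero_closed unfolding linear_maps_def by blast
  moreover have "f \<zero>\<^bsub>E\<^esub> \<in> carrier F"
    using f by (auto simp: linear_maps_def)
  ultimately show ?thesis by (simp add: E.smult_simps F.smult_simps)
qed

lemma linear_maps_minus:
  assumes "complex_normed_space E" "complex_normed_space F" and f: "f \<in> linear_maps E F"
    and a: "a \<in> carrier E" and b: "b \<in> carrier E"
  shows "f (a \<ominus>\<^bsub>E\<^esub> b) = f a \<ominus>\<^bsub>F\<^esub> f b"
proof -
  interpret E: complex_normed_space E by fact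
  interpret F: complex_normed_space F by fact
  have "f a \<in> carrier F" "f b \<in> carrier F" using f a b by (auto simp: linear_maps_def)
  moreover have "f (a \<oplus>\<^bsub>E\<^esub> (-1) \<odot>\<^bsub>E\<^esub> b) = f a \<oplus>\<^bsub>F\<^esub> (-1) \<odot>\<^bsub>F\<^esub> f b"
    using f a b E.smult_simps(1)[OF b, of "-1"] by (auto simp: linear_maps_def)
  ultimately show ?thesis using a b by (simp add: E.minus_eq_smult F.minus_eq_smult)
qed

text \<open>Treats both tensor products at once: the particular norm enters only through
  \<open>tensor_norm\<close> and \<open>measurable_norm\<close>.\<close>

locale tensor_field_data = section_pair X V W \<phi> \<psi>
  for X :: "'x measure" and V :: "'x \<Rightarrow> 'v normed_module" and W :: "'x \<Rightarrow> 'w normed_module"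
    and \<phi> :: "nat \<Rightarrow> 'x \<Rightarrow> 'v" and \<psi> :: "nat \<Rightarrow> 'x \<Rightarrow> 'w" +
  fixes MV :: "('x \<times> 'v) measure" and MW :: "('x \<times> 'w) measure" and \<alpha> :: "'x \<Rightarrow> ('v, 'w) tensor \<Rightarrow> real"
  assumes fields: "borel_banach_field X V MV" "borel_banach_field X W MW"
    and sections: "borel_section X MV (\<phi> n)" "borel_section X MW (\<psi> n)"
    and tensor_norm: "x \<in> space X \<Longrightarrow> tensor_norm (V x) (W x) (\<alpha> x)"
    and measurable_norm: "(\<lambda>x. \<alpha> x (tensor_sum (V x) (W x) (map (\<lambda>(c, i, j). (c \<odot>\<^bsub>V x\<^esub> \<phi> i x, \<psi> j x)) L))) \<in> borel_measurable X"
begin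

definition fibre :: "'x \<Rightarrow> ('v, 'w) ctensor normed_module" where
  "fibre x = completion (alg_tensor (\<alpha> x) (V x) (W x))"

definition elem :: "'x \<Rightarrow> 'v \<Rightarrow> 'w \<Rightarrow> ('v, 'w) ctensor" where
  "elem x v w = to_completion (alg_tensor (\<alpha> x) (V x) (W x)) (tensor_sum (V x) (W x) [(v, w)])"

definition tsum :: "(nat \<times> nat) list \<Rightarrow> 'x \<Rightarrow> ('v, 'w) ctensor" where
  "tsum I x = to_completion (alg_tensor (\<alpha> x) (V x) (W x)) (tensor_sum (V x) (W x) (map (\<lambda>(i, j). (\<phi> i x, \<psi> j x)) I))"

definition \<xi> :: "nat \<Rightarrow> 'x \<Rightarrow> ('v, 'w) ctensor" where
  "\<xi> n = tsum (from_nat n)"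

lemma elem_eq: "x \<in> space X \<Longrightarrow> elem x = tensor_norm.elem (V x) (W x) (\<alpha> x)"
  by (intro ext) (simp add: elem_def tensor_norm.elem_def[OF tensor_norm])

lemma tsum_eq: "x \<in> space X \<Longrightarrow> tsum I x = tensor_norm.sum_elems (V x) (W x) (\<alpha> x) (\<lambda>i. \<phi> i x) (\<lambda>j. \<psi> j x) I"
  by (simp add: tsum_def tensor_norm.sum_elems_def[OF tensor_norm])

lemma fibre_normed: "x \<in> space X \<Longrightarrow> complex_normed_space (fibre x)"
  unfolding fibre_def
  by (rule complex_normed_space.complex_normed_space_completion[OF tensor_norm.normed[OF tensor_norm]])

lemma elem_closed: "x \<in> space X \<Longrightarrow> v \<in> carrier (V x) \<Longrightarrow> w \<in> carrier (W x) \<Longrightarrow> elem x v w \<in> carrier (fibre x)"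
  unfolding elem_eq fibre_def by (rule tensor_norm.elem_closed[OF tensor_norm])

lemma tsum_closed: "x \<in> space X \<Longrightarrow> tsum I x \<in> carrier (fibre x)"
  unfolding tsum_eq fibre_def by (rule tensor_norm.sum_elems_closed[OF tensor_norm closed])

lemma tsum_Nil: "x \<in> space X \<Longrightarrow> tsum [] x = \<zero>\<^bsub>fibre x\<^esub>"
  unfolding tsum_eq fibre_def by (rule tensor_norm.sum_elems_Nil[OF tensor_norm])

lemma tsum_Cons: "x \<in> space X \<Longrightarrow> tsum ((i, j) # I) x = elem x (\<phi> i x) (\<psi> j x) \<oplus>\<^bsub>fibre x\<^esub> tsum I x"
  unfolding tsum_eq elem_eq fibre_def by (rule tensor_norm.sum_elems_Cons[OF tensor_norm closed])

lemma tsum_single: "x \<in> space X \<Longrightarrow> tsum [(i, j)] x = elem x (\<phi> i x) (\<psi> j x)"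
  by (simp add: tsum_def elem_def)

lemma nrm_elem_minus_elem:
  "x \<in> space X \<Longrightarrow> v \<in> carrier (V x) \<Longrightarrow> v' \<in> carrier (V x) \<Longrightarrow> w \<in> carrier (W x) \<Longrightarrow> w' \<in> carrier (W x) \<Longrightarrow>
    ndiff (fibre x) (elem x v w) (elem x v' w') \<le>
      ndiff (V x) v v' * nrm (W x) w + nrm (V x) v' * ndiff (W x) w w'"
  unfolding elem_eq fibre_def by (rule tensor_norm.nrm_elem_minus_elem[OF tensor_norm])

sublocale U: dense_sections X fibre \<xi>
proof
  show "standard_borel X" using fields by (simp add: borel_banach_field_def)
  show "complex_banach_space (fibre x)" if x: "x \<in> space X" for x
    unfolding fibre_def
    by (rule complex_normed_space.complex_banach_space_completion[OF tensor_norm.normed[OF tensor_norm[OF x]]])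
  show "\<xi> n x \<in> carrier (fibre x)" if x: "x \<in> space X" for n x
    unfolding \<xi>_def by (rule tsum_closed[OF x])
  show "norm_topology (fibre x) closure_of range (\<lambda>n. \<xi> n x) = carrier (fibre x)" if x: "x \<in> space X" for x
    unfolding \<xi>_def tsum_eq[OF x] fibre_def
    by (rule tensor_norm.sum_elems_dense[OF tensor_norm[OF x] closed(1)[OF x] closed(2)[OF x] dense(1)[OF x] dense(2)[OF x]])
  fix c i j k
  show "(\<lambda>x. ndiff (fibre x) (c \<odot>\<^bsub>fibre x\<^esub> \<xi> i x \<oplus>\<^bsub>fibre x\<^esub> \<xi> j x) (\<xi> k x)) \<in> borel_measurable X"
  proof (rule measurable_cong[THEN iffD1, OF _ measurable_norm])
    fix x assume x: "x \<in> space X"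
    show "\<alpha> x (tensor_sum (V x) (W x) (map (\<lambda>(c, i, j). (c \<odot>\<^bsub>V x\<^esub> \<phi> i x, \<psi> j x))
        (map (\<lambda>(i, j). (c, i, j)) (from_nat i) @ map (\<lambda>(i, j). (1, i, j)) (from_nat j) @ map (\<lambda>(i, j). (-1, i, j)) (from_nat k)))) =
      ndiff (fibre x) (c \<odot>\<^bsub>fibre x\<^esub> \<xi> i x \<oplus>\<^bsub>fibre x\<^esub> \<xi> j x) (\<xi> k x)"
      unfolding \<xi>_def tsum_eq[OF x] fibre_def
      by (rule tensor_norm.nrm_combination_sum_elems[OF tensor_norm[OF x] closed(1)[OF x] closed(2)[OF x], symmetric])
  qed
qed

lemma nearV: "x \<in> space X \<Longrightarrow> v \<in> carrier (V x) \<Longrightarrow> e > 0 \<Longrightarrow> \<exists>i. ndiff (V x) v (\<phi> i x) < e"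
  and nearW: "x \<in> space X \<Longrightarrow> w \<in> carrier (W x) \<Longrightarrow> e > 0 \<Longrightarrow> \<exists>j. ndiff (W x) w (\<psi> j x) < e"
proof -
  assume x: "x \<in> space X" and e: "e > 0"
  interpret V: complex_normed_space "V x" by (rule normed(1)[OF x])
  interpret W: complex_normed_space "W x" by (rule normed(2)[OF x])
  have rV: "range (\<lambda>n. \<phi> n x) \<subseteq> carrier (V x)" and rW: "range (\<lambda>n. \<psi> n x) \<subseteq> carrier (W x)"
    using closed[OF x] by auto
  show "\<exists>i. ndiff (V x) v (\<phi> i x) < e" if v: "v \<in> carrier (V x)"
  proof -
    have "\<exists>i. ndiff (V x) (\<phi> i x) v < e"
      using V.dense_iff[OF rV] dense(1)[OF x] v e by simp
    then show ?thesis unfolding V.nrm_minus_commute[OF v closed(1)[OF x]] .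
  qed
  show "\<exists>j. ndiff (W x) w (\<psi> j x) < e" if w: "w \<in> carrier (W x)"
  proof -
    have "\<exists>j. ndiff (W x) (\<psi> j x) w < e"
      using W.dense_iff[OF rW] dense(2)[OF x] w e by simp
    then show ?thesis unfolding W.nrm_minus_commute[OF w closed(2)[OF x]] .
  qed
qed

lemma measurable_elem_M0:
  "(\<lambda>((x, v), (y, w)). (x, elem x v w)) \<in> fibre_product MV MW \<rightarrow>\<^sub>M U.M0"
proof -
  let ?P = "fibre_product MV MW"
  let ?h = "\<lambda>z. (fst (fst z), elem (fst (fst z)) (snd (fst z)) (snd (snd z)))"
  have mem: "fst (fst z) \<in> space X \<and> snd (fst z) \<in> carrier (V (fst (fst z))) \<and> snd (snd z) \<in> carrier (W (fst (fst z))) \<and>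
     fst (snd z) = fst (fst z)" if "z \<in> space ?P" for z
    using that field_space[OF fields(1)] field_space[OF fields(2)] by (auto simp: U.space_fibre_product)
  note f = U.measurable_fibre_product_fst[of MV MW] and g = U.measurable_fibre_product_snd[of MV MW]
  have x: "(\<lambda>z. fst (fst z)) \<in> ?P \<rightarrow>\<^sub>M X"
    by (rule measurable_compose[OF f field_fst[OF fields(1)]])
  have dV: "(\<lambda>z. ndiff (V (fst (fst z))) (snd (fst z)) (\<phi> i (fst (fst z)))) \<in> borel_measurable ?P" for i
    using field_nrm_minus[OF fields(1) f field_section_compose[OF fields(1) sections(1) x]] by simp
  have dW: "(\<lambda>z. ndiff (W (fst (snd z))) (snd (snd z)) (\<psi> j (fst (snd z)))) \<in> borel_measurable ?P" for j
    using field_nrm_minus[OF fields(2) g field_section_compose[OF fields(2) sections(2) measurable_compose[OF g field_fst[OF fields(2)]]]] by simp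
  have "?h \<in> ?P \<rightarrow>\<^sub>M U.M0"
  proof (rule U.measurable_M0I)
    show "?h \<in> space ?P \<rightarrow> U.total" using mem elem_closed by (auto simp: U.total_def)
    show "(\<lambda>z. fst (?h z)) \<in> ?P \<rightarrow>\<^sub>M X" using x by simp
    fix n
    let ?F = "\<lambda>z. ndiff (fibre (fst (fst z))) (elem (fst (fst z)) (snd (fst z)) (snd (snd z))) (\<xi> n (fst (fst z)))"
    have "?F \<in> borel_measurable ?P"
    proof (rule borel_measurable_of_approx_inf)
      \<comment> \<open>The factors are replaced by \<open>\<phi> i\<close> and
        \<open>\<psi> j\<close> with the error of \<open>nrm_elem_minus_elem\<close>; the resulting
        elementary tensor is the section whose index codes the one-element list.\<close>
      let ?G = "\<lambda>(i, j) z. ndiff (V (fst (fst z))) (snd (fst z)) (\<phi> i (fst (fst z))) * nrm (W (fst (snd z))) (snd (snd z))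
        + nrm (V (fst (fst z))) (\<phi> i (fst (fst z))) * ndiff (W (fst (snd z))) (snd (snd z)) (\<psi> j (fst (snd z)))
        + ndiff (fibre (fst (fst z))) (\<xi> (to_nat [(i, j)]) (fst (fst z))) (\<xi> n (fst (fst z)))"
      show "?G ij \<in> borel_measurable ?P" for ij
        unfolding split_beta
        by (intro borel_measurable_add borel_measurable_times dV dW field_nrm[OF fields(2) g]
            measurable_compose[OF x U.section_diff] measurable_compose[OF x nrm_sections(1)])
      fix z assume z: "z \<in> space ?P"
      define y where "y = fst (fst z)"
      define v where "v = snd (fst z)"
      define w where "w = snd (snd z)"
      have y: "y \<in> space X" and v: "v \<in> carrier (V y)" and w: "w \<in> carrier (W y)" and y2: "fst (snd z) = y"
        using mem[OF z] by (simp_all add: y_def v_def w_def)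
      interpret V: complex_normed_space "V y" by (rule normed(1)[OF y])
      interpret W: complex_normed_space "W y" by (rule normed(2)[OF y])
      interpret U: complex_normed_space "fibre y" by (rule fibre_normed[OF y])
      have G: "?G (i, j) z = ndiff (V y) v (\<phi> i y) * nrm (W y) w + nrm (V y) (\<phi> i y) * ndiff (W y) w (\<psi> j y)
          + ndiff (fibre y) (elem y (\<phi> i y) (\<psi> j y)) (\<xi> n y)" for i j
        using tsum_single[OF y, of i j] y2 by (simp add: y_def[symmetric] v_def w_def \<xi>_def)
      have F: "?F z = ndiff (fibre y) (elem y v w) (\<xi> n y)" by (simp add: y_def v_def w_def)
      have c1: "elem y v w \<in> carrier (fibre y)" and c2: "elem y (\<phi> i y) (\<psi> j y) \<in> carrier (fibre y)" and c3: "\<xi> n y \<in> carrier (fibre y)" for i j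
        using elem_closed[OF y] v w closed[OF y] U.closed[OF y] by simp_all
      have 1: "ndiff (fibre y) (elem y v w) (elem y (\<phi> i y) (\<psi> j y)) \<le>
          ndiff (V y) v (\<phi> i y) * nrm (W y) w + nrm (V y) (\<phi> i y) * ndiff (W y) w (\<psi> j y)" for i j
        by (rule nrm_elem_minus_elem[OF y v closed(1)[OF y] w closed(2)[OF y]])
      show "?F z \<le> ?G ij z" for ij
      proof -
        obtain i j where ij: "ij = (i, j)" by (cases ij)
        show ?thesis unfolding ij G F using U.nrm_minus_triangle[OF c1 c2 c3, of i j] 1[of i j] by linarith
      qed
      fix e :: real assume e: "e > 0"
      have w1: "nrm (W y) w + 1 > 0" using w by (simp add: add_nonneg_pos)
      obtain i where i: "ndiff (V y) v (\<phi> i y) < e / 4 / (nrm (W y) w + 1)"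
        using nearV[OF y v, of "e / 4 / (nrm (W y) w + 1)"] e w1 by auto
      have i1: "nrm (V y) (\<phi> i y) + 1 > 0" using closed[OF y] by (simp add: add_nonneg_pos)
      obtain j where j: "ndiff (W y) w (\<psi> j y) < e / 4 / (nrm (V y) (\<phi> i y) + 1)"
        using nearW[OF y w, of "e / 4 / (nrm (V y) (\<phi> i y) + 1)"] e i1 by auto
      have "ndiff (V y) v (\<phi> i y) * (nrm (W y) w + 1) < e / 4" using i unfolding pos_less_divide_eq[OF w1] .
      moreover have "ndiff (V y) v (\<phi> i y) * nrm (W y) w \<le> ndiff (V y) v (\<phi> i y) * (nrm (W y) w + 1)"
        using v closed[OF y] by (intro mult_left_mono) auto
      moreover have "ndiff (W y) w (\<psi> j y) * (nrm (V y) (\<phi> i y) + 1) < e / 4" using j unfolding pos_less_divide_eq[OF i1] .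
      moreover have "nrm (V y) (\<phi> i y) * ndiff (W y) w (\<psi> j y) \<le> ndiff (W y) w (\<psi> j y) * (nrm (V y) (\<phi> i y) + 1)"
        using w closed[OF y] by (simp add: algebra_simps)
      moreover have "ndiff (fibre y) (elem y (\<phi> i y) (\<psi> j y)) (\<xi> n y) \<le>
          ndiff (fibre y) (elem y v w) (elem y (\<phi> i y) (\<psi> j y)) + ndiff (fibre y) (elem y v w) (\<xi> n y)"
        using U.nrm_minus_triangle[OF c2 c1 c3, of i j] U.nrm_minus_commute[OF c2 c1, of i j] by simp
      ultimately have "?G (i, j) z < ?F z + e"
        unfolding G F using 1[of i j] e by linarith
      then show "\<exists>ij. ?G ij z < ?F z + e" by (rule exI)
    qed
    then show "(\<lambda>z. ndiff (fibre (fst (?h z))) (snd (?h z)) (\<xi> n (fst (?h z)))) \<in> borel_measurable ?P"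
      by simp
  qed
  then show ?thesis by (simp add: split_beta')
qed

text \<open>Measurability of the canonical map makes the elementary sections Borel for M, and the
  operations of the field then make every \<open>\<xi> n\<close> Borel, which is what
  \<open>sets_field_eq\<close> asks for.\<close>

lemma sets_tensor_field_eq:
  assumes M: "borel_banach_field X fibre M"
    and t: "(\<lambda>((x, v), (y, w)). (x, elem x v w)) \<in> fibre_product MV MW \<rightarrow>\<^sub>M M"
  shows "sets M = sets U.M0"
proof (rule U.sets_field_eq[OF M])
  have el: "(\<lambda>x. (x, elem x (\<phi> i x) (\<psi> j x))) \<in> X \<rightarrow>\<^sub>M M" for i j
    using measurable_compose[OF measurable_fibre_product[OF sections(1)[unfolded borel_section_def, of i] sections(2)[unfolded borel_section_def, of j]] t]
    by simp
  have "(\<lambda>x. (x, tsum I x)) \<in> X \<rightarrow>\<^sub>M M" for I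
  proof (induction I)
    case Nil
    \<comment> \<open>The zero section is reached as 0 times an elementary one, through the
      measurable scalar multiplication.\<close>
    have "(\<lambda>x. (x, 0 \<odot>\<^bsub>fibre x\<^esub> elem x (\<phi> 0 x) (\<psi> 0 x))) \<in> X \<rightarrow>\<^sub>M M"
      using field_smult[OF M el[of 0 0], of "\<lambda>_. 0"] by simp
    then show ?case
    proof (rule measurable_cong[THEN iffD1, rotated])
      fix x assume x: "x \<in> space X"
      have "0 \<odot>\<^bsub>fibre x\<^esub> elem x (\<phi> 0 x) (\<psi> 0 x) = \<zero>\<^bsub>fibre x\<^esub>"
        by (rule complex_normed_space.smult_simps(6)[OF fibre_normed[OF x] elem_closed[OF x closed(1)[OF x] closed(2)[OF x]]])
      then show "(x, 0 \<odot>\<^bsub>fibre x\<^esub> elem x (\<phi> 0 x) (\<psi> 0 x)) = (x, tsum [] x)"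
        by (simp add: tsum_Nil[OF x])
    qed
  next
    case (Cons p I)
    obtain i j where p: "p = (i, j)" by (cases p)
    have "(\<lambda>x. (x, elem x (\<phi> i x) (\<psi> j x) \<oplus>\<^bsub>fibre x\<^esub> tsum I x)) \<in> X \<rightarrow>\<^sub>M M"
      using field_add[OF M el[of i j] Cons.IH] by simp
    then show ?case
      by (rule measurable_cong[THEN iffD1, rotated]) (simp add: p tsum_Cons)
  qed
  then show "borel_section X M (\<xi> n)" for n
    unfolding borel_section_def \<xi>_def .
qed

lemma ex1_structure:
  "\<exists>!S. \<exists>M. sets M = S \<and> borel_banach_field X fibre M \<and>
     (\<lambda>((x, v), (y, w)). (x, elem x v w)) \<in> fibre_product MV MW \<rightarrow>\<^sub>M M"
  by (rule ex1I[of _ "sets U.M0"]) (use U.borel_banach_field_M0 measurable_elem_M0 sets_tensor_field_eq in blast)+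

end

section \<open>The canonical map from the projective to the injective tensor product\<close>

context normed_pair
begin

interpretation P: complex_normed_space "alg_tensor (proj_norm E F) E F" by (rule normed_proj)
interpretation I: complex_normed_space "alg_tensor (inj_norm E F) E F" by (rule normed_inj)
interpretation PC: complex_normed_space "completion (alg_tensor (proj_norm E F) E F)" by (rule P.complex_normed_space_completion)
interpretation IC: complex_normed_space "completion (alg_tensor (inj_norm E F) E F)" by (rule I.complex_normed_space_completion)

text \<open>Both completions start from the same algebraic tensor product, on which the identity is
  contractive because the injective norm is the smaller one. It therefore preserves Cauchy sequences
  and their equivalence, and passes to classes.\<close>

lemma ex_canonical_map: "\<exists>j. canonical_map E F j"
proof -
  let ?P = "alg_tensor (proj_norm E F) E F" and ?I = "alg_tensor (inj_norm E F) E F"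
  have car: "carrier ?P = carrier ?I" and add: "a \<oplus>\<^bsub>?P\<^esub> b = a \<oplus>\<^bsub>?I\<^esub> b" and sm: "c \<odot>\<^bsub>?P\<^esub> a = c \<odot>\<^bsub>?I\<^esub> a" for a b c
    by (simp_all add: alg_tensor_def)
  have le: "inj_norm E F t \<le> proj_norm E F t" if "t \<in> carrier ?P" for t
    using that inj_norm_le_proj_norm by (elim alg_tensor_cases) simp
  have minus: "a \<ominus>\<^bsub>?P\<^esub> b = a \<ominus>\<^bsub>?I\<^esub> b" if "a \<in> carrier ?P" "b \<in> carrier ?P" for a b
    using that P.minus_eq_smult[of a b] I.minus_eq_smult[of a b] by (simp add: car add sm)
  have le_minus: "inj_norm E F (a \<ominus>\<^bsub>?I\<^esub> b) \<le> proj_norm E F (a \<ominus>\<^bsub>?P\<^esub> b)"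
    if "a \<in> carrier ?P" "b \<in> carrier ?P" for a b
    using le[OF P.minus_closed'[OF that]] unfolding minus[OF that] .
  have C: "I.Met.MCauchy s" if s: "P.Met.MCauchy s" for s
    unfolding I.MCauchy_iff
  proof (intro conjI allI impI)
    show sc: "s n \<in> carrier ?I" for n using P.MCauchy_carrier[OF s] car by simp
    fix e :: real assume "e > 0"
    then obtain N where N: "\<forall>m\<ge>N. \<forall>n\<ge>N. proj_norm E F (s m \<ominus>\<^bsub>?P\<^esub> s n) < e"
      using s unfolding P.MCauchy_iff nrm_alg_tensor by blast
    have "inj_norm E F (s m \<ominus>\<^bsub>?I\<^esub> s n) < e" if "m \<ge> N" "n \<ge> N" for m n
      using le_minus[OF P.MCauchy_carrier[OF s] P.MCauchy_carrier[OF s], of m n] N[rule_format, OF that] by linarith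
    then show "\<exists>N. \<forall>m\<ge>N. \<forall>n\<ge>N. ndiff ?I (s m) (s n) < e" unfolding nrm_alg_tensor by blast
  qed
  have eqv: "(s, t) \<in> cauchy_equiv ?I" if st: "(s, t) \<in> cauchy_equiv ?P" for s t
  proof -
    have s: "P.Met.MCauchy s" and t: "P.Met.MCauchy t" and lim: "(\<lambda>n. proj_norm E F (s n \<ominus>\<^bsub>?P\<^esub> t n)) \<longlonglongrightarrow> 0"
      using st by (simp_all add: P.cauchy_equiv_iff)
    have "(\<lambda>n. inj_norm E F (s n \<ominus>\<^bsub>?I\<^esub> t n)) \<longlonglongrightarrow> 0"
    proof (rule tendsto_sandwich[OF _ _ tendsto_const lim])
      show "\<forall>\<^sub>F n in sequentially. 0 \<le> inj_norm E F (s n \<ominus>\<^bsub>?I\<^esub> t n)"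
        using I.nrm_nonneg[unfolded nrm_alg_tensor] I.minus_closed' I.MCauchy_carrier[OF C[OF s]] I.MCauchy_carrier[OF C[OF t]]
        by (intro always_eventually allI) blast
      show "\<forall>\<^sub>F n in sequentially. inj_norm E F (s n \<ominus>\<^bsub>?I\<^esub> t n) \<le> proj_norm E F (s n \<ominus>\<^bsub>?P\<^esub> t n)"
        by (intro always_eventually allI le_minus P.MCauchy_carrier[OF s] P.MCauchy_carrier[OF t])
    qed
    then show ?thesis using C[OF s] C[OF t] by (simp add: I.cauchy_equiv_iff)
  qed
  \<comment> \<open>All representatives of a projective class lie in one injective class, so the
    union is just that class.\<close>
  define j where "j A = (\<Union>s\<in>A. I.lim_class s)" for A
  have j: "j (P.lim_class s) = I.lim_class s" if s: "P.Met.MCauchy s" for s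
  proof -
    have "congruent (cauchy_equiv ?P) I.lim_class"
    proof (rule congruentI)
      fix s t assume st: "(s, t) \<in> cauchy_equiv ?P"
      show "I.lim_class s = I.lim_class t"
        unfolding I.lim_class_def by (rule equiv_class_eq[OF I.equiv_cauchy_equiv eqv[OF st]])
    qed
    from UN_equiv_class[OF P.equiv_cauchy_equiv this] s show ?thesis
      by (simp add: j_def P.lim_class_def)
  qed
  have lin: "j \<in> linear_maps (completion ?P) (completion ?I)"
    unfolding linear_maps_def
  proof (intro CollectI conjI ballI allI)
    show "j \<in> carrier (completion ?P) \<rightarrow> carrier (completion ?I)"
      using j C by (auto simp: P.carrier_completion I.carrier_completion)
  next
    fix A B assume "A \<in> carrier (completion ?P)" "B \<in> carrier (completion ?P)"
    then obtain s t where s: "P.Met.MCauchy s" "A = P.lim_class s" and t: "P.Met.MCauchy t" "B = P.lim_class t"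
      by (metis P.completion_cases)
    show "j (A \<oplus>\<^bsub>completion ?P\<^esub> B) = j A \<oplus>\<^bsub>completion ?I\<^esub> j B"
      using j[OF P.MCauchy_add[OF s(1) t(1)]] j[OF s(1)] j[OF t(1)] C[OF s(1)] C[OF t(1)]
      by (simp add: s t P.add_completion I.add_completion add)
  next
    fix c A assume "A \<in> carrier (completion ?P)"
    then obtain s where s: "P.Met.MCauchy s" "A = P.lim_class s" by (rule P.completion_cases)
    show "j (c \<odot>\<^bsub>completion ?P\<^esub> A) = c \<odot>\<^bsub>completion ?I\<^esub> j A"
      using j[OF P.MCauchy_smult[OF s(1), of c]] j[OF s(1)] C[OF s(1)]
      by (simp add: s P.smult_completion I.smult_completion sm)
  qed
  moreover have "nrm (completion ?I) (j A) \<le> nrm (completion ?P) A" if A: "A \<in> carrier (completion ?P)" for A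
  proof -
    obtain s where s: "P.Met.MCauchy s" "A = P.lim_class s" using A by (rule P.completion_cases)
    show ?thesis
      unfolding s(2) j[OF s(1)]
      by (rule LIMSEQ_le[OF I.tendsto_nrm_completion[OF C[OF s(1)]] P.tendsto_nrm_completion[OF s(1)]])
        (use le P.MCauchy_carrier[OF s(1)] in auto)
  qed
  moreover have "j (proj_elem E F v w) = inj_elem E F v w" if "v \<in> carrier E" "w \<in> carrier F" for v w
  proof -
    have "pairs [(v, w)]" using that by simp
    then have "P.Met.MCauchy (\<lambda>n. ts [(v, w)])" by simp
    from j[OF this] show ?thesis
      unfolding proj_elem_def inj_elem_def P.to_completion_eq I.to_completion_eq .
  qed
  ultimately show ?thesis
    unfolding canonical_map_def proj_tensor_def inj_tensor_def contractions_def by blast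
qed

end

text \<open>Both structures are generated by the distances to the tensors \<open>\<Sum> \<phi>\<^sub>i \<otimes> \<psi>\<^sub>j\<close>, and the canonical map
  preserves these and is contractive.\<close>

lemma measurable_contraction:
  assumes P: "dense_sections X U \<xi>" and I: "dense_sections X U' \<xi>'"
    and J: "\<And>x. x \<in> space X \<Longrightarrow> J x \<in> contractions (U x) (U' x)"
    and J\<xi>: "\<And>x n. x \<in> space X \<Longrightarrow> J x (\<xi> n x) = \<xi>' n x"
  shows "(\<lambda>(x, t). (x, J x t)) \<in> dense_sections.M0 X U \<xi> \<rightarrow>\<^sub>M dense_sections.M0 X U' \<xi>'"
proof -
  interpret P: dense_sections X U \<xi> by (rule P)
  interpret I: dense_sections X U' \<xi>' by (rule I)
  let ?h = "\<lambda>p. (fst p, J (fst p) (snd p))"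
  have Jl: "J x \<in> linear_maps (U x) (U' x)" if "x \<in> space X" for x
    using J[OF that] by (simp add: contractions_def)
  have Jc: "J x t \<in> carrier (U' x)" if "x \<in> space X" "t \<in> carrier (U x)" for x t
    using Jl[OF that(1)] that(2) by (auto simp: linear_maps_def)
  have "?h \<in> P.M0 \<rightarrow>\<^sub>M I.M0"
  proof (rule I.measurable_M0I)
    show "?h \<in> space P.M0 \<rightarrow> I.total" using P.M0_mem Jc by (auto simp: I.total_def)
    show "(\<lambda>p. fst (?h p)) \<in> P.M0 \<rightarrow>\<^sub>M X" using P.fst_M0 by simp
    fix n
    let ?F = "\<lambda>p. ndiff (U' (fst p)) (J (fst p) (snd p)) (\<xi>' n (fst p))"
    have "?F \<in> borel_measurable P.M0"
    proof (rule borel_measurable_of_approx_inf)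
      let ?G = "\<lambda>i p. ndiff (U (fst p)) (snd p) (\<xi> i (fst p)) + ndiff (U' (fst p)) (\<xi>' i (fst p)) (\<xi>' n (fst p))"
      show "?G i \<in> borel_measurable P.M0" for i
        by (intro borel_measurable_add P.dist_M0 measurable_compose[OF P.fst_M0 I.section_diff])
      fix p assume p: "p \<in> space P.M0"
      define x where "x = fst p"
      define t where "t = snd p"
      have x: "x \<in> space X" and t: "t \<in> carrier (U x)" using P.M0_mem[OF p] by (simp_all add: x_def t_def)
      interpret U: complex_normed_space "U x" by (rule P.normed[OF x])
      interpret U': complex_normed_space "U' x" by (rule I.normed[OF x])
      have G: "?G i p = ndiff (U x) t (\<xi> i x) + ndiff (U' x) (\<xi>' i x) (\<xi>' n x)" for i
        by (simp add: x_def t_def)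
      have F: "?F p = ndiff (U' x) (J x t) (\<xi>' n x)" by (simp add: x_def t_def)
      have 1: "ndiff (U' x) (J x t) (\<xi>' i x) \<le> ndiff (U x) t (\<xi> i x)" for i
        using J[OF x] U.minus_closed'[OF t P.closed[OF x], of i]
          linear_maps_minus[OF P.normed[OF x] I.normed[OF x] Jl[OF x] t P.closed[OF x], of i] J\<xi>[OF x, of i]
        by (auto simp: contractions_def)
      show "?F p \<le> ?G i p" for i
        unfolding F G using U'.nrm_minus_triangle[OF Jc[OF x t] I.closed[OF x] I.closed[OF x], of n i] 1[of i] by linarith
      fix e :: real assume e: "e > 0"
      obtain i where i: "ndiff (U x) t (\<xi> i x) < e / 2" using P.near[OF x t, of "e / 2"] e by auto
      have "?G i p < ?F p + e"
        unfolding F G using U'.nrm_minus_triangle[OF I.closed[OF x] Jc[OF x t] I.closed[OF x], of i n]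
          U'.nrm_minus_commute[OF I.closed[OF x] Jc[OF x t], of i] 1[of i] i by linarith
      then show "\<exists>i. ?G i p < ?F p + e" by (rule exI)
    qed
    then show "(\<lambda>p. ndiff (U' (fst (?h p))) (snd (?h p)) (\<xi>' n (fst (?h p)))) \<in> borel_measurable P.M0"
      by simp
  qed
  then show ?thesis by (simp add: split_beta')
qed

lemma section_nrm_measurable:
  assumes "borel_banach_field X V M" "borel_section X M \<phi>"
  shows "(\<lambda>x. nrm (V x) (\<phi> x)) \<in> borel_measurable X"
  using field_nrm[OF assms(1) assms(2)[unfolded borel_section_def]] by simp

theorem proposition11p1:
  fixes X :: "'x measure"
    and V :: "'x \<Rightarrow> 'v normed_module" and MV :: "('x \<times> 'v) measure"
    and W :: "'x \<Rightarrow> 'w normed_module" and MW :: "('x \<times> 'w) measure"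
  assumes "borel_banach_field X V MV"
    and "borel_banach_field X W MW"
  shows "(\<exists>!S. \<exists>M. sets M = S \<and> inj_tensor_field X V MV W MW M) \<and>
    (\<exists>!S. \<exists>M. sets M = S \<and> proj_tensor_field X V MV W MW M) \<and>
    (\<exists>J. \<forall>x\<in>space X. canonical_map (V x) (W x) (J x)) \<and>
    (\<forall>J P M. (\<forall>x\<in>space X. canonical_map (V x) (W x) (J x)) \<longrightarrow>
       proj_tensor_field X V MV W MW P \<longrightarrow> inj_tensor_field X V MV W MW M \<longrightarrow>
       (\<lambda>(x, t). (x, J x t)) \<in> P \<rightarrow>\<^sub>M M)"
proof -
  have "\<exists>\<phi> :: nat \<Rightarrow> 'x \<Rightarrow> 'v. (\<forall>n. borel_section X MV (\<phi> n)) \<and>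
      (\<forall>x\<in>space X. norm_topology (V x) closure_of range (\<lambda>n. \<phi> n x) = carrier (V x))"
    using assms(1) by (simp add: borel_banach_field_def)
  then obtain \<phi> :: "nat \<Rightarrow> 'x \<Rightarrow> 'v" where \<phi>': "\<forall>n. borel_section X MV (\<phi> n)"
    "\<forall>x\<in>space X. norm_topology (V x) closure_of range (\<lambda>n. \<phi> n x) = carrier (V x)"
    by (elim exE conjE)
  have \<phi>: "borel_section X MV (\<phi> n)" for n using \<phi>'(1) by (rule spec)
  have \<phi>d: "norm_topology (V x) closure_of range (\<lambda>n. \<phi> n x) = carrier (V x)" if "x \<in> space X" for x
    using \<phi>'(2) that by (rule bspec)
  have "\<exists>\<psi> :: nat \<Rightarrow> 'x \<Rightarrow> 'w. (\<forall>n. borel_section X MW (\<psi> n)) \<and>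
      (\<forall>x\<in>space X. norm_topology (W x) closure_of range (\<lambda>n. \<psi> n x) = carrier (W x))"
    using assms(2) by (simp add: borel_banach_field_def)
  then obtain \<psi> :: "nat \<Rightarrow> 'x \<Rightarrow> 'w" where \<psi>': "\<forall>n. borel_section X MW (\<psi> n)"
    "\<forall>x\<in>space X. norm_topology (W x) closure_of range (\<lambda>n. \<psi> n x) = carrier (W x)"
    by (elim exE conjE)
  have \<psi>: "borel_section X MW (\<psi> n)" for n using \<psi>'(1) by (rule spec)
  have \<psi>d: "norm_topology (W x) closure_of range (\<lambda>n. \<psi> n x) = carrier (W x)" if "x \<in> space X" for x
    using \<psi>'(2) that by (rule bspec)
  interpret S: section_pair X V W \<phi> \<psi>
  proof (rule section_pair.intro)
    fix x assume x: "x \<in> space X"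
    show "complex_normed_space (V x)" by (rule field_normed[OF assms(1) x])
    show "complex_normed_space (W x)" by (rule field_normed[OF assms(2) x])
    show "\<phi> n x \<in> carrier (V x)" for n by (rule field_section_closed[OF assms(1) \<phi> x])
    show "\<psi> n x \<in> carrier (W x)" for n by (rule field_section_closed[OF assms(2) \<psi> x])
    show "norm_topology (V x) closure_of range (\<lambda>n. \<phi> n x) = carrier (V x)" by (rule \<phi>d[OF x])
    show "norm_topology (W x) closure_of range (\<lambda>n. \<psi> n x) = carrier (W x)" by (rule \<psi>d[OF x])
  qed (rule field_combination[OF assms(1) \<phi> \<phi> \<phi>] field_combination[OF assms(2) \<psi> \<psi> \<psi>]
      section_nrm_measurable[OF assms(1) \<phi>] section_nrm_measurable[OF assms(2) \<psi>])+
  interpret I: tensor_field_data X V W \<phi> \<psi> MV MW "\<lambda>x. inj_norm (V x) (W x)"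
    by (intro tensor_field_data.intro tensor_field_data_axioms.intro S.section_pair_axioms assms \<phi> \<psi>
        S.measurable_inj_norm normed_pair.tensor_norm_inj S.normed_pair)
  interpret P: tensor_field_data X V W \<phi> \<psi> MV MW "\<lambda>x. proj_norm (V x) (W x)"
    by (intro tensor_field_data.intro tensor_field_data_axioms.intro S.section_pair_axioms assms \<phi> \<psi>
        S.measurable_proj_norm normed_pair.tensor_norm_proj S.normed_pair)
  have fI: "I.fibre = (\<lambda>x. V x \<otimes>\<^sub>\<or> W x)" and fP: "P.fibre = (\<lambda>x. V x \<otimes>\<^sub>\<and> W x)"
    by (simp_all add: fun_eq_iff I.fibre_def P.fibre_def inj_tensor_def proj_tensor_def)
  have eI: "I.elem = (\<lambda>x. inj_elem (V x) (W x))" and eP: "P.elem = (\<lambda>x. proj_elem (V x) (W x))"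
    by (simp_all add: fun_eq_iff I.elem_def P.elem_def inj_elem_def proj_elem_def)
  have inj_iff: "inj_tensor_field X V MV W MW M \<longleftrightarrow> borel_banach_field X I.fibre M \<and>
      (\<lambda>((x, v), (y, w)). (x, I.elem x v w)) \<in> fibre_product MV MW \<rightarrow>\<^sub>M M" for M
    unfolding inj_tensor_field_def fI eI ..
  have proj_iff: "proj_tensor_field X V MV W MW M \<longleftrightarrow> borel_banach_field X P.fibre M \<and>
      (\<lambda>((x, v), (y, w)). (x, P.elem x v w)) \<in> fibre_product MV MW \<rightarrow>\<^sub>M M" for M
    unfolding proj_tensor_field_def fP eP ..
  have "\<forall>x\<in>space X. \<exists>j. canonical_map (V x) (W x) j"
    by (intro ballI normed_pair.ex_canonical_map S.normed_pair)
  then have ex: "\<exists>J. \<forall>x\<in>space X. canonical_map (V x) (W x) (J x)"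
    by (rule bchoice)
  have meas: "(\<lambda>(x, t). (x, J x t)) \<in> P \<rightarrow>\<^sub>M M"
    if J: "\<forall>x\<in>space X. canonical_map (V x) (W x) (J x)"
      and P: "proj_tensor_field X V MV W MW P" and M: "inj_tensor_field X V MV W MW M" for J P M
  proof -
    \<comment> \<open>By uniqueness P and M carry the structures generated by the distances, for
      which measurability can be checked on distances.\<close>
    have sP: "sets P = sets P.U.M0"
      using P unfolding proj_iff by (elim conjE) (rule P.sets_tensor_field_eq)
    have sM: "sets M = sets I.U.M0"
      using M unfolding inj_iff by (elim conjE) (rule I.sets_tensor_field_eq)
    have Jc: "J x \<in> contractions (P.fibre x) (I.fibre x)" if "x \<in> space X" for x
      using bspec[OF J that] unfolding fI fP canonical_map_def by (rule conjunct1)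
    have Je: "J x (P.elem x v w) = I.elem x v w" if "x \<in> space X" "v \<in> carrier (V x)" "w \<in> carrier (W x)" for x v w
      using bspec[OF J that(1)] that(2,3) unfolding eI eP canonical_map_def by simp
    \<comment> \<open>A canonical map is prescribed on elementary tensors only; linearity extends
      this to the finite sums that form the dense sections.\<close>
    have Js: "J x (P.tsum L x) = I.tsum L x" if x: "x \<in> space X" for x L
    proof (induction L)
      case Nil
      have "J x \<in> linear_maps (P.fibre x) (I.fibre x)" using Jc[OF x] by (simp add: contractions_def)
      from linear_maps_zero[OF P.fibre_normed[OF x] I.fibre_normed[OF x] this]
      show ?case by (simp add: P.tsum_Nil[OF x] I.tsum_Nil[OF x])
    next
      case (Cons p L)
      obtain i j where p: "p = (i, j)" by (cases p)
      have "J x (P.elem x (\<phi> i x) (\<psi> j x) \<oplus>\<^bsub>P.fibre x\<^esub> P.tsum L x) = J x (P.elem x (\<phi> i x) (\<psi> j x)) \<oplus>\<^bsub>I.fibre x\<^esub> J x (P.tsum L x)"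
        using Jc[OF x] P.elem_closed[OF x S.closed(1)[OF x] S.closed(2)[OF x]] P.tsum_closed[OF x]
        by (auto simp: contractions_def linear_maps_def)
      then show ?case
        unfolding p P.tsum_Cons[OF x] I.tsum_Cons[OF x] Cons.IH Je[OF x S.closed(1)[OF x] S.closed(2)[OF x]] .
    qed
    have "(\<lambda>(x, t). (x, J x t)) \<in> P.U.M0 \<rightarrow>\<^sub>M I.U.M0"
      by (rule measurable_contraction[OF P.U.dense_sections_axioms I.U.dense_sections_axioms Jc])
        (simp_all add: P.\<xi>_def I.\<xi>_def Js)
    then show ?thesis
      by (simp only: measurable_cong_sets[OF sP sM])
  qed
  show ?thesis
    unfolding inj_iff proj_iff
    using I.ex1_structure P.ex1_structure ex meas[unfolded inj_iff proj_iff] by (intro conjI allI impI)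
qed

end
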